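(* Let $V\subseteq L^2(\mathbb{R}^d)$ be a uniformly localizable reproducing kernel Hilbert space. Then there exists a separated set $\Lambda\subseteq\mathbb{R}^d$ with the following properties. (i) ($\ell^1$–$\ell^\infty$ interpolation) There exists a collection of functions $\{l_\lambda:\lambda\in\Lambda\}\subseteq V^\infty$ such that $\|l_\lambda\|_\infty=1$ and $$l_\lambda(\lambda')=\delta_{\lambda,\lambda'},\qquad\lambda,\lambda'\in\Lambda.$$ In particular, given $a\in\ell^1(\Lambda)$, the function $f=\sum_{\lambda\in\Lambda}a_\lambda l_\lambda$ belongs to $V^\infty$ and satisfies $f(\lambda)=a_\lambda$ for all $\lambda\in\Lambda$. (ii) ($\ell^1$–$\ell^\infty$ sampling) For all $f\in V^1$, $$\|f\|_\infty\le\sum_{\lambda\in\Lambda}|f(\lambda)|.$$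
   Context: A set $\Lambda\subseteq\mathbb{R}^d$ is relatively separated if $\sup_{x}\#(\Lambda\cap B_1(x))<\infty$, and separated if $\inf\{|\lambda-\lambda'|:\lambda\ne\lambda'\in\Lambda\}>0$. $W(L^\infty,L^1)(\mathbb{R}^d)$ is the space of $f\in L^\infty(\mathbb{R}^d)$ with $\int_{\mathbb{R}^d}\|f\|_{L^\infty(B_1(x))}dx<\infty$. A closed subspace $V\subseteq L^2(\mathbb{R}^d)$ is a localizable reproducing kernel Hilbert space if there exist a relatively separated set $\Gamma\subseteq\mathbb{R}^d$, a function $\Theta\in W(L^\infty,L^1)(\mathbb{R}^d)$, and a frame $\{F_\gamma:\gamma\in\Gamma\}$ of $V$ consisting of continuous functions with $|F_\gamma(x)|\le\Theta(x-\gamma)$ for all $\gamma\in\Gamma$, $x\in\mathbb{R}^d$. For $1\le p\le\infty$, $V^p:=\{\sum_{\gamma\in\Gamma}c_\gamma F_\gamma:c\in\ell^p(\Gamma)\}\subseteq L^p(\mathbb{R}^d)$, the series converging unconditionally in $L^p$ for $p<\infty$ and weak$^*$ for $p=\infty$. The spaces $V^p$ do not depend on the choice of the frame, are closed in $L^p(\mathbb{R}^d)$, and consist of continuous functions, so point values make sense. $V$ is uniformly localizable if it is localizable and $$\sup_{x,y\in\mathbb{R}^d,\,|x-y|\le\delta}\ \sup_{f\in V^\infty,\,\|f\|_\infty\le1}\big||f(x)|-|f(y)|\big|\to0\quad\text{as }\delta\to0^+.$$ *)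

theory Defs
  imports "HOL-Probability.Essential_Supremum"
begin

text \<open>
  Elements of Lebesgue spaces are represented by functions, not by classes modulo null sets. All
  function spaces are complex. For finite exponents we use a real \<open>p\<close> with \<open>1 \<le> p\<close>; the
  exponent \<open>\<infinity>\<close> is treated separately.
\<close>

definition Lp :: "real \<Rightarrow> ('a::euclidean_space \<Rightarrow> complex) set" where
  "Lp p = {f \<in> borel_measurable lebesgue. integrable lebesgue (\<lambda>x. norm (f x) powr p)}"

definition Lp_norm :: "real \<Rightarrow> ('a::euclidean_space \<Rightarrow> complex) \<Rightarrow> real" where
  "Lp_norm p f = (LINT x|lebesgue. norm (f x) powr p) powr (1 / p)"

definition L2_inner :: "('a::euclidean_space \<Rightarrow> complex) \<Rightarrow> ('a \<Rightarrow> complex) \<Rightarrow> complex" where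
  "L2_inner f g = (LINT x|lebesgue. f x * cnj (g x))"

definition Linf_norm_on :: "'a::euclidean_space set \<Rightarrow> ('a \<Rightarrow> 'b::real_normed_vector) \<Rightarrow> ennreal" where
  "Linf_norm_on S f = esssup (restrict_space lebesgue S) (\<lambda>x. ennreal (norm (f x)))"

abbreviation Linf_norm :: "('a::euclidean_space \<Rightarrow> 'b::real_normed_vector) \<Rightarrow> ennreal" where
  "Linf_norm \<equiv> Linf_norm_on UNIV"

definition Linf :: "('a::euclidean_space \<Rightarrow> 'b::real_normed_vector) set" where
  "Linf = {f \<in> borel_measurable lebesgue. Linf_norm f < \<infinity>}"

text \<open>The Wiener amalgam space \<open>W(L\<^sup>\<infinity>, L\<^sup>1)\<close>.\<close>

definition W_Linf_L1 :: "('a::euclidean_space \<Rightarrow> 'b::real_normed_vector) set" where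
  "W_Linf_L1 = {f \<in> Linf. (\<integral>\<^sup>+ x. Linf_norm_on (ball x 1) f \<partial>lebesgue) < \<infinity>}"

definition relatively_separated :: "'a::euclidean_space set \<Rightarrow> bool" where
  "relatively_separated \<Gamma> \<longleftrightarrow>
     (\<exists>N. \<forall>x. finite (\<Gamma> \<inter> ball x 1) \<and> card (\<Gamma> \<inter> ball x 1) \<le> N)"

text \<open>
  The closure condition is stated for the \<open>L\<^sup>2\<close> seminorm on functions, so (take a constant sequence)
  it also forces \<open>V\<close> to be saturated under almost everywhere equality: such a \<open>V\<close> is exactly the
  preimage of a closed subspace of the space of classes.
\<close>

definition closed_subspace_L2 :: "('a::euclidean_space \<Rightarrow> complex) set \<Rightarrow> bool" where
  "closed_subspace_L2 V \<longleftrightarrow>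
     V \<subseteq> Lp 2 \<and> (\<lambda>x. 0) \<in> V \<and>
     (\<forall>f\<in>V. \<forall>g\<in>V. (\<lambda>x. f x + g x) \<in> V) \<and>
     (\<forall>a. \<forall>f\<in>V. (\<lambda>x. a * f x) \<in> V) \<and>
     (\<forall>u f. (\<forall>n::nat. u n \<in> V) \<longrightarrow> f \<in> Lp 2 \<longrightarrow>
        (\<lambda>n. Lp_norm 2 (\<lambda>x. u n x - f x)) \<longlonglongrightarrow> 0 \<longrightarrow> f \<in> V)"

definition is_frame ::
    "('a::euclidean_space \<Rightarrow> complex) set \<Rightarrow> 'i set \<Rightarrow> ('i \<Rightarrow> 'a \<Rightarrow> complex) \<Rightarrow> bool" where
  "is_frame V \<Gamma> F \<longleftrightarrow>
     (\<forall>\<gamma>\<in>\<Gamma>. F \<gamma> \<in> V) \<and>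
     (\<exists>A>0. \<exists>B. \<forall>f\<in>V.
        (\<lambda>\<gamma>. (norm (L2_inner f (F \<gamma>)))\<^sup>2) summable_on \<Gamma> \<and>
        A * (Lp_norm 2 f)\<^sup>2 \<le> (\<Sum>\<^sub>\<infinity>\<gamma>\<in>\<Gamma>. (norm (L2_inner f (F \<gamma>)))\<^sup>2) \<and>
        (\<Sum>\<^sub>\<infinity>\<gamma>\<in>\<Gamma>. (norm (L2_inner f (F \<gamma>)))\<^sup>2) \<le> B * (Lp_norm 2 f)\<^sup>2)"

text \<open>\<open>V\<close> is a localizable reproducing kernel Hilbert space, as witnessed by the frame \<open>F\<close>.
  The frame is carried as data because it is what the spaces \<open>V\<^sup>p\<close> below are formed with.\<close>

definition localizable ::
    "('a::euclidean_space \<Rightarrow> complex) set \<Rightarrow> 'a set \<Rightarrow> ('a \<Rightarrow> 'a \<Rightarrow> complex) \<Rightarrow> bool" where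
  "localizable V \<Gamma> F \<longleftrightarrow>
     closed_subspace_L2 V \<and> relatively_separated \<Gamma> \<and> is_frame V \<Gamma> F \<and>
     (\<forall>\<gamma>\<in>\<Gamma>. continuous_on UNIV (F \<gamma>)) \<and>
     (\<exists>\<Theta> :: 'a \<Rightarrow> real. \<Theta> \<in> W_Linf_L1 \<and> (\<forall>\<gamma>\<in>\<Gamma>. \<forall>x. norm (F \<gamma> x) \<le> \<Theta> (x - \<gamma>)))"

text \<open>
  The spaces \<open>V\<^sup>p\<close> (\<open>p < \<infinity>\<close>) and \<open>V\<^sup>\<infinity>\<close>. Each class in these spaces has exactly one continuous
  representative, and that is the function we keep. Unconditional convergence is convergence
  along the net of finite subsets of the index set.
\<close>

definition Vp :: "real \<Rightarrow> 'a::euclidean_space set \<Rightarrow> ('a \<Rightarrow> 'a \<Rightarrow> complex) \<Rightarrow> ('a \<Rightarrow> complex) set" where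
  "Vp p \<Gamma> F = {f \<in> Lp p. continuous_on UNIV f \<and>
     (\<exists>c. (\<lambda>\<gamma>. norm (c \<gamma>) powr p) summable_on \<Gamma> \<and>
        ((\<lambda>S. Lp_norm p (\<lambda>x. f x - (\<Sum>\<gamma>\<in>S. c \<gamma> * F \<gamma> x))) \<longlongrightarrow> 0) (finite_subsets_at_top \<Gamma>))}"

definition Vinf :: "'a::euclidean_space set \<Rightarrow> ('a \<Rightarrow> 'a \<Rightarrow> complex) \<Rightarrow> ('a \<Rightarrow> complex) set" where
  "Vinf \<Gamma> F = {f \<in> Linf. continuous_on UNIV f \<and>
     (\<exists>c. bounded (c ` \<Gamma>) \<and>
        (\<forall>g\<in>Lp 1. ((\<lambda>S. LINT x|lebesgue. (\<Sum>\<gamma>\<in>S. c \<gamma> * F \<gamma> x) * g x)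
           \<longlongrightarrow> (LINT x|lebesgue. f x * g x)) (finite_subsets_at_top \<Gamma>)))}"

definition uniformly_localizable ::
    "('a::euclidean_space \<Rightarrow> complex) set \<Rightarrow> 'a set \<Rightarrow> ('a \<Rightarrow> 'a \<Rightarrow> complex) \<Rightarrow> bool" where
  "uniformly_localizable V \<Gamma> F \<longleftrightarrow>
     localizable V \<Gamma> F \<and>
     ((\<lambda>\<delta>. SUP (x, y)\<in>{(x, y). dist x y \<le> \<delta>}. SUP f\<in>{f \<in> Vinf \<Gamma> F. Linf_norm f \<le> 1}.
        ennreal \<bar>norm (f x) - norm (f y)\<bar>) \<longlongrightarrow> 0) (at_right 0)"

end

theory Submission
  imports Defs "HOL-Complex_Analysis.Great_Picard"
begin

text \<open>
  The set \<open>\<Lambda>\<close> is a limit of Fekete points. In the span of finitely many frame elements, nodes that nearly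
  maximise the determinant of the evaluation matrix have Lagrange functions bounded by \<open>1 + \<epsilon>\<close>: exchanging
  one node for \<open>x\<close> multiplies the determinant by the value at \<open>x\<close> of its Lagrange function. A Lagrange
  function is one at its own node and zero at the others, so the modulus of continuity keeps the nodes
  apart, uniformly in the finite family. Along a subsequence of an exhaustion of \<open>\<Gamma>\<close> both the nodes and the
  Lagrange functions converge, and the finite sampling inequality passes to the limit because the elements
  of \<open>V\<^sup>1\<close> have a summable majorant on the cells of a lattice.

  For the limit functions to lie in \<open>V\<^sup>\<infinity>\<close> the Lagrange functions need uniformly bounded coefficients. This
  amounts to the boundedness on \<open>\<ell>\<^sup>\<infinity>\<close> of the pseudo-inverse of the Gram matrix \<open>T\<close>, which has a spectral gap
  \<open>(0, A)\<close> on \<open>\<ell>\<^sup>2\<close> and is dominated by a convolution. For \<open>0 < |z| \<le> A / 2\<close> the lower bound of \<open>T - z\<close> on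
  \<open>\<ell>\<^sup>2\<close> is transferred to \<open>\<ell>\<^sup>\<infinity>\<close> by commuting with slowly varying weights. Averaging over the \<open>M\<close>-th roots
  of unity (in the form of a doubling argument) turns this into a bound of \<open>T\<^sup>M\<^sup>-\<^sup>1 v\<close> by \<open>(T\<^sup>M - z\<^sup>M) v\<close> with a
  constant independent of \<open>M\<close>. If \<open>v\<close> is chosen with \<open>T\<^sup>M v = y\<close> in the range of \<open>T\<close>, then \<open>z\<^sup>M v\<close> tends to
  zero and \<open>T\<^sup>M\<^sup>-\<^sup>1 v\<close> is the required preimage of \<open>y\<close>.
\<close>

subsection \<open>Summable sequences\<close>

text \<open>The frame may be redundant: \<open>T\<close> then has a kernel, a function has many
  coefficient families, and the Fekete construction controls none of them. The transferred resolvent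
  bound alone does not help, as its constant blows up when \<open>z\<close> tends to zero. So
  \<open>z\<close> stays on the circle of radius \<open>A / 4\<close> and the power \<open>M\<close>
  does the work: preimages under \<open>T\<^sup>M\<close> grow like \<open>(2 / A)\<^sup>M\<close>,
  and \<open>(A / 4)\<^sup>M\<close> beats this by \<open>2\<^sup>-\<^sup>M\<close>.

  The operators act on summable vectors, where sums converge absolutely and the suprema to be
  absorbed are finite. Exact inversion could leave this space; an approximate one stays in it, and
  its error is removed only at the level of functions.

  The nodes have no order that is consistent along the exhaustion. Cells smaller than the separation
  hold at most one node each, so a configuration is recorded by bounded data per cell, and a
  diagonal argument applies. The determinant is maximised over a noncompact space and a maximum need
  not exist; this is the origin of the tolerance \<open>1 + 1 / (n + 1)\<close>, which disappears in
  the limit.\<close>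

definition ell1 :: "'i set \<Rightarrow> ('i \<Rightarrow> complex) set" where
  "ell1 \<Gamma> = {u. (\<lambda>\<gamma>. norm (u \<gamma>)) summable_on \<Gamma>}"

definition ell2_inner :: "'i set \<Rightarrow> ('i \<Rightarrow> complex) \<Rightarrow> ('i \<Rightarrow> complex) \<Rightarrow> complex" where
  "ell2_inner \<Gamma> u v = (\<Sum>\<^sub>\<infinity>\<gamma>\<in>\<Gamma>. u \<gamma> * cnj (v \<gamma>))"

definition ell2_norm :: "'i set \<Rightarrow> ('i \<Rightarrow> complex) \<Rightarrow> real" where
  "ell2_norm \<Gamma> u = sqrt (\<Sum>\<^sub>\<infinity>\<gamma>\<in>\<Gamma>. (norm (u \<gamma>))\<^sup>2)"

definition mat_app :: "'i set \<Rightarrow> ('i \<Rightarrow> 'i \<Rightarrow> complex) \<Rightarrow> ('i \<Rightarrow> complex) \<Rightarrow> 'i \<Rightarrow> complex" where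
  "mat_app \<Gamma> G u \<gamma> = (\<Sum>\<^sub>\<infinity>\<gamma>'\<in>\<Gamma>. G \<gamma> \<gamma>' * u \<gamma>')"

lemma summable_on_bound_real:
  fixes f g :: "'i \<Rightarrow> real"
  assumes "g summable_on \<Gamma>" "\<And>\<gamma>. \<gamma> \<in> \<Gamma> \<Longrightarrow> 0 \<le> f \<gamma>" "\<And>\<gamma>. \<gamma> \<in> \<Gamma> \<Longrightarrow> f \<gamma> \<le> g \<gamma>"
  shows "f summable_on \<Gamma>"
  using assms summable_on_comparison_test by blast

lemma ell1_mult_bounded:
  assumes "u \<in> ell1 \<Gamma>" "\<And>\<gamma>. \<gamma> \<in> \<Gamma> \<Longrightarrow> norm (b \<gamma>) \<le> K"
  shows "(\<lambda>\<gamma>. b \<gamma> * u \<gamma>) \<in> ell1 \<Gamma>"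
proof -
  have "(\<lambda>\<gamma>. K * norm (u \<gamma>)) summable_on \<Gamma>"
    using assms(1) by (auto simp: ell1_def intro: summable_on_cmult_right)
  then show ?thesis
    unfolding ell1_def mem_Collect_eq
    by (rule summable_on_bound_real) (auto simp: norm_mult intro!: mult_right_mono assms(2))
qed

lemma ell1_cmult: "u \<in> ell1 \<Gamma> \<Longrightarrow> (\<lambda>\<gamma>. z * u \<gamma>) \<in> ell1 \<Gamma>"
  by (rule ell1_mult_bounded[where K = "norm z"]) auto

lemma ell1_add:
  assumes "u \<in> ell1 \<Gamma>" "v \<in> ell1 \<Gamma>"
  shows "(\<lambda>\<gamma>. u \<gamma> + v \<gamma>) \<in> ell1 \<Gamma>"
proof -
  have "(\<lambda>\<gamma>. norm (u \<gamma>) + norm (v \<gamma>)) summable_on \<Gamma>"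
    using assms by (auto simp: ell1_def intro: summable_on_add)
  then show ?thesis
    unfolding ell1_def mem_Collect_eq
    by (rule summable_on_bound_real) (auto simp: norm_triangle_ineq)
qed

lemma ell1_diff:
  assumes "u \<in> ell1 \<Gamma>" "v \<in> ell1 \<Gamma>"
  shows "(\<lambda>\<gamma>. u \<gamma> - v \<gamma>) \<in> ell1 \<Gamma>"
  using ell1_add[OF assms(1) ell1_cmult[OF assms(2), of "-1"]] by simp

lemma ell1_le_norm: "u \<in> ell1 \<Gamma> \<Longrightarrow> \<gamma> \<in> \<Gamma> \<Longrightarrow> norm (u \<gamma>) \<le> (\<Sum>\<^sub>\<infinity>\<gamma>\<in>\<Gamma>. norm (u \<gamma>))"
  using finite_sum_le_infsum[of "\<lambda>\<gamma>. norm (u \<gamma>)" \<Gamma> "{\<gamma>}"] by (simp add: ell1_def)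

lemma ell1_bounded: "u \<in> ell1 \<Gamma> \<Longrightarrow> \<exists>K\<ge>0. \<forall>\<gamma>\<in>\<Gamma>. norm (u \<gamma>) \<le> K"
  by (rule exI[of _ "\<Sum>\<^sub>\<infinity>\<gamma>\<in>\<Gamma>. norm (u \<gamma>)"]) (auto simp: ell1_le_norm infsum_nonneg)

lemma ell1_summable: "u \<in> ell1 \<Gamma> \<Longrightarrow> u summable_on \<Gamma>"
  by (simp add: ell1_def abs_summable_summable)

lemma ell1_ell2_inner:
  assumes "u \<in> ell1 \<Gamma>" "v \<in> ell1 \<Gamma>"
  shows "(\<lambda>\<gamma>. u \<gamma> * cnj (v \<gamma>)) \<in> ell1 \<Gamma>"
proof -
  obtain K where "\<forall>\<gamma>\<in>\<Gamma>. norm (v \<gamma>) \<le> K"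
    using ell1_bounded[OF assms(2)] by blast
  then have "(\<lambda>\<gamma>. cnj (v \<gamma>) * u \<gamma>) \<in> ell1 \<Gamma>"
    by (intro ell1_mult_bounded[OF assms(1)]) auto
  then show ?thesis by (simp add: mult.commute)
qed

lemma ell1_sq:
  assumes "u \<in> ell1 \<Gamma>"
  shows "(\<lambda>\<gamma>. (norm (u \<gamma>))\<^sup>2) summable_on \<Gamma>"
  using ell1_ell2_inner[OF assms assms] by (simp add: ell1_def norm_mult power2_eq_square)

lemma ell2_norm_nonneg: "0 \<le> ell2_norm \<Gamma> u"
  by (simp add: ell2_norm_def infsum_nonneg)

lemma ell2_norm_sq: "(ell2_norm \<Gamma> u)\<^sup>2 = (\<Sum>\<^sub>\<infinity>\<gamma>\<in>\<Gamma>. (norm (u \<gamma>))\<^sup>2)"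
  by (simp add: ell2_norm_def infsum_nonneg)

lemma sum_le_ell2_norm:
  assumes "u \<in> ell1 \<Gamma>" "finite S" "S \<subseteq> \<Gamma>"
  shows "(\<Sum>\<gamma>\<in>S. (norm (u \<gamma>))\<^sup>2) \<le> (ell2_norm \<Gamma> u)\<^sup>2"
  unfolding ell2_norm_sq by (rule finite_sum_le_infsum[OF ell1_sq[OF assms(1)] assms(2,3)]) auto

lemma L2_set_le_ell2_norm:
  assumes "u \<in> ell1 \<Gamma>" "finite S" "S \<subseteq> \<Gamma>"
  shows "L2_set (\<lambda>\<gamma>. norm (u \<gamma>)) S \<le> ell2_norm \<Gamma> u"
  unfolding L2_set_def using sum_le_ell2_norm[OF assms] ell2_norm_nonneg real_le_lsqrt by blast

lemma norm_le_ell2_norm: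
  assumes "u \<in> ell1 \<Gamma>" "\<gamma> \<in> \<Gamma>"
  shows "norm (u \<gamma>) \<le> ell2_norm \<Gamma> u"
  using L2_set_le_ell2_norm[OF assms(1), of "{\<gamma>}"] assms(2) by simp

text \<open>Bounded finite partial sums force summability along with the bound. This matters because
  \<open>infsum\<close> defaults to 0 on a non-summable family, where an estimate of
  \<open>ell2_norm\<close> would be void.\<close>

lemma ell2_norm_leI:
  assumes "0 \<le> L" "\<And>S. finite S \<Longrightarrow> S \<subseteq> \<Gamma> \<Longrightarrow> (\<Sum>\<gamma>\<in>S. (norm (u \<gamma>))\<^sup>2) \<le> L\<^sup>2"
  shows "ell2_norm \<Gamma> u \<le> L"
proof -
  have "(\<lambda>\<gamma>. (norm (u \<gamma>))\<^sup>2) summable_on \<Gamma>"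
    by (rule nonneg_bdd_above_summable_on) (auto simp: bdd_above_def intro!: exI[of _ "L\<^sup>2"] assms(2))
  then have "(\<Sum>\<^sub>\<infinity>\<gamma>\<in>\<Gamma>. (norm (u \<gamma>))\<^sup>2) \<le> L\<^sup>2"
    by (rule infsum_le_finite_sums) (auto intro: assms(2))
  then show ?thesis
    unfolding ell2_norm_def by (rule real_le_lsqrt[OF assms(1)])
qed

lemma ell2_norm_triangle:
  assumes "u \<in> ell1 \<Gamma>" "v \<in> ell1 \<Gamma>"
  shows "ell2_norm \<Gamma> (\<lambda>\<gamma>. u \<gamma> + v \<gamma>) \<le> ell2_norm \<Gamma> u + ell2_norm \<Gamma> v"
proof (rule ell2_norm_leI)
  show "0 \<le> ell2_norm \<Gamma> u + ell2_norm \<Gamma> v" by (simp add: ell2_norm_nonneg)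
  fix S assume S: "finite S" "S \<subseteq> \<Gamma>"
  have "L2_set (\<lambda>\<gamma>. norm (u \<gamma> + v \<gamma>)) S \<le> L2_set (\<lambda>\<gamma>. norm (u \<gamma>) + norm (v \<gamma>)) S"
    by (intro L2_set_mono norm_triangle_ineq) auto
  also have "\<dots> \<le> L2_set (\<lambda>\<gamma>. norm (u \<gamma>)) S + L2_set (\<lambda>\<gamma>. norm (v \<gamma>)) S"
    by (rule L2_set_triangle_ineq)
  also have "\<dots> \<le> ell2_norm \<Gamma> u + ell2_norm \<Gamma> v"
    by (intro add_mono L2_set_le_ell2_norm assms S)
  finally have "L2_set (\<lambda>\<gamma>. norm (u \<gamma> + v \<gamma>)) S \<le> ell2_norm \<Gamma> u + ell2_norm \<Gamma> v" .
  then show "(\<Sum>\<gamma>\<in>S. (norm (u \<gamma> + v \<gamma>))\<^sup>2) \<le> (ell2_norm \<Gamma> u + ell2_norm \<Gamma> v)\<^sup>2"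
    unfolding L2_set_def by (rule sqrt_le_D)
qed

lemma ell2_norm_cmult: "ell2_norm \<Gamma> (\<lambda>\<gamma>. z * u \<gamma>) = norm z * ell2_norm \<Gamma> u"
  by (simp add: ell2_norm_def norm_mult power_mult_distrib infsum_cmult_right' real_sqrt_mult)

lemma ell2_norm_triangle_diff:
  assumes "u \<in> ell1 \<Gamma>" "v \<in> ell1 \<Gamma>"
  shows "ell2_norm \<Gamma> (\<lambda>\<gamma>. u \<gamma> - v \<gamma>) \<le> ell2_norm \<Gamma> u + ell2_norm \<Gamma> v"
  using ell2_norm_triangle[OF assms(1) ell1_cmult[OF assms(2), of "-1"]] ell2_norm_cmult[of \<Gamma> "-1" v] by simp

lemma ell2_norm_le_ell1:
  assumes "u \<in> ell1 \<Gamma>"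
  shows "ell2_norm \<Gamma> u \<le> (\<Sum>\<^sub>\<infinity>\<gamma>\<in>\<Gamma>. norm (u \<gamma>))"
proof (rule ell2_norm_leI)
  show "0 \<le> (\<Sum>\<^sub>\<infinity>\<gamma>\<in>\<Gamma>. norm (u \<gamma>))" by (simp add: infsum_nonneg)
  fix S assume S: "finite S" "S \<subseteq> \<Gamma>"
  have "L2_set (\<lambda>\<gamma>. norm (u \<gamma>)) S \<le> (\<Sum>\<gamma>\<in>S. norm (u \<gamma>))"
    by (rule L2_set_le_sum) auto
  also have "\<dots> \<le> (\<Sum>\<^sub>\<infinity>\<gamma>\<in>\<Gamma>. norm (u \<gamma>))"
    using assms S by (intro finite_sum_le_infsum) (auto simp: ell1_def)
  finally show "(\<Sum>\<gamma>\<in>S. (norm (u \<gamma>))\<^sup>2) \<le> (\<Sum>\<^sub>\<infinity>\<gamma>\<in>\<Gamma>. norm (u \<gamma>))\<^sup>2"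
    unfolding L2_set_def by (rule sqrt_le_D)
qed

lemma ell2_inner_add_left:
  assumes "u \<in> ell1 \<Gamma>" "v \<in> ell1 \<Gamma>" "x \<in> ell1 \<Gamma>"
  shows "ell2_inner \<Gamma> (\<lambda>\<gamma>. u \<gamma> + v \<gamma>) x = ell2_inner \<Gamma> u x + ell2_inner \<Gamma> v x"
  unfolding ell2_inner_def distrib_right by (intro infsum_add ell1_summable ell1_ell2_inner assms)

lemma ell2_inner_commute: "ell2_inner \<Gamma> v u = cnj (ell2_inner \<Gamma> u v)"
  unfolding ell2_inner_def infsum_cnj[symmetric] by (simp add: mult.commute)

lemma ell2_inner_cmult_left: "ell2_inner \<Gamma> (\<lambda>\<gamma>. z * u \<gamma>) v = z * ell2_inner \<Gamma> u v"
  by (simp add: ell2_inner_def mult.assoc infsum_cmult_right')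

lemma ell2_inner_cmult_right: "ell2_inner \<Gamma> u (\<lambda>\<gamma>. z * v \<gamma>) = cnj z * ell2_inner \<Gamma> u v"
  by (subst (1 2) ell2_inner_commute) (simp add: ell2_inner_cmult_left)

lemma ell2_inner_add_right:
  assumes "u \<in> ell1 \<Gamma>" "v \<in> ell1 \<Gamma>" "x \<in> ell1 \<Gamma>"
  shows "ell2_inner \<Gamma> x (\<lambda>\<gamma>. u \<gamma> + v \<gamma>) = ell2_inner \<Gamma> x u + ell2_inner \<Gamma> x v"
  by (subst (1 2 3) ell2_inner_commute) (simp add: ell2_inner_add_left[OF assms])

lemma ell2_inner_self:
  assumes "u \<in> ell1 \<Gamma>"
  shows "ell2_inner \<Gamma> u u = complex_of_real ((ell2_norm \<Gamma> u)\<^sup>2)"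
proof -
  have "ell2_inner \<Gamma> u u = (\<Sum>\<^sub>\<infinity>\<gamma>\<in>\<Gamma>. complex_of_real ((norm (u \<gamma>))\<^sup>2))"
    unfolding ell2_inner_def by (simp add: complex_norm_square[symmetric])
  also have "\<dots> = complex_of_real (\<Sum>\<^sub>\<infinity>\<gamma>\<in>\<Gamma>. (norm (u \<gamma>))\<^sup>2)"
    by (intro infsumI has_sum_of_real has_sum_infsum ell1_sq assms)
  finally show ?thesis by (simp only: ell2_norm_sq)
qed

lemma ell2_norm_add_sq:
  assumes "u \<in> ell1 \<Gamma>" "v \<in> ell1 \<Gamma>"
  shows "(ell2_norm \<Gamma> (\<lambda>\<gamma>. u \<gamma> + v \<gamma>))\<^sup>2 = (ell2_norm \<Gamma> u)\<^sup>2 + 2 * Re (ell2_inner \<Gamma> u v) + (ell2_norm \<Gamma> v)\<^sup>2"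
proof -
  have "complex_of_real ((ell2_norm \<Gamma> (\<lambda>\<gamma>. u \<gamma> + v \<gamma>))\<^sup>2) = ell2_inner \<Gamma> u u + ell2_inner \<Gamma> v u + (ell2_inner \<Gamma> u v + ell2_inner \<Gamma> v v)"
    by (subst ell2_inner_self[OF ell1_add[OF assms], symmetric]) (simp add: ell2_inner_add_left ell2_inner_add_right ell1_add assms)
  then have "Re (complex_of_real ((ell2_norm \<Gamma> (\<lambda>\<gamma>. u \<gamma> + v \<gamma>))\<^sup>2)) = Re (ell2_inner \<Gamma> u u + ell2_inner \<Gamma> v u + (ell2_inner \<Gamma> u v + ell2_inner \<Gamma> v v))"
    by (rule arg_cong)
  then show ?thesis by (simp only: ell2_inner_self[OF assms(1)] ell2_inner_self[OF assms(2)] ell2_inner_commute[of \<Gamma> v u]) simp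
qed

lemma ell2_norm_diff_sq:
  assumes "u \<in> ell1 \<Gamma>" "v \<in> ell1 \<Gamma>"
  shows "(ell2_norm \<Gamma> (\<lambda>\<gamma>. u \<gamma> - z * v \<gamma>))\<^sup>2 = (ell2_norm \<Gamma> u)\<^sup>2 - 2 * Re (cnj z * ell2_inner \<Gamma> u v) + (norm z)\<^sup>2 * (ell2_norm \<Gamma> v)\<^sup>2"
  using ell2_norm_add_sq[OF assms(1) ell1_cmult[OF assms(2), of "-z"]]
  unfolding ell2_norm_cmult ell2_inner_cmult_right by (simp add: power_mult_distrib)

lemma ell2_inner_Cauchy_Schwarz:
  assumes "u \<in> ell1 \<Gamma>" "v \<in> ell1 \<Gamma>"
  shows "norm (ell2_inner \<Gamma> u v) \<le> ell2_norm \<Gamma> u * ell2_norm \<Gamma> v"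
proof -
  have s: "(\<lambda>\<gamma>. norm (u \<gamma> * cnj (v \<gamma>))) summable_on \<Gamma>"
    using ell1_ell2_inner[OF assms] by (simp add: ell1_def)
  have "norm (ell2_inner \<Gamma> u v) \<le> (\<Sum>\<^sub>\<infinity>\<gamma>\<in>\<Gamma>. norm (u \<gamma> * cnj (v \<gamma>)))"
    unfolding ell2_inner_def by (rule norm_infsum_bound[OF s])
  also have "\<dots> \<le> ell2_norm \<Gamma> u * ell2_norm \<Gamma> v"
  proof (rule infsum_le_finite_sums[OF s])
    fix S assume S: "finite S" "S \<subseteq> \<Gamma>"
    have "(\<Sum>\<gamma>\<in>S. norm (u \<gamma> * cnj (v \<gamma>))) = (\<Sum>\<gamma>\<in>S. \<bar>norm (u \<gamma>)\<bar> * \<bar>norm (v \<gamma>)\<bar>)"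
      by (simp add: norm_mult)
    also have "\<dots> \<le> L2_set (\<lambda>\<gamma>. norm (u \<gamma>)) S * L2_set (\<lambda>\<gamma>. norm (v \<gamma>)) S"
      by (rule L2_set_mult_ineq)
    also have "\<dots> \<le> ell2_norm \<Gamma> u * ell2_norm \<Gamma> v"
      by (intro mult_mono L2_set_le_ell2_norm assms S ell2_norm_nonneg L2_set_nonneg)
    finally show "(\<Sum>\<gamma>\<in>S. norm (u \<gamma> * cnj (v \<gamma>))) \<le> ell2_norm \<Gamma> u * ell2_norm \<Gamma> v" .
  qed
  finally show ?thesis .
qed

lemma has_sum_sum:
  fixes f :: "'a \<Rightarrow> 'b \<Rightarrow> 'c::topological_comm_monoid_add"
  assumes "finite S" "\<And>i. i \<in> S \<Longrightarrow> (f i has_sum s i) A"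
  shows "((\<lambda>x. \<Sum>i\<in>S. f i x) has_sum (\<Sum>i\<in>S. s i)) A"
  using assms by (induction S rule: finite_induct) (auto intro: has_sum_add)

lemma has_sum_diff:
  fixes f g :: "'a \<Rightarrow> 'b::real_normed_vector"
  assumes "(f has_sum a) A" "(g has_sum b) A"
  shows "((\<lambda>x. f x - g x) has_sum (a - b)) A"
  using has_sum_add[OF assms(1), of "\<lambda>x. - g x" "- b"] assms(2) by (simp add: has_sum_uminus)

lemma finite_subset_approx:
  fixes f :: "'i \<Rightarrow> real"
  assumes "f summable_on \<Gamma>" "\<And>\<gamma>. \<gamma> \<in> \<Gamma> \<Longrightarrow> 0 \<le> f \<gamma>" "\<epsilon> > 0"
  obtains S where "finite S" "S \<subseteq> \<Gamma>" "(\<Sum>\<^sub>\<infinity>\<gamma>\<in>\<Gamma> - S. f \<gamma>) < \<epsilon>"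
proof -
  obtain S where S: "finite S" "S \<subseteq> \<Gamma>" "dist (sum f S) (infsum f \<Gamma>) \<le> \<epsilon> / 2"
    using infsum_finite_approximation[OF assms(1), of "\<epsilon> / 2"] assms(3) by auto
  have "infsum f \<Gamma> = infsum f S + infsum f (\<Gamma> - S)"
    using infsum_Un_disjoint[of f S "\<Gamma> - S"] S summable_on_subset_banach[OF assms(1), of "\<Gamma> - S"]
    by (simp add: Un_absorb1)
  with S assms(3) have "(\<Sum>\<^sub>\<infinity>\<gamma>\<in>\<Gamma> - S. f \<gamma>) < \<epsilon>" by (auto simp: dist_real_def)
  then show ?thesis using that S by blast
qed

subsection \<open>Matrices dominated by a convolution\<close>

text \<open>The index set need not be a group: \<open>q\<close> sends an index to its lattice cell,
  at most \<open>N\<close> indices share one, and decay is measured in the group of cells.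
  Domination is required for all indices, also outside \<Gamma>, so that entry bounds need no case
  distinction; the Gram matrix is extended by zero accordingly.\<close>

locale convolution_dominated =
  fixes \<Gamma> :: "'i set" and q :: "'i \<Rightarrow> 'k::ab_group_add" and N :: nat
    and G :: "'i \<Rightarrow> 'i \<Rightarrow> complex" and \<Xi> :: "'k \<Rightarrow> real"
  assumes fib_fin: "finite {\<gamma>\<in>\<Gamma>. q \<gamma> = k}"
    and fib_card: "card {\<gamma>\<in>\<Gamma>. q \<gamma> = k} \<le> N"
    and dom: "norm (G \<gamma> \<gamma>') \<le> \<Xi> (q \<gamma> - q \<gamma>')"
    and \<Xi>_nonneg: "0 \<le> \<Xi> k" and \<Xi>_summable: "\<Xi> summable_on UNIV"
begin

text \<open>Each cell contributes at most \<open>N\<close> equal terms. The injection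
  \<open>g\<close> covers rows and columns at once: it will be \<open>k - b\<close> or
  \<open>b - k\<close>, and distinct cells still meet distinct values of
  \<open>\<kappa>\<close>.\<close>

lemma sum_cells_le:
  assumes "finite S" "S \<subseteq> \<Gamma>" "inj g" "\<kappa> summable_on UNIV" "\<And>k. 0 \<le> \<kappa> k"
  shows "(\<Sum>\<gamma>\<in>S. \<kappa> (g (q \<gamma>))) \<le> real N * (\<Sum>\<^sub>\<infinity>k. \<kappa> k)"
proof -
  have "(\<Sum>\<gamma>\<in>S. \<kappa> (g (q \<gamma>))) = (\<Sum>k\<in>q ` S. \<Sum>\<gamma> | \<gamma> \<in> S \<and> q \<gamma> = k. \<kappa> (g (q \<gamma>)))"
    by (rule sum.image_gen[OF assms(1)])
  also have "\<dots> \<le> (\<Sum>k\<in>q ` S. real N * \<kappa> (g k))"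
  proof (rule sum_mono)
    fix k
    have "card {\<gamma> \<in> S. q \<gamma> = k} \<le> card {\<gamma> \<in> \<Gamma>. q \<gamma> = k}"
      using assms(2) by (intro card_mono fib_fin) auto
    then have "card {\<gamma> \<in> S. q \<gamma> = k} \<le> N" using fib_card[of k] by linarith
    then show "(\<Sum>\<gamma> | \<gamma> \<in> S \<and> q \<gamma> = k. \<kappa> (g (q \<gamma>))) \<le> real N * \<kappa> (g k)"
      using assms(5) by (simp add: mult_right_mono)
  qed
  also have "\<dots> = real N * (\<Sum>k\<in>g ` q ` S. \<kappa> k)"
    using assms(3) by (simp add: sum_distrib_left sum.reindex inj_on_subset)
  also have "\<dots> \<le> real N * (\<Sum>\<^sub>\<infinity>k. \<kappa> k)"
    using assms by (intro mult_left_mono finite_sum_le_infsum) auto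
  finally show ?thesis .
qed

lemma sum_cells_left:
  assumes "finite S" "S \<subseteq> \<Gamma>" "\<kappa> summable_on UNIV" "\<And>k. 0 \<le> \<kappa> k"
  shows "(\<Sum>\<gamma>\<in>S. \<kappa> (q \<gamma> - b)) \<le> real N * (\<Sum>\<^sub>\<infinity>k. \<kappa> k)"
  by (rule sum_cells_le[OF assms(1,2) _ assms(3,4)]) (auto simp: inj_def)

lemma sum_cells_right:
  assumes "finite S" "S \<subseteq> \<Gamma>" "\<kappa> summable_on UNIV" "\<And>k. 0 \<le> \<kappa> k"
  shows "(\<Sum>\<gamma>\<in>S. \<kappa> (b - q \<gamma>)) \<le> real N * (\<Sum>\<^sub>\<infinity>k. \<kappa> k)"
  by (rule sum_cells_le[OF assms(1,2) _ assms(3,4)]) (auto simp: inj_def)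

text \<open>
  Schur's test along the diagonals \<open>q \<gamma> - q \<gamma>' = m\<close>; the input \<open>h\<close> may vary with the diagonal,
  which is what the commutator estimate below needs.
\<close>
lemma schur_finite:
  assumes fin: "finite S" "S \<subseteq> \<Gamma>" "finite T" "T \<subseteq> \<Gamma>"
    and \<kappa>: "\<kappa> summable_on UNIV" "\<And>k. 0 \<le> \<kappa> k"
    and h: "\<And>m \<gamma>. 0 \<le> h m \<gamma>" "\<And>m T. finite T \<Longrightarrow> T \<subseteq> \<Gamma> \<Longrightarrow> (\<Sum>\<gamma>\<in>T. (h m \<gamma>)\<^sup>2) \<le> L\<^sup>2"
  shows "(\<Sum>\<gamma>\<in>S. (\<Sum>\<gamma>'\<in>T. \<kappa> (q \<gamma> - q \<gamma>') * h (q \<gamma> - q \<gamma>') \<gamma>')\<^sup>2) \<le> (real N * (\<Sum>\<^sub>\<infinity>k. \<kappa> k) * L)\<^sup>2"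
proof -
  define K where "K = (\<Sum>\<^sub>\<infinity>k. \<kappa> k)"
  have K0: "0 \<le> K" unfolding K_def by (intro infsum_nonneg \<kappa>)
  have cs: "(\<Sum>\<gamma>'\<in>T. \<kappa> (q \<gamma> - q \<gamma>') * h (q \<gamma> - q \<gamma>') \<gamma>')\<^sup>2
      \<le> real N * K * (\<Sum>\<gamma>'\<in>T. \<kappa> (q \<gamma> - q \<gamma>') * (h (q \<gamma> - q \<gamma>') \<gamma>')\<^sup>2)" for \<gamma>
  proof -
    have "(\<Sum>\<gamma>'\<in>T. \<kappa> (q \<gamma> - q \<gamma>') * h (q \<gamma> - q \<gamma>') \<gamma>')\<^sup>2
      = (\<Sum>\<gamma>'\<in>T. sqrt (\<kappa> (q \<gamma> - q \<gamma>')) * (sqrt (\<kappa> (q \<gamma> - q \<gamma>')) * h (q \<gamma> - q \<gamma>') \<gamma>'))\<^sup>2"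
      using \<kappa>(2) by (simp add: mult.assoc[symmetric])
    also have "\<dots> \<le> (\<Sum>\<gamma>'\<in>T. (sqrt (\<kappa> (q \<gamma> - q \<gamma>')))\<^sup>2) * (\<Sum>\<gamma>'\<in>T. (sqrt (\<kappa> (q \<gamma> - q \<gamma>')) * h (q \<gamma> - q \<gamma>') \<gamma>')\<^sup>2)"
      by (rule Cauchy_Schwarz_ineq_sum)
    also have "\<dots> = (\<Sum>\<gamma>'\<in>T. \<kappa> (q \<gamma> - q \<gamma>')) * (\<Sum>\<gamma>'\<in>T. \<kappa> (q \<gamma> - q \<gamma>') * (h (q \<gamma> - q \<gamma>') \<gamma>')\<^sup>2)"
      using \<kappa>(2) by (simp add: power_mult_distrib)
    also have "\<dots> \<le> real N * K * (\<Sum>\<gamma>'\<in>T. \<kappa> (q \<gamma> - q \<gamma>') * (h (q \<gamma> - q \<gamma>') \<gamma>')\<^sup>2)"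
      unfolding K_def by (intro mult_right_mono sum_cells_right fin \<kappa> sum_nonneg mult_nonneg_nonneg) auto
    finally show ?thesis .
  qed
  have col: "(\<Sum>\<gamma>\<in>S. \<kappa> (q \<gamma> - b) * (h (q \<gamma> - b) \<gamma>')\<^sup>2)
      \<le> real N * (\<Sum>m\<in>(\<lambda>(\<gamma>, \<gamma>'). q \<gamma> - q \<gamma>') ` (S \<times> T). \<kappa> m * (h m \<gamma>')\<^sup>2)" if "\<gamma>' \<in> T" "b = q \<gamma>'" for \<gamma>' b
  proof -
    have fM: "finite ((\<lambda>(\<gamma>, \<gamma>'). q \<gamma> - q \<gamma>') ` (S \<times> T))" using fin by auto
    \<comment> \<open>Only the finitely many differences realised by \<open>S\<close> and
      \<open>T\<close> matter. Cutting off outside them leaves a finite sum over diagonals, which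
      can be interchanged with the sum over \<open>T\<close> below.\<close>
    define \<kappa>' where "\<kappa>' m = (if m \<in> (\<lambda>(\<gamma>, \<gamma>'). q \<gamma> - q \<gamma>') ` (S \<times> T) then \<kappa> m * (h m \<gamma>')\<^sup>2 else 0)" for m
    have s: "(\<kappa>' has_sum (\<Sum>m\<in>(\<lambda>(\<gamma>, \<gamma>'). q \<gamma> - q \<gamma>') ` (S \<times> T). \<kappa> m * (h m \<gamma>')\<^sup>2)) UNIV"
      using has_sum_finite[OF fM, of "\<lambda>m. \<kappa> m * (h m \<gamma>')\<^sup>2"]
      by (rule has_sum_cong_neutral[THEN iffD1, rotated -1]) (auto simp: \<kappa>'_def)
    have "(\<Sum>\<gamma>\<in>S. \<kappa> (q \<gamma> - b) * (h (q \<gamma> - b) \<gamma>')\<^sup>2) = (\<Sum>\<gamma>\<in>S. \<kappa>' (q \<gamma> - b))"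
      using that by (intro sum.cong) (auto simp: \<kappa>'_def image_iff)
    also have "\<dots> \<le> real N * (\<Sum>\<^sub>\<infinity>k. \<kappa>' k)"
      using \<kappa> by (intro sum_cells_left fin has_sum_imp_summable[OF s]) (auto simp: \<kappa>'_def)
    also have "(\<Sum>\<^sub>\<infinity>k. \<kappa>' k) = (\<Sum>m\<in>(\<lambda>(\<gamma>, \<gamma>'). q \<gamma> - q \<gamma>') ` (S \<times> T). \<kappa> m * (h m \<gamma>')\<^sup>2)"
      by (rule infsumI[OF s])
    finally show ?thesis .
  qed
  define M where "M = (\<lambda>(\<gamma>, \<gamma>'). q \<gamma> - q \<gamma>') ` (S \<times> T)"
  have fM: "finite M" using fin by (auto simp: M_def)
  have "(\<Sum>\<gamma>\<in>S. (\<Sum>\<gamma>'\<in>T. \<kappa> (q \<gamma> - q \<gamma>') * h (q \<gamma> - q \<gamma>') \<gamma>')\<^sup>2)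
      \<le> (\<Sum>\<gamma>\<in>S. real N * K * (\<Sum>\<gamma>'\<in>T. \<kappa> (q \<gamma> - q \<gamma>') * (h (q \<gamma> - q \<gamma>') \<gamma>')\<^sup>2))"
    by (intro sum_mono cs)
  also have "\<dots> = real N * K * (\<Sum>\<gamma>'\<in>T. \<Sum>\<gamma>\<in>S. \<kappa> (q \<gamma> - q \<gamma>') * (h (q \<gamma> - q \<gamma>') \<gamma>')\<^sup>2)"
    unfolding sum_distrib_left[symmetric] by (subst sum.swap) (rule refl)
  also have "\<dots> \<le> real N * K * (\<Sum>\<gamma>'\<in>T. real N * (\<Sum>m\<in>M. \<kappa> m * (h m \<gamma>')\<^sup>2))"
    unfolding M_def using K0 by (intro mult_left_mono sum_mono col) auto
  \<comment> \<open>Summing over \<open>\<gamma>'\<close> inside a fixed diagonal \<open>m\<close>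
    makes the hypothesis on \<open>h m\<close> applicable.\<close>
  also have "\<dots> = real N * K * (real N * (\<Sum>m\<in>M. \<kappa> m * (\<Sum>\<gamma>'\<in>T. (h m \<gamma>')\<^sup>2)))"
    unfolding sum_distrib_left[symmetric] by (subst sum.swap) (simp add: sum_distrib_left)
  also have "\<dots> \<le> real N * K * (real N * (\<Sum>m\<in>M. \<kappa> m * L\<^sup>2))"
    using K0 fin by (intro mult_left_mono sum_mono h \<kappa>) auto
  also have "\<dots> \<le> real N * K * (real N * (K * L\<^sup>2))"
    unfolding sum_distrib_right[symmetric] K_def
    using K0[unfolded K_def] \<kappa> fM by (intro mult_left_mono mult_right_mono finite_sum_le_infsum) auto
  also have "\<dots> = (real N * K * L)\<^sup>2" by (simp add: power2_eq_square)
  finally show ?thesis unfolding K_def .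
qed

text \<open>With \<open>S\<close> fixed the inner sums are limits over finite \<open>T\<close>, and
  the finite estimate is uniform in both. The rows enter as arbitrary convergent sums
  \<open>t\<close>, not through \<open>mat_app\<close>, so that the test also covers
  commutators.\<close>

lemma schur:
  assumes t: "\<And>\<gamma>. \<gamma> \<in> \<Gamma> \<Longrightarrow> (k \<gamma> has_sum t \<gamma>) \<Gamma>"
    and k: "\<And>\<gamma> \<gamma>'. \<gamma> \<in> \<Gamma> \<Longrightarrow> \<gamma>' \<in> \<Gamma> \<Longrightarrow> norm (k \<gamma> \<gamma>') \<le> \<kappa> (q \<gamma> - q \<gamma>') * h (q \<gamma> - q \<gamma>') \<gamma>'"
    and \<kappa>: "\<kappa> summable_on UNIV" "\<And>k. 0 \<le> \<kappa> k"
    and h: "\<And>m \<gamma>. 0 \<le> h m \<gamma>" "\<And>m T. finite T \<Longrightarrow> T \<subseteq> \<Gamma> \<Longrightarrow> (\<Sum>\<gamma>\<in>T. (h m \<gamma>)\<^sup>2) \<le> L\<^sup>2" and L: "0 \<le> L"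
  shows "ell2_norm \<Gamma> t \<le> real N * (\<Sum>\<^sub>\<infinity>k. \<kappa> k) * L"
proof (rule ell2_norm_leI)
  show "0 \<le> real N * (\<Sum>\<^sub>\<infinity>k. \<kappa> k) * L" by (intro mult_nonneg_nonneg infsum_nonneg \<kappa> L) auto
  fix S assume S: "finite S" "S \<subseteq> \<Gamma>"
  show "(\<Sum>\<gamma>\<in>S. (norm (t \<gamma>))\<^sup>2) \<le> (real N * (\<Sum>\<^sub>\<infinity>k. \<kappa> k) * L)\<^sup>2"
  proof (rule tendsto_upperbound)
    show "((\<lambda>T. \<Sum>\<gamma>\<in>S. (norm (\<Sum>\<gamma>'\<in>T. k \<gamma> \<gamma>'))\<^sup>2) \<longlongrightarrow> (\<Sum>\<gamma>\<in>S. (norm (t \<gamma>))\<^sup>2)) (finite_subsets_at_top \<Gamma>)"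
      using t S(2) by (intro tendsto_sum tendsto_power tendsto_norm) (auto simp: has_sum_def)
    have "(\<Sum>\<gamma>\<in>S. (norm (\<Sum>\<gamma>'\<in>T. k \<gamma> \<gamma>'))\<^sup>2) \<le> (real N * (\<Sum>\<^sub>\<infinity>k. \<kappa> k) * L)\<^sup>2" if T: "finite T" "T \<subseteq> \<Gamma>" for T
    proof -
      have "(\<Sum>\<gamma>\<in>S. (norm (\<Sum>\<gamma>'\<in>T. k \<gamma> \<gamma>'))\<^sup>2) \<le> (\<Sum>\<gamma>\<in>S. (\<Sum>\<gamma>'\<in>T. \<kappa> (q \<gamma> - q \<gamma>') * h (q \<gamma> - q \<gamma>') \<gamma>')\<^sup>2)"
        using S(2) T(2) by (intro sum_mono power_mono sum_norm_le k) auto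
      also have "\<dots> \<le> (real N * (\<Sum>\<^sub>\<infinity>k. \<kappa> k) * L)\<^sup>2" by (rule schur_finite[OF S T \<kappa> h])
      finally show ?thesis .
    qed
    then show "\<forall>\<^sub>F T in finite_subsets_at_top \<Gamma>. (\<Sum>\<gamma>\<in>S. (norm (\<Sum>\<gamma>'\<in>T. k \<gamma> \<gamma>'))\<^sup>2) \<le> (real N * (\<Sum>\<^sub>\<infinity>k. \<kappa> k) * L)\<^sup>2"
      by (intro eventually_finite_subsets_at_top_weakI) auto
  qed simp
qed

section \<open>The operator of a dominated matrix on summable vectors\<close>

definition B where "B = real N * (\<Sum>\<^sub>\<infinity>k. \<Xi> k)"

lemma B_nonneg: "0 \<le> B"
  by (simp add: B_def infsum_nonneg \<Xi>_nonneg)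

lemma \<Xi>_le: "\<Xi> k \<le> (\<Sum>\<^sub>\<infinity>k. \<Xi> k)"
  using finite_sum_le_infsum[OF \<Xi>_summable, of "{k}"] by (simp add: \<Xi>_nonneg)

lemma norm_G_le: "norm (G \<gamma> \<gamma>') \<le> (\<Sum>\<^sub>\<infinity>k. \<Xi> k)"
  using dom \<Xi>_le order_trans by blast

lemma row_ell1: "u \<in> ell1 \<Gamma> \<Longrightarrow> (\<lambda>\<gamma>'. G \<gamma> \<gamma>' * u \<gamma>') \<in> ell1 \<Gamma>"
  by (rule ell1_mult_bounded) (auto intro: norm_G_le)

lemma mat_app_has_sum: "u \<in> ell1 \<Gamma> \<Longrightarrow> ((\<lambda>\<gamma>'. G \<gamma> \<gamma>' * u \<gamma>') has_sum mat_app \<Gamma> G u \<gamma>) \<Gamma>"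
  unfolding mat_app_def by (intro has_sum_infsum ell1_summable row_ell1)

lemma mat_app_add: "u \<in> ell1 \<Gamma> \<Longrightarrow> v \<in> ell1 \<Gamma> \<Longrightarrow> mat_app \<Gamma> G (\<lambda>\<gamma>. u \<gamma> + v \<gamma>) = (\<lambda>\<gamma>. mat_app \<Gamma> G u \<gamma> + mat_app \<Gamma> G v \<gamma>)"
  unfolding mat_app_def distrib_left by (intro ext infsum_add ell1_summable row_ell1)

lemma mat_app_cmult: "mat_app \<Gamma> G (\<lambda>\<gamma>. z * u \<gamma>) = (\<lambda>\<gamma>. z * mat_app \<Gamma> G u \<gamma>)"
  unfolding mat_app_def by (simp add: mult.left_commute infsum_cmult_right')

lemma mat_app_diff:
  assumes "u \<in> ell1 \<Gamma>" "v \<in> ell1 \<Gamma>"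
  shows "mat_app \<Gamma> G (\<lambda>\<gamma>. u \<gamma> - v \<gamma>) = (\<lambda>\<gamma>. mat_app \<Gamma> G u \<gamma> - mat_app \<Gamma> G v \<gamma>)"
  using mat_app_add[OF assms(1) ell1_cmult[OF assms(2), of "-1"]] mat_app_cmult[of "-1" v] by simp

text \<open>Column sums of the dominating kernel are at most \<open>B\<close>. The point is that
  iterates of the matrix stay in \<open>ell1\<close>, where all series converge absolutely.\<close>

lemma mat_app_ell1:
  assumes "u \<in> ell1 \<Gamma>"
  shows "mat_app \<Gamma> G u \<in> ell1 \<Gamma>"
proof -
  have su: "(\<lambda>\<gamma>. norm (u \<gamma>)) summable_on \<Gamma>" using assms by (simp add: ell1_def)
  have "(\<Sum>\<gamma>\<in>S. norm (mat_app \<Gamma> G u \<gamma>)) \<le> B * (\<Sum>\<^sub>\<infinity>\<gamma>\<in>\<Gamma>. norm (u \<gamma>))" if S: "finite S" "S \<subseteq> \<Gamma>" for S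
  proof -
    have r: "(\<lambda>\<gamma>'. norm (G \<gamma> \<gamma>' * u \<gamma>')) summable_on \<Gamma>" for \<gamma>
      using row_ell1[OF assms] by (simp add: ell1_def)
    have "(\<Sum>\<gamma>\<in>S. norm (mat_app \<Gamma> G u \<gamma>)) \<le> (\<Sum>\<gamma>\<in>S. \<Sum>\<^sub>\<infinity>\<gamma>'\<in>\<Gamma>. norm (G \<gamma> \<gamma>' * u \<gamma>'))"
      unfolding mat_app_def by (intro sum_mono norm_infsum_bound r)
    also have "\<dots> = (\<Sum>\<^sub>\<infinity>\<gamma>'\<in>\<Gamma>. \<Sum>\<gamma>\<in>S. norm (G \<gamma> \<gamma>' * u \<gamma>'))"
      by (intro infsumI[symmetric] has_sum_sum S has_sum_infsum r)
    also have "\<dots> \<le> (\<Sum>\<^sub>\<infinity>\<gamma>'\<in>\<Gamma>. B * norm (u \<gamma>'))"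
    proof (rule infsum_mono)
      show "(\<lambda>\<gamma>'. \<Sum>\<gamma>\<in>S. norm (G \<gamma> \<gamma>' * u \<gamma>')) summable_on \<Gamma>"
        by (rule has_sum_imp_summable[OF has_sum_sum[OF S(1) has_sum_infsum[OF r]]])
      show "(\<lambda>\<gamma>'. B * norm (u \<gamma>')) summable_on \<Gamma>" by (intro summable_on_cmult_right su)
      fix \<gamma>'
      have "(\<Sum>\<gamma>\<in>S. norm (G \<gamma> \<gamma>' * u \<gamma>')) \<le> (\<Sum>\<gamma>\<in>S. \<Xi> (q \<gamma> - q \<gamma>')) * norm (u \<gamma>')"
        unfolding sum_distrib_right norm_mult by (intro sum_mono mult_right_mono dom) auto
      also have "\<dots> \<le> B * norm (u \<gamma>')"
        unfolding B_def by (intro mult_right_mono sum_cells_left S \<Xi>_summable \<Xi>_nonneg) auto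
      finally show "(\<Sum>\<gamma>\<in>S. norm (G \<gamma> \<gamma>' * u \<gamma>')) \<le> B * norm (u \<gamma>')" .
    qed
    also have "\<dots> = B * (\<Sum>\<^sub>\<infinity>\<gamma>\<in>\<Gamma>. norm (u \<gamma>))" by (rule infsum_cmult_right')
    finally show ?thesis .
  qed
  then show ?thesis
    unfolding ell1_def mem_Collect_eq
    by (intro nonneg_bdd_above_summable_on) (auto simp: bdd_above_def intro!: exI[of _ "B * (\<Sum>\<^sub>\<infinity>\<gamma>\<in>\<Gamma>. norm (u \<gamma>))"])
qed

lemma mat_app_ell2_norm:
  assumes "u \<in> ell1 \<Gamma>"
  shows "ell2_norm \<Gamma> (mat_app \<Gamma> G u) \<le> B * ell2_norm \<Gamma> u"
  unfolding B_def
  by (rule schur[where k = "\<lambda>\<gamma> \<gamma>'. G \<gamma> \<gamma>' * u \<gamma>'" and h = "\<lambda>m \<gamma>. norm (u \<gamma>)"])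
    (auto simp: norm_mult ell2_norm_nonneg \<Xi>_nonneg \<Xi>_summable assms intro!: mat_app_has_sum mult_right_mono dom sum_le_ell2_norm)

text \<open>Entries are bounded and \<open>u\<close>, \<open>v\<close> summable, so the double
  series is dominated by a product series and the sums may be interchanged.\<close>

lemma mat_app_adjoint:
  assumes herm: "\<And>\<gamma> \<gamma>'. G \<gamma>' \<gamma> = cnj (G \<gamma> \<gamma>')" and "u \<in> ell1 \<Gamma>" "v \<in> ell1 \<Gamma>"
  shows "ell2_inner \<Gamma> (mat_app \<Gamma> G u) v = ell2_inner \<Gamma> u (mat_app \<Gamma> G v)"
proof -
  let ?f = "\<lambda>\<gamma> \<gamma>'. G \<gamma> \<gamma>' * u \<gamma>' * cnj (v \<gamma>)"
  let ?K = "(\<Sum>\<^sub>\<infinity>k. \<Xi> k) * (\<Sum>\<^sub>\<infinity>\<gamma>\<in>\<Gamma>. norm (v \<gamma>)) * (\<Sum>\<^sub>\<infinity>\<gamma>\<in>\<Gamma>. norm (u \<gamma>))"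
  have K0: "0 \<le> (\<Sum>\<^sub>\<infinity>k. \<Xi> k)" by (simp add: infsum_nonneg \<Xi>_nonneg)
  have le: "(\<Sum>(\<gamma>, \<gamma>')\<in>F. norm (?f \<gamma> \<gamma>')) \<le> ?K" if F: "finite F" "F \<subseteq> \<Gamma> \<times> \<Gamma>" for F
  proof -
    have sub: "F \<subseteq> fst ` F \<times> snd ` F" by (auto simp: image_iff) force+
    have S: "finite (fst ` F)" "fst ` F \<subseteq> \<Gamma>" "finite (snd ` F)" "snd ` F \<subseteq> \<Gamma>" using F by auto
    have "(\<Sum>(\<gamma>, \<gamma>')\<in>F. norm (?f \<gamma> \<gamma>')) \<le> (\<Sum>(\<gamma>, \<gamma>')\<in>fst ` F \<times> snd ` F. norm (?f \<gamma> \<gamma>'))"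
      using sub S by (intro sum_mono2) auto
    also have "\<dots> = (\<Sum>\<gamma>\<in>fst ` F. \<Sum>\<gamma>'\<in>snd ` F. norm (?f \<gamma> \<gamma>'))"
      by (rule sum.cartesian_product[symmetric])
    also have "\<dots> \<le> (\<Sum>\<gamma>\<in>fst ` F. \<Sum>\<gamma>'\<in>snd ` F. (\<Sum>\<^sub>\<infinity>k. \<Xi> k) * norm (v \<gamma>) * norm (u \<gamma>'))"
    proof (intro sum_mono)
      fix \<gamma> \<gamma>'
      have "norm (?f \<gamma> \<gamma>') = norm (G \<gamma> \<gamma>') * (norm (v \<gamma>) * norm (u \<gamma>'))"
        by (simp add: norm_mult)
      also have "\<dots> \<le> (\<Sum>\<^sub>\<infinity>k. \<Xi> k) * (norm (v \<gamma>) * norm (u \<gamma>'))"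
        by (intro mult_right_mono norm_G_le) auto
      finally show "norm (?f \<gamma> \<gamma>') \<le> (\<Sum>\<^sub>\<infinity>k. \<Xi> k) * norm (v \<gamma>) * norm (u \<gamma>')"
        by (simp add: mult.assoc)
    qed
    also have "\<dots> = (\<Sum>\<^sub>\<infinity>k. \<Xi> k) * (\<Sum>\<gamma>\<in>fst ` F. norm (v \<gamma>)) * (\<Sum>\<gamma>'\<in>snd ` F. norm (u \<gamma>'))"
      by (simp add: sum_distrib_left sum_distrib_right mult.assoc) (rule sum.swap)
    also have "\<dots> \<le> ?K"
      using assms(2,3) S K0
      by (intro mult_mono mult_left_mono mult_nonneg_nonneg finite_sum_le_infsum sum_nonneg infsum_nonneg) (auto simp: ell1_def \<Xi>_nonneg)
    finally show ?thesis .
  qed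
  have "(\<lambda>(\<gamma>, \<gamma>'). norm (?f \<gamma> \<gamma>')) summable_on \<Gamma> \<times> \<Gamma>"
    by (rule nonneg_bdd_above_summable_on) (auto simp: bdd_above_def intro!: exI[of _ ?K] le)
  then have "(\<lambda>x. norm (case x of (\<gamma>, \<gamma>') \<Rightarrow> ?f \<gamma> \<gamma>')) summable_on \<Gamma> \<times> \<Gamma>"
    by (simp add: case_prod_unfold)
  then have s: "(\<lambda>(\<gamma>, \<gamma>'). ?f \<gamma> \<gamma>') summable_on \<Gamma> \<times> \<Gamma>"
    by (rule abs_summable_summable)
  have "ell2_inner \<Gamma> (mat_app \<Gamma> G u) v = (\<Sum>\<^sub>\<infinity>\<gamma>\<in>\<Gamma>. \<Sum>\<^sub>\<infinity>\<gamma>'\<in>\<Gamma>. ?f \<gamma> \<gamma>')"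
    by (simp add: ell2_inner_def mat_app_def infsum_cmult_left')
  also have "\<dots> = (\<Sum>\<^sub>\<infinity>\<gamma>'\<in>\<Gamma>. \<Sum>\<^sub>\<infinity>\<gamma>\<in>\<Gamma>. ?f \<gamma> \<gamma>')"
    by (rule infsum_swap_banach[OF s])
  also have "\<dots> = (\<Sum>\<^sub>\<infinity>\<gamma>'\<in>\<Gamma>. u \<gamma>' * (\<Sum>\<^sub>\<infinity>\<gamma>\<in>\<Gamma>. cnj (G \<gamma>' \<gamma> * v \<gamma>)))"
    unfolding infsum_cmult_right'[symmetric] by (intro infsum_cong) (simp add: herm[symmetric] mult_ac)
  also have "\<dots> = ell2_inner \<Gamma> u (mat_app \<Gamma> G v)"
    by (simp add: ell2_inner_def mat_app_def infsum_cnj[symmetric])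
  finally show ?thesis .
qed

end

subsection \<open>Spectral gap and inverse-closedness\<close>

text \<open>In spectral terms \<open>gap_finite\<close> says \<open>0 \<le> T\<close> and
  \<open>A T \<le> T\<^sup>2\<close>: no spectrum in \<open>(0, A)\<close>, but possibly at 0. It is
  stated for finite support because there it translates directly into the frame inequality.
  \<open>slow_weight\<close> is the geometric input on the group of cells, supplied later by
  exponentials.\<close>

locale gapped_gram = convolution_dominated \<Gamma> q N G \<Xi>
  for \<Gamma> :: "'i set" and q :: "'i \<Rightarrow> 'k::ab_group_add" and N G \<Xi> +
  fixes A :: real
  assumes herm: "G \<gamma>' \<gamma> = cnj (G \<gamma> \<gamma>')"
    and A_pos: "0 < A"
    and gap_finite: "finite {\<gamma>. c \<gamma> \<noteq> 0} \<Longrightarrow> {\<gamma>. c \<gamma> \<noteq> 0} \<subseteq> \<Gamma> \<Longrightarrow>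
      0 \<le> Re (ell2_inner \<Gamma> (mat_app \<Gamma> G c) c) \<and> A * Re (ell2_inner \<Gamma> (mat_app \<Gamma> G c) c) \<le> (ell2_norm \<Gamma> (mat_app \<Gamma> G c))\<^sup>2"
    and slow_weight: "0 < \<delta> \<Longrightarrow> finite M \<Longrightarrow>
      \<exists>w :: 'k \<Rightarrow> real. (\<forall>k. 0 < w k \<and> w k \<le> 1) \<and> w 0 = 1 \<and> w summable_on UNIV \<and>
          (\<forall>m\<in>M. \<forall>k. \<bar>w (k + m) - w k\<bar> \<le> \<delta> * w k)"
begin

abbreviation "T \<equiv> mat_app \<Gamma> G"

section \<open>Truncation to finite support and the quadratic form of \<open>T\<close>\<close>

definition restr where "restr S u = (\<lambda>\<gamma>. if \<gamma> \<in> S then u \<gamma> else (0::complex))"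

lemma restr_ell1:
  assumes "u \<in> ell1 \<Gamma>"
  shows "restr S u \<in> ell1 \<Gamma>"
proof -
  have "(\<lambda>\<gamma>. (if \<gamma> \<in> S then 1 else 0) * u \<gamma>) \<in> ell1 \<Gamma>"
    by (rule ell1_mult_bounded[OF assms, of _ 1]) auto
  also have "(\<lambda>\<gamma>. (if \<gamma> \<in> S then 1 else 0) * u \<gamma>) = restr S u" by (auto simp: restr_def)
  finally show ?thesis .
qed

lemma restr_approx:
  assumes "u \<in> ell1 \<Gamma>" "0 < \<epsilon>"
  obtains S where "finite S" "S \<subseteq> \<Gamma>" "ell2_norm \<Gamma> (\<lambda>\<gamma>. u \<gamma> - restr S u \<gamma>) < \<epsilon>"
proof -
  have "(\<lambda>\<gamma>. norm (u \<gamma>)) summable_on \<Gamma>" using assms(1) by (simp add: ell1_def)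
  then obtain S where S: "finite S" "S \<subseteq> \<Gamma>" "(\<Sum>\<^sub>\<infinity>\<gamma>\<in>\<Gamma> - S. norm (u \<gamma>)) < \<epsilon>"
    by (rule finite_subset_approx[OF _ norm_ge_zero assms(2)])
  have "ell2_norm \<Gamma> (\<lambda>\<gamma>. u \<gamma> - restr S u \<gamma>) \<le> (\<Sum>\<^sub>\<infinity>\<gamma>\<in>\<Gamma>. norm (u \<gamma> - restr S u \<gamma>))"
    by (intro ell2_norm_le_ell1 ell1_diff assms restr_ell1)
  also have "\<dots> = (\<Sum>\<^sub>\<infinity>\<gamma>\<in>\<Gamma> - S. norm (u \<gamma>))"
    by (rule infsum_cong_neutral) (auto simp: restr_def)
  finally have "ell2_norm \<Gamma> (\<lambda>\<gamma>. u \<gamma> - restr S u \<gamma>) < \<epsilon>" using S(3) by linarith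
  with S(1,2) show ?thesis by (rule that)
qed

lemma restr_seq:
  assumes "u \<in> ell1 \<Gamma>"
  obtains S where "\<And>n::nat. finite (S n)" "\<And>n. S n \<subseteq> \<Gamma>"
    "(\<lambda>n. ell2_norm \<Gamma> (\<lambda>\<gamma>. u \<gamma> - restr (S n) u \<gamma>)) \<longlonglongrightarrow> 0"
proof -
  have "\<forall>n. \<exists>S. finite S \<and> S \<subseteq> \<Gamma> \<and> ell2_norm \<Gamma> (\<lambda>\<gamma>. u \<gamma> - restr S u \<gamma>) < 1 / real (Suc n)"
  proof
    fix n show "\<exists>S. finite S \<and> S \<subseteq> \<Gamma> \<and> ell2_norm \<Gamma> (\<lambda>\<gamma>. u \<gamma> - restr S u \<gamma>) < 1 / real (Suc n)"
      by (rule restr_approx[OF assms, of "1 / real (Suc n)"]) auto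
  qed
  from choice[OF this] obtain S where S: "\<And>n. finite (S n)" "\<And>n. S n \<subseteq> \<Gamma>"
      "\<And>n. ell2_norm \<Gamma> (\<lambda>\<gamma>. u \<gamma> - restr (S n) u \<gamma>) < 1 / real (Suc n)" by blast
  have "(\<lambda>n. ell2_norm \<Gamma> (\<lambda>\<gamma>. u \<gamma> - restr (S n) u \<gamma>)) \<longlonglongrightarrow> 0"
    by (rule tendsto_sandwich[OF _ _ tendsto_const LIMSEQ_inverse_real_of_nat])
      (use S(3) in \<open>auto simp: ell2_norm_nonneg inverse_eq_divide less_imp_le\<close>)
  with S(1,2) show ?thesis by (rule that)
qed

lemma ell2_norm_tendsto:
  assumes "u \<in> ell1 \<Gamma>" "\<And>n. v n \<in> ell1 \<Gamma>" "(\<lambda>n. ell2_norm \<Gamma> (\<lambda>\<gamma>. u \<gamma> - v n \<gamma>)) \<longlonglongrightarrow> 0"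
  shows "(\<lambda>n. ell2_norm \<Gamma> (v n)) \<longlonglongrightarrow> ell2_norm \<Gamma> u"
proof (rule Lim_transform2[OF tendsto_const])
  have "norm (ell2_norm \<Gamma> u - ell2_norm \<Gamma> (v n)) \<le> ell2_norm \<Gamma> (\<lambda>\<gamma>. u \<gamma> - v n \<gamma>)" for n
  proof -
    have "ell2_norm \<Gamma> (v n) \<le> ell2_norm \<Gamma> u + ell2_norm \<Gamma> (\<lambda>\<gamma>. u \<gamma> - v n \<gamma>)"
      using ell2_norm_triangle_diff[OF assms(1) ell1_diff[OF assms(1) assms(2)[of n]]] by simp
    moreover have "ell2_norm \<Gamma> u \<le> ell2_norm \<Gamma> (v n) + ell2_norm \<Gamma> (\<lambda>\<gamma>. u \<gamma> - v n \<gamma>)"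
      using ell2_norm_triangle[OF assms(2)[of n] ell1_diff[OF assms(1) assms(2)[of n]]] by simp
    ultimately show ?thesis by (simp add: abs_le_iff)
  qed
  then show "(\<lambda>n. ell2_norm \<Gamma> u - ell2_norm \<Gamma> (v n)) \<longlonglongrightarrow> 0"
    by (intro Lim_null_comparison[OF _ assms(3)]) auto
qed

text \<open>Both sides are continuous for \<open>ell2_norm\<close>, and truncations to finite sets
  converge in it; boundedness of \<open>T\<close> carries the convergence over to
  \<open>T u\<close>.\<close>

lemma gap:
  assumes "u \<in> ell1 \<Gamma>"
  shows "0 \<le> Re (ell2_inner \<Gamma> (T u) u)" and "A * Re (ell2_inner \<Gamma> (T u) u) \<le> (ell2_norm \<Gamma> (T u))\<^sup>2"
proof -
  obtain S where S: "\<And>n::nat. finite (S n)" "\<And>n. S n \<subseteq> \<Gamma>"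
    and lim: "(\<lambda>n. ell2_norm \<Gamma> (\<lambda>\<gamma>. u \<gamma> - restr (S n) u \<gamma>)) \<longlonglongrightarrow> 0" using restr_seq[OF assms] by blast
  define v where "v n = restr (S n) u" for n
  have v: "v n \<in> ell1 \<Gamma>" for n unfolding v_def by (rule restr_ell1[OF assms])
  have d: "(\<lambda>\<gamma>. u \<gamma> - v n \<gamma>) \<in> ell1 \<Gamma>" for n by (rule ell1_diff[OF assms v])
  have sup: "{\<gamma>. v n \<gamma> \<noteq> 0} \<subseteq> S n" for n by (auto simp: v_def restr_def)
  have fin: "0 \<le> Re (ell2_inner \<Gamma> (T (v n)) (v n)) \<and> A * Re (ell2_inner \<Gamma> (T (v n)) (v n)) \<le> (ell2_norm \<Gamma> (T (v n)))\<^sup>2" for n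
    by (rule gap_finite[OF finite_subset[OF sup S(1)] subset_trans[OF sup S(2)]])
  have n2v: "(\<lambda>n. ell2_norm \<Gamma> (v n)) \<longlonglongrightarrow> ell2_norm \<Gamma> u"
    by (rule ell2_norm_tendsto[OF assms v]) (use lim in \<open>simp add: v_def\<close>)
  have Td: "(\<lambda>n. ell2_norm \<Gamma> (\<lambda>\<gamma>. T u \<gamma> - T (v n) \<gamma>)) \<longlonglongrightarrow> 0"
  proof (rule Lim_null_comparison[OF always_eventually])
    show "(\<lambda>n. B * ell2_norm \<Gamma> (\<lambda>\<gamma>. u \<gamma> - v n \<gamma>)) \<longlonglongrightarrow> 0"
      using tendsto_mult_left[OF lim, of B] by (simp add: v_def)
    show "\<forall>n. norm (ell2_norm \<Gamma> (\<lambda>\<gamma>. T u \<gamma> - T (v n) \<gamma>)) \<le> B * ell2_norm \<Gamma> (\<lambda>\<gamma>. u \<gamma> - v n \<gamma>)"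
      using mat_app_ell2_norm[OF d] by (simp add: mat_app_diff[OF assms v] ell2_norm_nonneg)
  qed
  have Tv: "(\<lambda>n. ell2_norm \<Gamma> (T (v n))) \<longlonglongrightarrow> ell2_norm \<Gamma> (T u)"
    by (rule ell2_norm_tendsto[OF mat_app_ell1[OF assms] mat_app_ell1[OF v] Td])
  have ell2_inner: "(\<lambda>n. Re (ell2_inner \<Gamma> (T (v n)) (v n))) \<longlonglongrightarrow> Re (ell2_inner \<Gamma> (T u) u)"
  proof (rule tendsto_Re, rule Lim_transform2[OF tendsto_const])
    have "norm (ell2_inner \<Gamma> (T u) u - ell2_inner \<Gamma> (T (v n)) (v n))
        \<le> ell2_norm \<Gamma> (\<lambda>\<gamma>. T u \<gamma> - T (v n) \<gamma>) * ell2_norm \<Gamma> u + ell2_norm \<Gamma> (T (v n)) * ell2_norm \<Gamma> (\<lambda>\<gamma>. u \<gamma> - v n \<gamma>)" for n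
    proof -
      have "ell2_inner \<Gamma> (T u) u = ell2_inner \<Gamma> (\<lambda>\<gamma>. T u \<gamma> - T (v n) \<gamma>) u + ell2_inner \<Gamma> (T (v n)) u"
        using ell2_inner_add_left[OF ell1_diff[OF mat_app_ell1[OF assms] mat_app_ell1[OF v]] mat_app_ell1[OF v] assms, of n n] by simp
      moreover have "ell2_inner \<Gamma> (T (v n)) u = ell2_inner \<Gamma> (T (v n)) (\<lambda>\<gamma>. u \<gamma> - v n \<gamma>) + ell2_inner \<Gamma> (T (v n)) (v n)"
        using ell2_inner_add_right[OF d v mat_app_ell1[OF v], of n n n] by simp
      ultimately have "ell2_inner \<Gamma> (T u) u - ell2_inner \<Gamma> (T (v n)) (v n)
          = ell2_inner \<Gamma> (\<lambda>\<gamma>. T u \<gamma> - T (v n) \<gamma>) u + ell2_inner \<Gamma> (T (v n)) (\<lambda>\<gamma>. u \<gamma> - v n \<gamma>)" by simp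
      then show ?thesis
        using norm_triangle_ineq[of "ell2_inner \<Gamma> (\<lambda>\<gamma>. T u \<gamma> - T (v n) \<gamma>) u" "ell2_inner \<Gamma> (T (v n)) (\<lambda>\<gamma>. u \<gamma> - v n \<gamma>)"]
          ell2_inner_Cauchy_Schwarz[OF ell1_diff[OF mat_app_ell1[OF assms] mat_app_ell1[OF v]] assms, of n]
          ell2_inner_Cauchy_Schwarz[OF mat_app_ell1[OF v] d, of n n] by simp
    qed
    moreover have "(\<lambda>n. ell2_norm \<Gamma> (\<lambda>\<gamma>. T u \<gamma> - T (v n) \<gamma>) * ell2_norm \<Gamma> u + ell2_norm \<Gamma> (T (v n)) * ell2_norm \<Gamma> (\<lambda>\<gamma>. u \<gamma> - v n \<gamma>)) \<longlonglongrightarrow> 0 * ell2_norm \<Gamma> u + ell2_norm \<Gamma> (T u) * 0"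
      by (intro tendsto_add tendsto_mult tendsto_const Td Tv lim[folded v_def])
    ultimately show "(\<lambda>n. ell2_inner \<Gamma> (T u) u - ell2_inner \<Gamma> (T (v n)) (v n)) \<longlonglongrightarrow> 0"
      by (intro Lim_null_comparison[where f = "\<lambda>n. ell2_inner \<Gamma> (T u) u - ell2_inner \<Gamma> (T (v n)) (v n)", OF always_eventually]) auto
  qed
  show "0 \<le> Re (ell2_inner \<Gamma> (T u) u)"
    using fin by (intro tendsto_lowerbound[OF ell2_inner always_eventually]) auto
  show "A * Re (ell2_inner \<Gamma> (T u) u) \<le> (ell2_norm \<Gamma> (T u))\<^sup>2"
    using fin by (intro tendsto_le[OF sequentially_bot tendsto_power[OF Tv] tendsto_mult_left[OF ell2_inner]] always_eventually) simp
qed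

lemma ell2_inner_T_real:
  assumes "u \<in> ell1 \<Gamma>"
  shows "ell2_inner \<Gamma> (T u) u = complex_of_real (Re (ell2_inner \<Gamma> (T u) u))"
proof -
  have "cnj (ell2_inner \<Gamma> (T u) u) = ell2_inner \<Gamma> (T u) u"
    by (rule trans[OF ell2_inner_commute[symmetric] mat_app_adjoint[OF herm assms assms, symmetric]])
  then show ?thesis by (simp add: complex_eq_iff)
qed

text \<open>
  The shift by \<open>z \<noteq> 0\<close> makes the bound hold on the kernel of \<open>T\<close> as well, so that it survives the
  multiplication of a vector by a cut-off function.
\<close>
lemma resolvent_bound:
  assumes "u \<in> ell1 \<Gamma>" "norm z \<le> A / 2"
  shows "norm z * ell2_norm \<Gamma> u \<le> ell2_norm \<Gamma> (\<lambda>\<gamma>. T u \<gamma> - z * u \<gamma>)"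
proof -
  define p where "p = Re (ell2_inner \<Gamma> (T u) u)"
  \<comment> \<open>The cross term in the expansion of the square is \<open>2 Re z\<close> times the
    form \<open>p\<close>. Since \<open>2 Re z \<le> A\<close>, the gap lets the square of
    \<open>ell2_norm \<Gamma> (T u)\<close> absorb it, and the term in \<open>norm z\<close> is left
    over.\<close>
  have "2 * Re (cnj z * ell2_inner \<Gamma> (T u) u) = 2 * Re z * p"
    by (subst ell2_inner_T_real[OF assms(1)]) (simp add: p_def)
  also have "\<dots> \<le> A * p"
    using assms(2) abs_Re_le_cmod[of z] gap(1)[OF assms(1)] by (intro mult_right_mono) (auto simp: p_def)
  also have "\<dots> \<le> (ell2_norm \<Gamma> (T u))\<^sup>2" using gap(2)[OF assms(1)] by (simp add: p_def)
  finally have "(norm z * ell2_norm \<Gamma> u)\<^sup>2 \<le> (ell2_norm \<Gamma> (\<lambda>\<gamma>. T u \<gamma> - z * u \<gamma>))\<^sup>2"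
    unfolding ell2_norm_diff_sq[OF mat_app_ell1[OF assms(1)] assms(1)] by (simp add: power_mult_distrib)
  then show ?thesis by (rule power2_le_imp_le[OF _ ell2_norm_nonneg])
qed

text \<open>Positivity of the form at \<open>y = u - T u / A\<close> corresponds to
  \<open>t (1 - t / A)\<^sup>2 \<ge> 0\<close> on the spectrum. Combined with
  \<open>t\<^sup>2 \<ge> A t\<close> it yields \<open>t\<^sup>3 \<ge> A t\<^sup>2\<close>: the
  operator is bounded below by \<open>A\<close> on its range. Evaluating the form at a suitable
  vector replaces functional calculus.\<close>

lemma gap_range:
  assumes "u \<in> ell1 \<Gamma>"
  shows "A * (ell2_norm \<Gamma> (T u))\<^sup>2 \<le> Re (ell2_inner \<Gamma> (T (T u)) (T u))"
proof -
  define x where "x = T u"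
  have x: "x \<in> ell1 \<Gamma>" unfolding x_def by (rule mat_app_ell1[OF assms])
  define t where "t = complex_of_real (- (1 / A))"
  define y where "y = (\<lambda>\<gamma>. u \<gamma> + t * x \<gamma>)"
  have tx: "(\<lambda>\<gamma>. t * x \<gamma>) \<in> ell1 \<Gamma>" by (rule ell1_cmult[OF x])
  have y: "y \<in> ell1 \<Gamma>" unfolding y_def by (rule ell1_add[OF assms tx])
  have Ty: "T y = (\<lambda>\<gamma>. x \<gamma> + t * T x \<gamma>)"
    unfolding y_def mat_app_add[OF assms tx] mat_app_cmult by (simp only: x_def)
  have "ell2_inner \<Gamma> (T y) y = ell2_inner \<Gamma> x u + cnj t * ell2_inner \<Gamma> x x + (t * ell2_inner \<Gamma> (T x) u + t * cnj t * ell2_inner \<Gamma> (T x) x)"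
    unfolding Ty unfolding y_def
    by (simp add: ell2_inner_add_left ell2_inner_add_right ell1_add ell1_cmult mat_app_ell1 assms x ell2_inner_cmult_left ell2_inner_cmult_right algebra_simps)
  also have "ell2_inner \<Gamma> (T x) u = ell2_inner \<Gamma> x x" using mat_app_adjoint[OF herm x assms] by (simp add: x_def)
  finally have "0 \<le> Re (ell2_inner \<Gamma> x u) - 2 / A * (ell2_norm \<Gamma> x)\<^sup>2 + Re (ell2_inner \<Gamma> (T x) x) / A\<^sup>2"
    using gap(1)[OF y] by (simp add: ell2_inner_self[OF x] t_def power2_eq_square)
  moreover have "Re (ell2_inner \<Gamma> x u) \<le> (ell2_norm \<Gamma> x)\<^sup>2 / A"
    using gap(2)[OF assms] A_pos by (simp add: x_def field_simps)
  ultimately have "0 \<le> (ell2_norm \<Gamma> x)\<^sup>2 / A - 2 / A * (ell2_norm \<Gamma> x)\<^sup>2 + Re (ell2_inner \<Gamma> (T x) x) / A\<^sup>2" by linarith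
  then have "(ell2_norm \<Gamma> x)\<^sup>2 / A \<le> Re (ell2_inner \<Gamma> (T x) x) / A\<^sup>2" by (simp add: algebra_simps)
  then show ?thesis using A_pos by (simp add: field_simps power2_eq_square x_def)
qed

text \<open>The commutator of \<open>w\<close> with \<open>T\<close> has entries
  \<open>(w (k + m) - w k) * G \<gamma> \<gamma>'\<close>. On diagonals in \<open>M\<close> slow
  variation makes them small; elsewhere the difference is at most the sum of the two weights. In
  both cases the input carries weights centred at \<open>a\<close> and at \<open>a - m\<close>, so a
  bound \<open>L\<close> uniform in the centre is what closes the estimate.\<close>

lemma commutator_bound:
  fixes w :: "'k \<Rightarrow> real" and u :: "'i \<Rightarrow> complex"
  assumes w: "\<And>k. 0 < w k" "\<And>k. w k \<le> 1"
    and slow: "\<And>m k. m \<in> M \<Longrightarrow> \<bar>w (k + m) - w k\<bar> \<le> \<delta> * w k" and \<delta>: "0 \<le> \<delta>"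
    and u: "u \<in> ell1 \<Gamma>" and L: "\<And>a. ell2_norm \<Gamma> (\<lambda>\<gamma>. w (q \<gamma> - a) * u \<gamma>) \<le> L"
  shows "ell2_norm \<Gamma> (\<lambda>\<gamma>. w (q \<gamma> - a) * T u \<gamma> - T (\<lambda>\<gamma>. w (q \<gamma> - a) * u \<gamma>) \<gamma>)
    \<le> real N * (\<Sum>\<^sub>\<infinity>m. \<Xi> m * (if m \<in> M then \<delta> else 1)) * (2 * L)"
proof -
  have wl: "(\<lambda>\<gamma>. complex_of_real (w (q \<gamma> - a)) * u \<gamma>) \<in> ell1 \<Gamma>" for a
    by (rule ell1_mult_bounded[OF u, of _ 1]) (simp add: w less_imp_le)
  \<comment> \<open>On the diagonal \<open>m = q \<gamma> - q \<gamma>'\<close> the weight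
    \<open>w (q \<gamma> - a)\<close> of the output index equals
    \<open>w (q \<gamma>' - (a - m))\<close>: it becomes a weight on the input index with a shifted
    centre.\<close>
  define h where "h m \<gamma> = (w (q \<gamma> - a) + w (q \<gamma> - (a - m))) * norm (u \<gamma>)" for m \<gamma>
  show ?thesis
  proof (rule schur[where k = "\<lambda>\<gamma> \<gamma>'. w (q \<gamma> - a) * (G \<gamma> \<gamma>' * u \<gamma>') - G \<gamma> \<gamma>' * (w (q \<gamma>' - a) * u \<gamma>')" and h = h])
    fix \<gamma>
    show "((\<lambda>\<gamma>'. w (q \<gamma> - a) * (G \<gamma> \<gamma>' * u \<gamma>') - G \<gamma> \<gamma>' * (w (q \<gamma>' - a) * u \<gamma>')) has_sum
        w (q \<gamma> - a) * T u \<gamma> - T (\<lambda>\<gamma>. w (q \<gamma> - a) * u \<gamma>) \<gamma>) \<Gamma>"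
      using has_sum_diff[OF has_sum_cmult_right[OF mat_app_has_sum[OF u]] mat_app_has_sum[OF wl]]
      by blast
  next
    fix \<gamma> \<gamma>'
    define k where "k = q \<gamma>' - a"
    define m where "m = q \<gamma> - q \<gamma>'"
    have km: "q \<gamma> - a = k + m" "q \<gamma>' - (a - m) = k + m" by (simp_all add: k_def m_def algebra_simps)
    have "\<bar>w (k + m) - w k\<bar> \<le> (if m \<in> M then \<delta> else 1) * (w k + w (k + m))"
    proof (cases "m \<in> M")
      case True
      have "\<delta> * w k \<le> \<delta> * (w k + w (k + m))" using w(1)[of "k + m"] \<delta> by (intro mult_left_mono) auto
      then show ?thesis using slow[OF True, of k] True by simp
    next
      case False
      then show ?thesis using w(1)[of k] w(1)[of "k + m"] by simp
    qed
    then have "norm (G \<gamma> \<gamma>') * (\<bar>w (k + m) - w k\<bar> * norm (u \<gamma>'))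
        \<le> \<Xi> m * ((if m \<in> M then \<delta> else 1) * (w k + w (k + m)) * norm (u \<gamma>'))"
      unfolding m_def by (intro mult_mono dom mult_right_mono) (auto simp: \<Xi>_nonneg)
    moreover have "w (q \<gamma> - a) * (G \<gamma> \<gamma>' * u \<gamma>') - G \<gamma> \<gamma>' * (w (q \<gamma>' - a) * u \<gamma>')
        = G \<gamma> \<gamma>' * (complex_of_real (w (k + m) - w k) * u \<gamma>')"
      by (simp add: km k_def[symmetric] algebra_simps)
    ultimately show "norm (w (q \<gamma> - a) * (G \<gamma> \<gamma>' * u \<gamma>') - G \<gamma> \<gamma>' * (w (q \<gamma>' - a) * u \<gamma>'))
      \<le> \<Xi> (q \<gamma> - q \<gamma>') * (if q \<gamma> - q \<gamma>' \<in> M then \<delta> else 1) * h (q \<gamma> - q \<gamma>') \<gamma>'"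
      unfolding m_def[symmetric] h_def km k_def[symmetric]
      by (simp only: norm_mult norm_of_real mult.assoc)
  next
    show "(\<lambda>m. \<Xi> m * (if m \<in> M then \<delta> else 1)) summable_on UNIV"
      by (rule summable_on_bound_real[OF summable_on_cmult_right[OF \<Xi>_summable, of "\<delta> + 1"]])
        (use \<delta> \<Xi>_nonneg in \<open>auto simp: algebra_simps\<close>)
    show "0 \<le> \<Xi> k * (if k \<in> M then \<delta> else 1)" for k using \<delta> \<Xi>_nonneg by simp
    show "0 \<le> h m \<gamma>" for m \<gamma> using w(1) by (simp add: h_def less_imp_le add_nonneg_nonneg)
    show "0 \<le> 2 * L" using order_trans[OF ell2_norm_nonneg L] by simp
    fix m S assume S: "finite S" "S \<subseteq> \<Gamma>"
    let ?v = "\<lambda>\<gamma>. w (q \<gamma> - a) * u \<gamma> + w (q \<gamma> - (a - m)) * u \<gamma>"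
    have "h m \<gamma> = norm (?v \<gamma>)" for \<gamma>
    proof -
      have "?v \<gamma> = complex_of_real (w (q \<gamma> - a) + w (q \<gamma> - (a - m))) * u \<gamma>" by (simp add: algebra_simps)
      then show ?thesis using w(1)[of "q \<gamma> - a"] w(1)[of "q \<gamma> - (a - m)"]
        by (simp only: norm_mult norm_of_real h_def)
    qed
    then have "(\<Sum>\<gamma>\<in>S. (h m \<gamma>)\<^sup>2) = (\<Sum>\<gamma>\<in>S. (norm (?v \<gamma>))\<^sup>2)" by simp
    also have "\<dots> \<le> (ell2_norm \<Gamma> ?v)\<^sup>2" by (rule sum_le_ell2_norm[OF ell1_add[OF wl wl] S])
    also have "\<dots> \<le> (2 * L)\<^sup>2"
      using ell2_norm_triangle[OF wl wl, of a "a - m"] L[of a] L[of "a - m"] by (intro power_mono ell2_norm_nonneg) linarith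
    finally show "(\<Sum>\<gamma>\<in>S. (h m \<gamma>)\<^sup>2) \<le> (2 * L)\<^sup>2" .
  qed
qed

text \<open>A summable weight turns a sup bound into an \<open>ell2_norm\<close> bound, uniformly in
  the centre \<open>a\<close>; \<open>w \<le> 1\<close> gives \<open>w\<^sup>2 \<le> w\<close>, so
  summability of \<open>w\<close> itself suffices.\<close>

lemma weighted_ell2_norm_le:
  assumes w: "\<And>k. 0 < w k" "\<And>k. w k \<le> 1" "w summable_on UNIV"
    and b: "\<And>\<gamma>. \<gamma> \<in> \<Gamma> \<Longrightarrow> norm (b \<gamma>) \<le> K" and K: "0 \<le> K"
  shows "ell2_norm \<Gamma> (\<lambda>\<gamma>. complex_of_real (w (q \<gamma> - a)) * b \<gamma>) \<le> sqrt (real N * (\<Sum>\<^sub>\<infinity>k. w k)) * K"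
proof (rule ell2_norm_leI)
  have W: "0 \<le> real N * (\<Sum>\<^sub>\<infinity>k. w k)" by (intro mult_nonneg_nonneg infsum_nonneg) (auto simp: w less_imp_le)
  then show "0 \<le> sqrt (real N * (\<Sum>\<^sub>\<infinity>k. w k)) * K" using K by simp
  fix S assume S: "finite S" "S \<subseteq> \<Gamma>"
  have "(\<Sum>\<gamma>\<in>S. (norm (complex_of_real (w (q \<gamma> - a)) * b \<gamma>))\<^sup>2) \<le> (\<Sum>\<gamma>\<in>S. w (q \<gamma> - a) * K\<^sup>2)"
  proof (rule sum_mono)
    fix \<gamma> assume "\<gamma> \<in> S"
    then have "(norm (b \<gamma>))\<^sup>2 \<le> K\<^sup>2" using S b by (intro power_mono) auto
    moreover have "(w (q \<gamma> - a))\<^sup>2 \<le> w (q \<gamma> - a)"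
      using w(1,2)[of "q \<gamma> - a"] by (simp add: power2_eq_square mult_left_le)
    ultimately show "(norm (complex_of_real (w (q \<gamma> - a)) * b \<gamma>))\<^sup>2 \<le> w (q \<gamma> - a) * K\<^sup>2"
      using w(1)[of "q \<gamma> - a"] by (simp add: norm_mult power_mult_distrib mult_mono)
  qed
  also have "\<dots> \<le> real N * (\<Sum>\<^sub>\<infinity>k. w k) * K\<^sup>2"
    unfolding sum_distrib_right[symmetric]
    by (intro mult_right_mono sum_cells_left S w) (auto simp: w less_imp_le)
  also have "\<dots> = (sqrt (real N * (\<Sum>\<^sub>\<infinity>k. w k)) * K)\<^sup>2" using W by (simp add: power_mult_distrib)
  finally show "(\<Sum>\<gamma>\<in>S. (norm (complex_of_real (w (q \<gamma> - a)) * b \<gamma>))\<^sup>2) \<le> (sqrt (real N * (\<Sum>\<^sub>\<infinity>k. w k)) * K)\<^sup>2" .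
qed

lemma small_commutator_weight:
  assumes "0 < \<eta>"
  shows "\<exists>(w :: 'k \<Rightarrow> real) \<delta> M. (\<forall>k. 0 < w k \<and> w k \<le> 1) \<and> w 0 = 1 \<and> w summable_on UNIV \<and> 0 \<le> \<delta> \<and>
    (\<forall>m\<in>M. \<forall>k. \<bar>w (k + m) - w k\<bar> \<le> \<delta> * w k) \<and>
    (\<Sum>\<^sub>\<infinity>m. \<Xi> m * (if m \<in> M then \<delta> else 1)) \<le> \<eta>"
proof -
  define X where "X = (\<Sum>\<^sub>\<infinity>k. \<Xi> k)"
  have X: "0 \<le> X" unfolding X_def by (simp add: infsum_nonneg \<Xi>_nonneg)
  obtain M where M: "finite M" "(\<Sum>\<^sub>\<infinity>k\<in>UNIV - M. \<Xi> k) < \<eta> / 2"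
    by (rule finite_subset_approx[OF \<Xi>_summable \<Xi>_nonneg, of "\<eta> / 2"]) (use assms in auto)
  \<comment> \<open>The finite set \<open>M\<close> leaves out less than \<open>\<eta> / 2\<close>
    of the mass of \<open>\<Xi>\<close>, and \<open>\<delta>\<close> makes the damped mass on
    \<open>M\<close> at most \<open>\<eta> / 2\<close>; \<open>X + 1\<close> keeps the denominator
    positive when \<open>\<Xi>\<close> vanishes.\<close>
  define \<delta> where "\<delta> = \<eta> / (2 * (X + 1))"
  have \<delta>: "0 < \<delta>" using assms X by (simp add: \<delta>_def)
  obtain w where w: "\<And>k. 0 < w k \<and> w k \<le> (1::real)" "w 0 = 1" "w summable_on UNIV"
     "\<And>m k. m \<in> M \<Longrightarrow> \<bar>w (k + m) - w k\<bar> \<le> \<delta> * w k"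
    using slow_weight[OF \<delta> M(1)] by blast
  have s: "\<Xi> summable_on M" "\<Xi> summable_on (UNIV - M)"
    using summable_on_subset_banach[OF \<Xi>_summable] by auto
  have "((\<lambda>m. \<Xi> m * (if m \<in> M then \<delta> else 1)) has_sum (infsum \<Xi> M * \<delta>)) M"
    using has_sum_cmult_left[OF has_sum_infsum[OF s(1)], of \<delta>] by (rule has_sum_cong[THEN iffD1, rotated]) auto
  moreover have "((\<lambda>m. \<Xi> m * (if m \<in> M then \<delta> else 1)) has_sum (infsum \<Xi> (UNIV - M))) (UNIV - M)"
    using has_sum_infsum[OF s(2)] by (rule has_sum_cong[THEN iffD1, rotated]) auto
  ultimately have "((\<lambda>m. \<Xi> m * (if m \<in> M then \<delta> else 1)) has_sum (infsum \<Xi> M * \<delta> + infsum \<Xi> (UNIV - M))) (M \<union> (UNIV - M))"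
    by (rule has_sum_Un_disjoint) auto
  then have "(\<Sum>\<^sub>\<infinity>m. \<Xi> m * (if m \<in> M then \<delta> else 1)) = infsum \<Xi> M * \<delta> + infsum \<Xi> (UNIV - M)"
    by (simp add: infsumI)
  moreover have "infsum \<Xi> M \<le> X"
    unfolding X_def by (rule infsum_mono_neutral[OF s(1) \<Xi>_summable]) (auto simp: \<Xi>_nonneg)
  then have "infsum \<Xi> M * \<delta> \<le> X * \<delta>" using \<delta> by (intro mult_right_mono) auto
  moreover have "X * \<delta> \<le> \<eta> / 2" using X assms by (simp add: \<delta>_def field_simps)
  ultimately have "(\<Sum>\<^sub>\<infinity>m. \<Xi> m * (if m \<in> M then \<delta> else 1)) \<le> \<eta>" using M(2) by linarith
  then show ?thesis using w \<delta> by (intro exI[of _ w] exI[of _ \<delta>] exI[of _ M]) auto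
qed

text \<open>
  The \<open>\<ell>\<^sup>2\<close> resolvent bound is transferred to the sup norm by testing it on \<open>w (q - a) u\<close>; the
  commutator with a slowly varying weight is absorbed into the left-hand side.
\<close>
lemma resolvent_sup_bound:
  shows "\<exists>C\<ge>0. \<forall>z u K. norm z = A / 4 \<longrightarrow> u \<in> ell1 \<Gamma> \<longrightarrow> (\<forall>\<gamma>\<in>\<Gamma>. norm (T u \<gamma> - z * u \<gamma>) \<le> K) \<longrightarrow>
    (\<forall>\<gamma>\<in>\<Gamma>. norm (u \<gamma>) \<le> C * K)"
proof -
  define r where "r = A / 4"
  have r: "0 < r" using A_pos by (simp add: r_def)
  \<comment> \<open>With this size the commutator contributes at most \<open>r / 2 * L\<close>, that
    is half of the left-hand side after taking the supremum over the centres.\<close>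
  define \<eta> where "\<eta> = r / (4 * (real N + 1))"
  have \<eta>: "0 < \<eta>" using r by (simp add: \<eta>_def)
  obtain w \<delta> M where w: "\<And>k. 0 < w k" "\<And>k. w k \<le> (1::real)" "w 0 = 1" "w summable_on UNIV" "0 \<le> \<delta>"
    "\<And>m k. m \<in> M \<Longrightarrow> \<bar>w (k + m) - w k\<bar> \<le> \<delta> * w k"
    and small: "(\<Sum>\<^sub>\<infinity>m. \<Xi> m * (if m \<in> M then \<delta> else 1)) \<le> \<eta>"
    using small_commutator_weight[OF \<eta>] by blast
  define D where "D = sqrt (real N * (\<Sum>\<^sub>\<infinity>k. w k))"
  have D: "0 \<le> D" unfolding D_def by (intro real_sqrt_ge_zero mult_nonneg_nonneg infsum_nonneg) (auto simp: w less_imp_le)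
  have main: "norm (u \<gamma>) \<le> 2 * D / r * K" if z: "norm z = A / 4" and u: "u \<in> ell1 \<Gamma>"
      and K: "\<And>\<gamma>. \<gamma> \<in> \<Gamma> \<Longrightarrow> norm (T u \<gamma> - z * u \<gamma>) \<le> K" and \<gamma>: "\<gamma> \<in> \<Gamma>" for z K \<gamma> and u :: "'i \<Rightarrow> complex"
  proof -
    have K0: "0 \<le> K" using K[OF \<gamma>] norm_ge_zero order_trans by blast
    have wl: "(\<lambda>\<gamma>. complex_of_real (w (q \<gamma> - a)) * v \<gamma>) \<in> ell1 \<Gamma>" if "v \<in> ell1 \<Gamma>" for a and v :: "'i \<Rightarrow> complex"
      by (rule ell1_mult_bounded[OF that, of _ 1]) (simp add: w less_imp_le)
    \<comment> \<open>The supremum over all centres is finite because \<open>u\<close> is summable,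
      which legitimises the absorption of \<open>L / 2\<close>. Its size does not enter the final
      constant.\<close>
    define L where "L = (SUP a. ell2_norm \<Gamma> (\<lambda>\<gamma>. w (q \<gamma> - a) * u \<gamma>))"
    have "ell2_norm \<Gamma> (\<lambda>\<gamma>. w (q \<gamma> - a) * u \<gamma>) \<le> ell2_norm \<Gamma> u" for a
    proof (rule ell2_norm_leI[OF ell2_norm_nonneg])
      fix S assume S: "finite S" "S \<subseteq> \<Gamma>"
      have "(\<Sum>\<gamma>\<in>S. (norm (w (q \<gamma> - a) * u \<gamma>))\<^sup>2) \<le> (\<Sum>\<gamma>\<in>S. (norm (u \<gamma>))\<^sup>2)"
        using w(1,2) by (intro sum_mono power_mono) (auto simp: norm_mult less_imp_le intro: mult_left_le_one_le)
      also have "\<dots> \<le> (ell2_norm \<Gamma> u)\<^sup>2" by (rule sum_le_ell2_norm[OF u S])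
      finally show "(\<Sum>\<gamma>\<in>S. (norm (w (q \<gamma> - a) * u \<gamma>))\<^sup>2) \<le> (ell2_norm \<Gamma> u)\<^sup>2" .
    qed
    then have bdd: "bdd_above (range (\<lambda>a. ell2_norm \<Gamma> (\<lambda>\<gamma>. w (q \<gamma> - a) * u \<gamma>)))" by (rule bdd_aboveI2)
    have L: "ell2_norm \<Gamma> (\<lambda>\<gamma>. w (q \<gamma> - a) * u \<gamma>) \<le> L" for a
      unfolding L_def by (rule cSUP_upper[OF _ bdd]) simp
    have L0: "0 \<le> L" by (rule order_trans[OF ell2_norm_nonneg L])
    have Lb: "ell2_norm \<Gamma> (\<lambda>\<gamma>. w (q \<gamma> - a) * u \<gamma>) \<le> D / r * K + L / 2" for a
    proof -
      define W where "W \<gamma> = complex_of_real (w (q \<gamma> - a))" for \<gamma>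
      define t where "t \<gamma> = W \<gamma> * T u \<gamma> - T (\<lambda>\<gamma>. W \<gamma> * u \<gamma>) \<gamma>" for \<gamma>
      define b where "b \<gamma> = T u \<gamma> - z * u \<gamma>" for \<gamma>
      have b: "b \<in> ell1 \<Gamma>" unfolding b_def by (intro ell1_diff ell1_cmult mat_app_ell1 u)
      have Wl: "(\<lambda>\<gamma>. W \<gamma> * v \<gamma>) \<in> ell1 \<Gamma>" if "v \<in> ell1 \<Gamma>" for v unfolding W_def by (rule wl[OF that])
      have t: "t \<in> ell1 \<Gamma>" unfolding t_def by (intro ell1_diff Wl mat_app_ell1 u)
      have "r * ell2_norm \<Gamma> (\<lambda>\<gamma>. W \<gamma> * u \<gamma>) \<le> ell2_norm \<Gamma> (\<lambda>\<gamma>. T (\<lambda>\<gamma>. W \<gamma> * u \<gamma>) \<gamma> - z * (W \<gamma> * u \<gamma>))"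
        using resolvent_bound[OF Wl[OF u], of z] z A_pos by (simp add: r_def)
      also have "(\<lambda>\<gamma>. T (\<lambda>\<gamma>. W \<gamma> * u \<gamma>) \<gamma> - z * (W \<gamma> * u \<gamma>)) = (\<lambda>\<gamma>. W \<gamma> * b \<gamma> - t \<gamma>)"
        by (simp add: t_def b_def algebra_simps)
      also have "ell2_norm \<Gamma> \<dots> \<le> ell2_norm \<Gamma> (\<lambda>\<gamma>. W \<gamma> * b \<gamma>) + ell2_norm \<Gamma> t" by (rule ell2_norm_triangle_diff[OF Wl[OF b] t])
      also have "ell2_norm \<Gamma> (\<lambda>\<gamma>. W \<gamma> * b \<gamma>) \<le> D * K"
        unfolding D_def W_def by (rule weighted_ell2_norm_le) (auto simp: w K K0 b_def)
      also have "ell2_norm \<Gamma> t \<le> real N * (\<Sum>\<^sub>\<infinity>m. \<Xi> m * (if m \<in> M then \<delta> else 1)) * (2 * L)"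
        unfolding t_def W_def by (rule commutator_bound[OF w(1,2,6,5) u L])
      also have "\<dots> \<le> real N * \<eta> * (2 * L)" by (intro mult_right_mono mult_left_mono small) (use L0 in auto)
      also have "\<dots> \<le> r / 2 * L"
      proof -
        have "real N * \<eta> * 2 \<le> r / 2" using r by (simp add: \<eta>_def field_simps)
        then have "real N * \<eta> * 2 * L \<le> r / 2 * L" using L0 by (rule mult_right_mono)
        then show ?thesis by (simp only: mult.assoc)
      qed
      finally have "r * ell2_norm \<Gamma> (\<lambda>\<gamma>. W \<gamma> * u \<gamma>) \<le> D * K + r / 2 * L" by simp
      also have "\<dots> = r * (D / r * K + L / 2)" using r by (simp add: distrib_left)
      finally have "r * ell2_norm \<Gamma> (\<lambda>\<gamma>. W \<gamma> * u \<gamma>) \<le> r * (D / r * K + L / 2)" .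
      then show ?thesis using r by (simp add: W_def)
    qed
    have "(SUP a. ell2_norm \<Gamma> (\<lambda>\<gamma>. w (q \<gamma> - a) * u \<gamma>)) \<le> D / r * K + L / 2"
      by (rule cSUP_least[OF UNIV_not_empty Lb])
    then have "L \<le> D / r * K + L / 2" by (simp only: L_def[symmetric])
    then have L': "L \<le> 2 * D / r * K" by simp
    \<comment> \<open>The weight centred at the cell of \<open>\<gamma>\<close> equals one there, so
      the value at \<open>\<gamma>\<close> is read off from the weighted norm.\<close>
    have "norm (u \<gamma>) = norm (w (q \<gamma> - q \<gamma>) * u \<gamma>)" by (simp add: w(3))
    also have "\<dots> \<le> ell2_norm \<Gamma> (\<lambda>\<gamma>'. w (q \<gamma>' - q \<gamma>) * u \<gamma>')" by (rule norm_le_ell2_norm[OF wl[OF u] \<gamma>])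
    finally show ?thesis using L[of "q \<gamma>"] L' by linarith
  qed
  show ?thesis by (rule exI[of _ "2 * D / r"]) (use D r main in auto)
qed

section \<open>Powers of the Gram operator: sup bounds and approximate preimages\<close>

lemma Tpow_ell1: "u \<in> ell1 \<Gamma> \<Longrightarrow> (T ^^ n) u \<in> ell1 \<Gamma>"
  by (induction n) (auto intro: mat_app_ell1)

lemma Tpow_add: "u \<in> ell1 \<Gamma> \<Longrightarrow> v \<in> ell1 \<Gamma> \<Longrightarrow> (T ^^ n) (\<lambda>\<gamma>. u \<gamma> + v \<gamma>) = (\<lambda>\<gamma>. (T ^^ n) u \<gamma> + (T ^^ n) v \<gamma>)"
  by (induction n) (auto simp: mat_app_add Tpow_ell1)

lemma Tpow_cmult: "(T ^^ n) (\<lambda>\<gamma>. z * u \<gamma>) = (\<lambda>\<gamma>. z * (T ^^ n) u \<gamma>)"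
  by (induction n) (auto simp: mat_app_cmult)

text \<open>
  From \<open>M\<close> to \<open>2 M\<close> by \<open>T\<^sup>2\<^sup>M - s\<^sup>2 = (T\<^sup>M - s) (T\<^sup>M + s)\<close> and \<open>2 T\<^sup>M = (T\<^sup>M - s) + (T\<^sup>M + s)\<close>; the
  constant does not deteriorate.
\<close>
lemma power_resolvent_sup_bound:
  assumes base: "\<And>z u K. norm z = r \<Longrightarrow> u \<in> ell1 \<Gamma> \<Longrightarrow>
      (\<And>\<gamma>. \<gamma> \<in> \<Gamma> \<Longrightarrow> norm (T u \<gamma> - z * u \<gamma>) \<le> K) \<Longrightarrow> \<forall>\<gamma>\<in>\<Gamma>. norm (u \<gamma>) \<le> C * K"
    and r: "0 \<le> r"
    and "norm z = r ^ 2 ^ j" "u \<in> ell1 \<Gamma>" "\<And>\<gamma>. \<gamma> \<in> \<Gamma> \<Longrightarrow> norm ((T ^^ 2 ^ j) u \<gamma> - z * u \<gamma>) \<le> K" "\<gamma> \<in> \<Gamma>"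
  shows "norm ((T ^^ (2 ^ j - 1)) u \<gamma>) \<le> C * K"
  using assms(3-6)
proof (induction j arbitrary: z u K \<gamma>)
  case 0
  then show ?case using base[of z u K] by simp
next
  case (Suc j)
  define M where "M = (2::nat) ^ j"
  have M: "2 ^ Suc j = M + M" "0 < M" by (auto simp: M_def)
  \<comment> \<open>The claim is made for every \<open>z\<close> on the circle of radius
    \<open>r ^ 2 ^ Suc j\<close>, since both square roots \<open>s\<close> and \<open>- s\<close> on
    the previous circle are used.\<close>
  define s where "s = csqrt z"
  have s: "s * s = z" using power2_csqrt[of z] by (simp add: s_def power2_eq_square)
  have "norm z = r ^ M * r ^ M" using Suc.prems(1) unfolding M(1) power_add .
  then have "(norm s)\<^sup>2 = (r ^ M)\<^sup>2" unfolding power2_eq_square s[symmetric] norm_mult .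
  then have ns: "norm s = r ^ M" using r by (simp add: power2_eq_iff_nonneg)
  have half: "norm ((T ^^ (M - 1)) (\<lambda>\<gamma>. (T ^^ M) u \<gamma> + t * u \<gamma>) \<gamma>) \<le> C * K" if t: "t = s \<or> t = - s" for t
    unfolding M_def
  proof (rule Suc.IH)
    show "norm t = r ^ 2 ^ j" using t ns by (auto simp: M_def)
    show "(\<lambda>\<gamma>. (T ^^ 2 ^ j) u \<gamma> + t * u \<gamma>) \<in> ell1 \<Gamma>"
      by (intro ell1_add ell1_cmult Tpow_ell1 Suc.prems)
    show "\<gamma> \<in> \<Gamma>" by fact
    fix \<gamma> assume \<gamma>: "\<gamma> \<in> \<Gamma>"
    have tt: "t * t = z" using t s by auto
    have "(T ^^ M) (\<lambda>\<gamma>. (T ^^ M) u \<gamma> + t * u \<gamma>) = (\<lambda>\<gamma>. (T ^^ M) ((T ^^ M) u) \<gamma> + (T ^^ M) (\<lambda>\<gamma>. t * u \<gamma>) \<gamma>)"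
      by (intro Tpow_add ell1_cmult Tpow_ell1 Suc.prems)
    also have "\<dots> = (\<lambda>\<gamma>. (T ^^ (M + M)) u \<gamma> + t * (T ^^ M) u \<gamma>)" unfolding Tpow_cmult funpow_add by simp
    finally have "(T ^^ M) (\<lambda>\<gamma>. (T ^^ M) u \<gamma> + t * u \<gamma>) \<gamma> - t * ((T ^^ M) u \<gamma> + t * u \<gamma>)
        = (T ^^ (M + M)) u \<gamma> - z * u \<gamma>" by (simp add: algebra_simps flip: tt)
    then show "norm ((T ^^ 2 ^ j) (\<lambda>\<gamma>. (T ^^ 2 ^ j) u \<gamma> + t * u \<gamma>) \<gamma> - t * ((T ^^ 2 ^ j) u \<gamma> + t * u \<gamma>)) \<le> K"
      using Suc.prems(3)[OF \<gamma>] unfolding M by (simp add: M_def)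
  qed
  have sum: "(T ^^ (M - 1)) (\<lambda>\<gamma>. (T ^^ M) u \<gamma> + t * u \<gamma>) \<gamma> = (T ^^ (M + M - 1)) u \<gamma> + t * (T ^^ (M - 1)) u \<gamma>" for t
  proof -
    have "(T ^^ (M - 1)) (\<lambda>\<gamma>. (T ^^ M) u \<gamma> + t * u \<gamma>) = (\<lambda>\<gamma>. (T ^^ (M - 1)) ((T ^^ M) u) \<gamma> + (T ^^ (M - 1)) (\<lambda>\<gamma>. t * u \<gamma>) \<gamma>)"
      by (intro Tpow_add ell1_cmult Tpow_ell1 Suc.prems)
    also have "(T ^^ (M - 1)) ((T ^^ M) u) = (T ^^ ((M - 1) + M)) u" by (simp only: funpow_add o_apply)
    also have "(M - 1) + M = M + M - 1" using M(2) by simp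
    finally show ?thesis unfolding Tpow_cmult by simp
  qed
  \<comment> \<open>For \<open>t = s\<close> and \<open>t = - s\<close> the terms with
    \<open>t\<close> cancel. Each summand costs \<open>C * K\<close> and the left-hand side carries
    the factor two, so the constant survives the doubling.\<close>
  have "norm (2 * (T ^^ (M + M - 1)) u \<gamma>) \<le> C * K + C * K"
    using norm_triangle_mono[OF half[of s] half[of "- s"]] unfolding sum by simp
  then show ?case unfolding M by (simp add: norm_mult)
qed

text \<open>On the range of \<open>T\<close> the form lies above \<open>A\<close> and the norm of
  \<open>T\<close> below \<open>B'\<close>, so the step \<open>x - \<kappa> T x\<close> multiplies
  the squared norm by at most \<open>1 - 2 \<kappa> A + \<kappa>\<^sup>2 B'\<^sup>2\<close>, which
  is minimal at \<open>\<kappa> = A / B'\<^sup>2\<close>. Then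
  \<open>\<kappa> A = 1 - \<rho>\<^sup>2\<close>, and the geometric series of the corrections is at
  most \<open>(1 + \<rho>) / A \<le> 2 / A\<close>. Adding \<open>A\<close> to \<open>B\<close>
  ensures \<open>A \<le> B'\<close>.\<close>

lemma richardson_contraction:
  obtains \<kappa> \<rho> where "0 \<le> \<kappa>" "0 \<le> \<rho>" "\<rho> < 1" "\<kappa> / (1 - \<rho>) \<le> 2 / A"
    "\<And>u. u \<in> ell1 \<Gamma> \<Longrightarrow> ell2_norm \<Gamma> (\<lambda>\<gamma>. T u \<gamma> - complex_of_real \<kappa> * T (T u) \<gamma>) \<le> \<rho> * ell2_norm \<Gamma> (T u)"
proof -
  define B' where "B' = B + A"
  have B': "A \<le> B'" "0 < B'" "B \<le> B'" using A_pos B_nonneg by (auto simp: B'_def)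
  define \<kappa> where "\<kappa> = A / B'\<^sup>2"
  define \<rho> where "\<rho> = sqrt (1 - A\<^sup>2 / B'\<^sup>2)"
  have AB: "A\<^sup>2 / B'\<^sup>2 \<le> 1" using B' A_pos by (simp add: power_mono)
  have \<rho>2: "\<rho>\<^sup>2 = 1 - A\<^sup>2 / B'\<^sup>2" using AB by (simp add: \<rho>_def)
  have \<rho>: "0 \<le> \<rho>" using AB by (simp add: \<rho>_def)
  have \<rho>1: "\<rho> < 1" using A_pos B' by (simp add: \<rho>_def)
  have \<kappa>0: "0 < \<kappa>" using A_pos B' by (simp add: \<kappa>_def)
  have "\<kappa> * A = 1 - \<rho>\<^sup>2" unfolding \<rho>2 by (simp add: \<kappa>_def power2_eq_square)
  also have "\<dots> = (1 - \<rho>) * (1 + \<rho>)" by (simp add: algebra_simps power2_eq_square)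
  also have "\<dots> \<le> (1 - \<rho>) * 2" using \<rho> \<rho>1 by (intro mult_left_mono) auto
  finally have bd: "\<kappa> / (1 - \<rho>) \<le> 2 / A" using \<rho>1 A_pos by (simp add: divide_simps mult.commute)
  have "ell2_norm \<Gamma> (\<lambda>\<gamma>. T u \<gamma> - complex_of_real \<kappa> * T (T u) \<gamma>) \<le> \<rho> * ell2_norm \<Gamma> (T u)" if u: "u \<in> ell1 \<Gamma>" for u
  proof -
    have Tu: "T u \<in> ell1 \<Gamma>" by (rule mat_app_ell1[OF u])
    have "ell2_norm \<Gamma> (T (T u)) \<le> B' * ell2_norm \<Gamma> (T u)"
      by (rule order_trans[OF mat_app_ell2_norm[OF Tu] mult_right_mono[OF B'(3) ell2_norm_nonneg]])
    then have "(ell2_norm \<Gamma> (T (T u)))\<^sup>2 \<le> (B' * ell2_norm \<Gamma> (T u))\<^sup>2" by (rule power_mono[OF _ ell2_norm_nonneg])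
    then have "\<kappa>\<^sup>2 * (ell2_norm \<Gamma> (T (T u)))\<^sup>2 \<le> \<kappa>\<^sup>2 * (B' * ell2_norm \<Gamma> (T u))\<^sup>2" by (rule mult_left_mono) simp
    also have "\<dots> = A\<^sup>2 / B'\<^sup>2 * (ell2_norm \<Gamma> (T u))\<^sup>2" using B' by (simp add: \<kappa>_def power_mult_distrib power_divide power2_eq_square)
    finally have 1: "\<kappa>\<^sup>2 * (ell2_norm \<Gamma> (T (T u)))\<^sup>2 \<le> A\<^sup>2 / B'\<^sup>2 * (ell2_norm \<Gamma> (T u))\<^sup>2" .
    have "A\<^sup>2 / B'\<^sup>2 * (ell2_norm \<Gamma> (T u))\<^sup>2 = \<kappa> * (A * (ell2_norm \<Gamma> (T u))\<^sup>2)" by (simp add: \<kappa>_def power2_eq_square)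
    also have "\<dots> \<le> \<kappa> * Re (ell2_inner \<Gamma> (T u) (T (T u)))"
      using gap_range[OF u] \<kappa>0 by (intro mult_left_mono) (auto simp: ell2_inner_commute[of \<Gamma> "T u" "T (T u)"])
    finally have 2: "A\<^sup>2 / B'\<^sup>2 * (ell2_norm \<Gamma> (T u))\<^sup>2 \<le> \<kappa> * Re (ell2_inner \<Gamma> (T u) (T (T u)))" .
    have "(ell2_norm \<Gamma> (\<lambda>\<gamma>. T u \<gamma> - complex_of_real \<kappa> * T (T u) \<gamma>))\<^sup>2
       = (ell2_norm \<Gamma> (T u))\<^sup>2 - 2 * (\<kappa> * Re (ell2_inner \<Gamma> (T u) (T (T u)))) + \<kappa>\<^sup>2 * (ell2_norm \<Gamma> (T (T u)))\<^sup>2"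
      using ell2_norm_diff_sq[OF Tu mat_app_ell1[OF Tu], of "complex_of_real \<kappa>"] by simp
    also have "\<dots> \<le> (ell2_norm \<Gamma> (T u))\<^sup>2 - A\<^sup>2 / B'\<^sup>2 * (ell2_norm \<Gamma> (T u))\<^sup>2" using 1 2 by linarith
    also have "\<dots> = (\<rho> * ell2_norm \<Gamma> (T u))\<^sup>2" by (simp add: power_mult_distrib \<rho>2 algebra_simps)
    finally show ?thesis by (rule power2_le_imp_le) (intro mult_nonneg_nonneg \<rho> ell2_norm_nonneg)
  qed
  then show ?thesis using \<kappa>0 \<rho> \<rho>1 bd by (intro that[of \<kappa> \<rho>]) auto
qed

text \<open>The iteration \<open>v + \<kappa> (u - T v)\<close>, started at zero, contracts the
  residual \<open>T u - T (T v)\<close>. An exact solution would be a limit of square-summable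
  vectors and might leave \<open>ell1\<close>; stopping early keeps \<open>v\<close> there. The
  solution \<open>T v\<close> again lies in the range of \<open>T\<close>, so the step can be
  repeated.\<close>

lemma approx_inverse:
  assumes u: "u \<in> ell1 \<Gamma>" and \<epsilon>: "0 < \<epsilon>"
  shows "\<exists>v\<in>ell1 \<Gamma>. ell2_norm \<Gamma> (\<lambda>\<gamma>. T (T v) \<gamma> - T u \<gamma>) \<le> \<epsilon> \<and> ell2_norm \<Gamma> (T v) \<le> 2 / A * ell2_norm \<Gamma> (T u)"
proof -
  obtain \<kappa> \<rho> where \<kappa>: "0 \<le> \<kappa>" and \<rho>: "0 \<le> \<rho>" "\<rho> < 1" and bd: "\<kappa> / (1 - \<rho>) \<le> 2 / A"
    and contr: "\<And>u. u \<in> ell1 \<Gamma> \<Longrightarrow> ell2_norm \<Gamma> (\<lambda>\<gamma>. T u \<gamma> - complex_of_real \<kappa> * T (T u) \<gamma>) \<le> \<rho> * ell2_norm \<Gamma> (T u)"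
    by (rule richardson_contraction) (rule that)
  let ?n = "ell2_norm \<Gamma> (T u)"
  have "\<exists>v\<in>ell1 \<Gamma>. ell2_norm \<Gamma> (\<lambda>\<gamma>. T u \<gamma> - T (T v) \<gamma>) \<le> \<rho> ^ J * ?n \<and> ell2_norm \<Gamma> (T v) \<le> \<kappa> * (\<Sum>j<J. \<rho> ^ j) * ?n" for J
  proof (induction J)
    case 0
    have "(\<lambda>\<gamma>. 0) \<in> ell1 \<Gamma>" "T (\<lambda>\<gamma>. 0) = (\<lambda>\<gamma>. 0)" by (auto simp: ell1_def mat_app_def)
    then show ?case by (intro bexI[of _ "\<lambda>\<gamma>. 0"]) (auto simp: ell2_norm_def)
  next
    case (Suc J)
    then obtain v where v: "v \<in> ell1 \<Gamma>" "ell2_norm \<Gamma> (\<lambda>\<gamma>. T u \<gamma> - T (T v) \<gamma>) \<le> \<rho> ^ J * ?n" "ell2_norm \<Gamma> (T v) \<le> \<kappa> * (\<Sum>j<J. \<rho> ^ j) * ?n"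
      by blast
    define x where "x = (\<lambda>\<gamma>. u \<gamma> - T v \<gamma>)"
    have Tv: "T v \<in> ell1 \<Gamma>" by (rule mat_app_ell1[OF v(1)])
    have x: "x \<in> ell1 \<Gamma>" unfolding x_def by (rule ell1_diff[OF u Tv])
    have Tx: "T x = (\<lambda>\<gamma>. T u \<gamma> - T (T v) \<gamma>)" unfolding x_def by (rule mat_app_diff[OF u Tv])
    define v' where "v' = (\<lambda>\<gamma>. v \<gamma> + complex_of_real \<kappa> * x \<gamma>)"
    have \<kappa>x: "(\<lambda>\<gamma>. complex_of_real \<kappa> * x \<gamma>) \<in> ell1 \<Gamma>" by (rule ell1_cmult[OF x])
    have v': "v' \<in> ell1 \<Gamma>" unfolding v'_def by (rule ell1_add[OF v(1) \<kappa>x])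
    have Tv': "T v' = (\<lambda>\<gamma>. T v \<gamma> + complex_of_real \<kappa> * T x \<gamma>)"
      unfolding v'_def mat_app_add[OF v(1) \<kappa>x] mat_app_cmult ..
    have \<kappa>Tx: "(\<lambda>\<gamma>. complex_of_real \<kappa> * T x \<gamma>) \<in> ell1 \<Gamma>" by (rule ell1_cmult[OF mat_app_ell1[OF x]])
    have TTv': "T (T v') = (\<lambda>\<gamma>. T (T v) \<gamma> + complex_of_real \<kappa> * T (T x) \<gamma>)"
      unfolding Tv' mat_app_add[OF Tv \<kappa>Tx] mat_app_cmult ..
    have "ell2_norm \<Gamma> (\<lambda>\<gamma>. T u \<gamma> - T (T v') \<gamma>) = ell2_norm \<Gamma> (\<lambda>\<gamma>. T x \<gamma> - complex_of_real \<kappa> * T (T x) \<gamma>)"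
      unfolding TTv' by (simp add: Tx[THEN fun_cong] algebra_simps)
    also have "\<dots> \<le> \<rho> * ell2_norm \<Gamma> (T x)" by (rule contr[OF x])
    also have "\<dots> \<le> \<rho> * (\<rho> ^ J * ?n)" using v(2) \<rho> by (intro mult_left_mono) (simp_all add: Tx)
    finally have 1: "ell2_norm \<Gamma> (\<lambda>\<gamma>. T u \<gamma> - T (T v') \<gamma>) \<le> \<rho> ^ Suc J * ?n" by simp
    have "ell2_norm \<Gamma> (T v') \<le> ell2_norm \<Gamma> (T v) + \<kappa> * ell2_norm \<Gamma> (T x)"
      unfolding Tv' using ell2_norm_triangle[OF Tv \<kappa>Tx] ell2_norm_cmult[of \<Gamma> "complex_of_real \<kappa>" "T x"] \<kappa> by simp
    also have "\<dots> \<le> \<kappa> * (\<Sum>j<J. \<rho> ^ j) * ?n + \<kappa> * (\<rho> ^ J * ?n)"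
      using v(2,3) \<kappa> by (intro add_mono mult_left_mono) (simp_all add: Tx)
    also have "\<dots> = \<kappa> * (\<Sum>j<Suc J. \<rho> ^ j) * ?n" by (simp add: algebra_simps)
    finally show ?case using v' 1 by blast
  qed
  then obtain v where v: "\<And>J. v J \<in> ell1 \<Gamma>" "\<And>J. ell2_norm \<Gamma> (\<lambda>\<gamma>. T u \<gamma> - T (T (v J)) \<gamma>) \<le> \<rho> ^ J * ?n"
    "\<And>J. ell2_norm \<Gamma> (T (v J)) \<le> \<kappa> * (\<Sum>j<J. \<rho> ^ j) * ?n" unfolding Bex_def by metis
  have "(\<lambda>J. \<rho> ^ J * ?n) \<longlonglongrightarrow> 0 * ?n" using \<rho> by (intro tendsto_mult_right LIMSEQ_power_zero) auto
  then have "\<forall>\<^sub>F J in sequentially. \<rho> ^ J * ?n < \<epsilon>" using \<epsilon> by (intro order_tendstoD) auto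
  then obtain J where J: "\<rho> ^ J * ?n < \<epsilon>" by (auto simp: eventually_sequentially)
  have "ell2_norm \<Gamma> (\<lambda>\<gamma>. T (T (v J)) \<gamma> - T u \<gamma>) = ell2_norm \<Gamma> (\<lambda>\<gamma>. T u \<gamma> - T (T (v J)) \<gamma>)"
    by (simp add: ell2_norm_def norm_minus_commute)
  then have 1: "ell2_norm \<Gamma> (\<lambda>\<gamma>. T (T (v J)) \<gamma> - T u \<gamma>) \<le> \<epsilon>" using v(2)[of J] J by simp
  have "\<kappa> * (\<Sum>j<J. \<rho> ^ j) = \<kappa> / (1 - \<rho>) * (1 - \<rho> ^ J)"
    using \<rho> by (simp add: sum_gp_strict)
  also have "\<dots> \<le> \<kappa> / (1 - \<rho>) * 1" using \<kappa> \<rho> by (intro mult_left_mono) auto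
  finally have "\<kappa> * (\<Sum>j<J. \<rho> ^ j) * ?n \<le> 2 / A * ?n" using bd by (intro mult_right_mono ell2_norm_nonneg) simp
  then have "ell2_norm \<Gamma> (T (v J)) \<le> 2 / A * ?n" using v(3)[of J] by linarith
  with 1 v(1) show ?thesis by blast
qed

lemma approx_power_inverse:
  assumes "u \<in> ell1 \<Gamma>" "0 < \<epsilon>"
  shows "\<exists>v\<in>ell1 \<Gamma>. ell2_norm \<Gamma> (\<lambda>\<gamma>. (T ^^ M) (T v) \<gamma> - T u \<gamma>) \<le> \<epsilon> \<and> ell2_norm \<Gamma> (T v) \<le> (2 / A) ^ M * ell2_norm \<Gamma> (T u)"
  using assms
proof (induction M arbitrary: u \<epsilon>)
  case 0
  then show ?case by (intro bexI[of _ u]) (auto simp: ell2_norm_def)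
next
  case (Suc M)
  obtain v1 where v1: "v1 \<in> ell1 \<Gamma>" "ell2_norm \<Gamma> (\<lambda>\<gamma>. T (T v1) \<gamma> - T u \<gamma>) \<le> \<epsilon> / 2" "ell2_norm \<Gamma> (T v1) \<le> 2 / A * ell2_norm \<Gamma> (T u)"
    using approx_inverse[OF Suc.prems(1), of "\<epsilon> / 2"] Suc.prems(2) by auto
  \<comment> \<open>The error of the inner approximation passes once more through \<open>T\<close>,
    whose norm is at most \<open>B\<close>.\<close>
  have "0 < \<epsilon> / (2 * (B + 1))" using Suc.prems(2) B_nonneg by simp
  from Suc.IH[OF v1(1) this] obtain v where v: "v \<in> ell1 \<Gamma>"
    "ell2_norm \<Gamma> (\<lambda>\<gamma>. (T ^^ M) (T v) \<gamma> - T v1 \<gamma>) \<le> \<epsilon> / (2 * (B + 1))" "ell2_norm \<Gamma> (T v) \<le> (2 / A) ^ M * ell2_norm \<Gamma> (T v1)" by blast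
  have l: "(T ^^ M) (T v) \<in> ell1 \<Gamma>" "T v1 \<in> ell1 \<Gamma>" "T u \<in> ell1 \<Gamma>" by (intro Tpow_ell1 mat_app_ell1 v v1 Suc.prems)+
  have "ell2_norm \<Gamma> (\<lambda>\<gamma>. (T ^^ Suc M) (T v) \<gamma> - T u \<gamma>) =
    ell2_norm \<Gamma> (\<lambda>\<gamma>. (T ((T ^^ M) (T v)) \<gamma> - T (T v1) \<gamma>) + (T (T v1) \<gamma> - T u \<gamma>))" by simp
  also have "\<dots> \<le> ell2_norm \<Gamma> (\<lambda>\<gamma>. T ((T ^^ M) (T v)) \<gamma> - T (T v1) \<gamma>) + ell2_norm \<Gamma> (\<lambda>\<gamma>. T (T v1) \<gamma> - T u \<gamma>)"
    by (intro ell2_norm_triangle ell1_diff mat_app_ell1 l Suc.prems)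
  also have "ell2_norm \<Gamma> (\<lambda>\<gamma>. T ((T ^^ M) (T v)) \<gamma> - T (T v1) \<gamma>) \<le> B * (\<epsilon> / (2 * (B + 1)))"
    using mat_app_ell2_norm[OF ell1_diff[OF l(1,2)]] mult_left_mono[OF v(2) B_nonneg] unfolding mat_app_diff[OF l(1,2)] by linarith
  also have "\<dots> \<le> \<epsilon> / 2" using B_nonneg Suc.prems(2) by (simp add: field_simps)
  finally have 1: "ell2_norm \<Gamma> (\<lambda>\<gamma>. (T ^^ Suc M) (T v) \<gamma> - T u \<gamma>) \<le> \<epsilon>" using v1(2) by simp
  have "ell2_norm \<Gamma> (T v) \<le> (2 / A) ^ M * (2 / A * ell2_norm \<Gamma> (T u))"
    using v(3) mult_left_mono[OF v1(3), of "(2 / A) ^ M"] A_pos by simp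
  then have "ell2_norm \<Gamma> (T v) \<le> (2 / A) ^ Suc M * ell2_norm \<Gamma> (T u)" by (simp add: mult_ac)
  with 1 v(1) show ?case by blast
qed

text \<open>The doubling bound is applied to \<open>z\<close> with \<open>T\<^sup>M z\<close> close
  to \<open>T u\<close>: then \<open>T\<^sup>M\<^sup>-\<^sup>1 z\<close> is an approximate preimage
  of \<open>T u\<close> whose sup bound involves \<open>T u\<close> but not \<open>u\<close>. The
  entries of \<open>u\<close> may be arbitrarily large, which is the purpose. The error is measured
  in \<open>ell2_norm\<close> because the gap converts it into an \<open>L\<^sup>2\<close> error of
  synthesised functions.\<close>

theorem bounded_preimage:
  shows "\<exists>C\<ge>0. \<forall>u K \<epsilon>. u \<in> ell1 \<Gamma> \<longrightarrow> 0 \<le> K \<longrightarrow> (\<forall>\<gamma>\<in>\<Gamma>. norm (T u \<gamma>) \<le> K) \<longrightarrow> 0 < \<epsilon> \<longrightarrow>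
    (\<exists>c. finite {\<gamma>. c \<gamma> \<noteq> 0} \<and> {\<gamma>. c \<gamma> \<noteq> 0} \<subseteq> \<Gamma> \<and> (\<forall>\<gamma>. norm (c \<gamma>) \<le> C * (K + \<epsilon>)) \<and>
      ell2_norm \<Gamma> (\<lambda>\<gamma>. T c \<gamma> - T u \<gamma>) \<le> \<epsilon>)"
proof -
  obtain C where C: "0 \<le> C" and base: "\<And>z u K. norm z = A / 4 \<Longrightarrow> u \<in> ell1 \<Gamma> \<Longrightarrow>
    (\<And>\<gamma>. \<gamma> \<in> \<Gamma> \<Longrightarrow> norm (T u \<gamma> - z * u \<gamma>) \<le> K) \<Longrightarrow> \<forall>\<gamma>\<in>\<Gamma>. norm (u \<gamma>) \<le> C * K"
    using resolvent_sup_bound by blast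
  have "\<exists>c. finite {\<gamma>. c \<gamma> \<noteq> 0} \<and> {\<gamma>. c \<gamma> \<noteq> 0} \<subseteq> \<Gamma> \<and> (\<forall>\<gamma>. norm (c \<gamma>) \<le> C * (K + \<epsilon>)) \<and>
      ell2_norm \<Gamma> (\<lambda>\<gamma>. T c \<gamma> - T u \<gamma>) \<le> \<epsilon>"
    if u: "u \<in> ell1 \<Gamma>" and K: "0 \<le> K" "\<And>\<gamma>. \<gamma> \<in> \<Gamma> \<Longrightarrow> norm (T u \<gamma>) \<le> K" and \<epsilon>: "0 < \<epsilon>" for u K \<epsilon>
  proof -
    let ?n = "ell2_norm \<Gamma> (T u)"
    \<comment> \<open>Nothing bounds \<open>?n\<close> in terms of \<open>K\<close>. This is
      harmless: \<open>M\<close> may depend on it, because \<open>C\<close> is independent of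
      \<open>M\<close>.\<close>
    have "(\<lambda>j. (1 / 2) ^ 2 ^ j * ?n) \<longlonglongrightarrow> 0 * ?n"
    proof (rule tendsto_mult_right)
      show "(\<lambda>j. (1 / 2 :: real) ^ 2 ^ j) \<longlonglongrightarrow> 0"
        using LIMSEQ_subseq_LIMSEQ[OF LIMSEQ_power_zero[of "1 / 2 :: real"], of "\<lambda>j. 2 ^ j"]
        by (simp add: strict_mono_def o_def)
    qed
    then have "\<forall>\<^sub>F j in sequentially. (1 / 2) ^ 2 ^ j * ?n < \<epsilon> / 2" using \<epsilon> by (intro order_tendstoD) auto
    then obtain j where j: "(1 / 2) ^ 2 ^ j * ?n < \<epsilon> / 2" by (auto simp: eventually_sequentially)
    define M where "M = (2::nat) ^ j"
    have M: "M = Suc (M - 1)" by (simp add: M_def)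
    obtain v where v: "v \<in> ell1 \<Gamma>" "ell2_norm \<Gamma> (\<lambda>\<gamma>. (T ^^ M) (T v) \<gamma> - T u \<gamma>) \<le> \<epsilon> / 2" "ell2_norm \<Gamma> (T v) \<le> (2 / A) ^ M * ?n"
      using approx_power_inverse[OF u, of "\<epsilon> / 2" M] \<epsilon> by auto
    define z where "z = T v"
    have z: "z \<in> ell1 \<Gamma>" unfolding z_def by (rule mat_app_ell1[OF v(1)])
    have d: "(\<lambda>\<gamma>. (T ^^ M) z \<gamma> - T u \<gamma>) \<in> ell1 \<Gamma>" by (intro ell1_diff Tpow_ell1 mat_app_ell1 z u)
    define c0 where "c0 = (T ^^ (M - 1)) z"
    have c0: "c0 \<in> ell1 \<Gamma>" unfolding c0_def by (rule Tpow_ell1[OF z])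
    have Tc0: "T c0 = (T ^^ M) z" unfolding c0_def by (subst (2) M) simp
    have sup: "norm (c0 \<gamma>) \<le> C * (K + \<epsilon>)" if \<gamma>: "\<gamma> \<in> \<Gamma>" for \<gamma>
      unfolding c0_def M_def
    proof (rule power_resolvent_sup_bound[OF base])
      show "norm (complex_of_real ((A / 4) ^ 2 ^ j)) = (A / 4) ^ 2 ^ j" using A_pos by (simp only: norm_of_real) simp
      show "z \<in> ell1 \<Gamma>" "\<gamma> \<in> \<Gamma>" "0 \<le> A / 4" using z \<gamma> A_pos by auto
      fix \<gamma> assume \<gamma>: "\<gamma> \<in> \<Gamma>"
      \<comment> \<open>\<open>z\<close> grows at most like \<open>(2 / A) ^ M\<close>; the radius
        \<open>A / 4\<close>, half of the admissible \<open>A / 2\<close>, makes the product decay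
        like \<open>(1 / 2) ^ M\<close>.\<close>
      have "norm ((A / 4) ^ M * z \<gamma>) \<le> (A / 4) ^ M * ((2 / A) ^ M * ?n)"
        using norm_le_ell2_norm[OF z \<gamma>] v(3) A_pos by (simp add: norm_mult norm_power z_def del: times_divide_eq_left)
      also have "\<dots> = (A / 4 * (2 / A)) ^ M * ?n" by (simp only: power_mult_distrib mult.assoc)
      also have "A / 4 * (2 / A) = 1 / 2" using A_pos by simp
      finally have "norm (complex_of_real ((A / 4) ^ M) * z \<gamma>) \<le> \<epsilon> / 2" using j by (simp add: M_def)
      moreover have "norm ((T ^^ M) z \<gamma> - T u \<gamma>) \<le> \<epsilon> / 2"
        using norm_le_ell2_norm[OF d \<gamma>] v(2) by (simp add: z_def)
      moreover have "norm ((T ^^ M) z \<gamma> - complex_of_real ((A / 4) ^ M) * z \<gamma>)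
        \<le> norm ((T ^^ M) z \<gamma> - T u \<gamma>) + norm (T u \<gamma>) + norm (complex_of_real ((A / 4) ^ M) * z \<gamma>)"
        by (rule order_trans[OF norm_triangle_ineq4]) (simp add: norm_triangle_sub add.commute)
      ultimately show "norm ((T ^^ 2 ^ j) z \<gamma> - complex_of_real ((A / 4) ^ 2 ^ j) * z \<gamma>) \<le> K + \<epsilon>"
        using K(2)[OF \<gamma>] by (simp add: M_def)
    qed
    \<comment> \<open>Truncation to a finite set does not increase the sup norm and costs, after
      application of \<open>T\<close>, at most \<open>\<epsilon> / 2\<close>.\<close>
    have "0 < \<epsilon> / (2 * (B + 1))" using \<epsilon> B_nonneg by simp
    then obtain S where S: "finite S" "S \<subseteq> \<Gamma>" "ell2_norm \<Gamma> (\<lambda>\<gamma>. c0 \<gamma> - restr S c0 \<gamma>) < \<epsilon> / (2 * (B + 1))"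
      by (rule restr_approx[OF c0])
    define c where "c = restr S c0"
    have c: "c \<in> ell1 \<Gamma>" unfolding c_def by (rule restr_ell1[OF c0])
    have supp: "{\<gamma>. c \<gamma> \<noteq> 0} \<subseteq> S" by (auto simp: c_def restr_def)
    have "ell2_norm \<Gamma> (\<lambda>\<gamma>. T c0 \<gamma> - T c \<gamma>) \<le> B * (\<epsilon> / (2 * (B + 1)))"
      using mat_app_ell2_norm[OF ell1_diff[OF c0 c]] mult_left_mono[OF less_imp_le[OF S(3)[folded c_def]] B_nonneg]
      unfolding mat_app_diff[OF c0 c] by linarith
    also have "\<dots> \<le> \<epsilon> / 2" using B_nonneg \<epsilon> by (simp add: field_simps)
    finally have "ell2_norm \<Gamma> (\<lambda>\<gamma>. T c0 \<gamma> - T c \<gamma>) \<le> \<epsilon> / 2" .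
    then have "ell2_norm \<Gamma> (\<lambda>\<gamma>. (T c0 \<gamma> - T u \<gamma>) - (T c0 \<gamma> - T c \<gamma>)) \<le> \<epsilon>"
      using ell2_norm_triangle_diff[of "\<lambda>\<gamma>. T c0 \<gamma> - T u \<gamma>" \<Gamma> "\<lambda>\<gamma>. T c0 \<gamma> - T c \<gamma>", OF ell1_diff[OF mat_app_ell1[OF c0] mat_app_ell1[OF u]] ell1_diff[OF mat_app_ell1[OF c0] mat_app_ell1[OF c]]]
        v(2) by (simp add: Tc0 z_def)
    then have "ell2_norm \<Gamma> (\<lambda>\<gamma>. T c \<gamma> - T u \<gamma>) \<le> \<epsilon>" by simp
    moreover have "norm (c \<gamma>) \<le> C * (K + \<epsilon>)" for \<gamma>
      using sup[of \<gamma>] S(2) C K(1) \<epsilon> by (auto simp: c_def restr_def)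
    ultimately show ?thesis using supp S(1,2) by (intro exI[of _ c]) (meson finite_subset subset_trans)
  qed
  with C show ?thesis by blast
qed

end

subsection \<open>Fekete points\<close>

definition lin :: "'i set \<Rightarrow> ('i \<Rightarrow> 'x \<Rightarrow> complex) \<Rightarrow> ('x \<Rightarrow> complex) \<Rightarrow> bool" where
  "lin S F f \<longleftrightarrow> (\<exists>c. \<forall>x. f x = (\<Sum>i\<in>S. c i * F i x))"

text \<open>The functions \<open>F i\<close> may be linearly dependent; \<open>m\<close> is the
  dimension of their span. Nodes are functions on all naturals of which the values below
  \<open>m\<close> count, so that an exchange of a node is a function update.\<close>

definition lagrange_system ::
    "'i set \<Rightarrow> ('i \<Rightarrow> 'x \<Rightarrow> complex) \<Rightarrow> nat \<Rightarrow> (nat \<Rightarrow> 'x) \<Rightarrow> (nat \<Rightarrow> 'x \<Rightarrow> complex) \<Rightarrow> bool" where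
  "lagrange_system S F m y l \<longleftrightarrow>
     (\<forall>i<m. lin S F (l i)) \<and> (\<forall>i<m. \<forall>k<m. l i (y k) = (if i = k then 1 else 0)) \<and>
     (\<forall>f. lin S F f \<longrightarrow> (\<forall>x. f x = (\<Sum>i<m. f (y i) * l i x)))"

lemma lin_add:
  assumes "lin S F f" "lin S F g"
  shows "lin S F (\<lambda>x. f x + g x)"
proof -
  obtain c d where "\<forall>x. f x = (\<Sum>i\<in>S. c i * F i x)" "\<forall>x. g x = (\<Sum>i\<in>S. d i * F i x)"
    using assms unfolding lin_def by blast
  then show ?thesis unfolding lin_def
    by (intro exI[of _ "\<lambda>i. c i + d i"]) (simp add: sum.distrib distrib_right)
qed

lemma lin_cmult:
  assumes "lin S F f"
  shows "lin S F (\<lambda>x. a * f x)"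
proof -
  obtain c where "\<forall>x. f x = (\<Sum>i\<in>S. c i * F i x)" using assms unfolding lin_def by blast
  then show ?thesis unfolding lin_def
    by (intro exI[of _ "\<lambda>i. a * c i"]) (simp add: sum_distrib_left mult.assoc)
qed

lemma lin_diff:
  assumes "lin S F f" "lin S F g"
  shows "lin S F (\<lambda>x. f x - g x)"
  using lin_add[OF assms(1) lin_cmult[OF assms(2), of "-1"]] by simp

lemma lin_sum:
  assumes "finite I" "\<And>i. i \<in> I \<Longrightarrow> lin S F (f i)"
  shows "lin S F (\<lambda>x. \<Sum>i\<in>I. f i x)"
  using assms
proof (induction I rule: finite_induct)
  case empty
  show ?case unfolding lin_def by (rule exI[of _ "\<lambda>_. 0"]) simp
next
  case (insert i I)
  then show ?case using lin_add[of S F "f i" "\<lambda>x. \<Sum>i\<in>I. f i x"] by simp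
qed

lemma lin_insert:
  assumes "finite S" "s \<notin> S"
  shows "lin (insert s S) F f \<longleftrightarrow> (\<exists>f0 a. lin S F f0 \<and> (\<forall>x. f x = f0 x + a * F s x))"
proof
  assume "lin (insert s S) F f"
  then obtain c where c: "\<forall>x. f x = (\<Sum>i\<in>insert s S. c i * F i x)" unfolding lin_def by blast
  have "lin S F (\<lambda>x. \<Sum>i\<in>S. c i * F i x)" unfolding lin_def by blast
  then show "\<exists>f0 a. lin S F f0 \<and> (\<forall>x. f x = f0 x + a * F s x)"
    using c assms by (intro exI[of _ "\<lambda>x. \<Sum>i\<in>S. c i * F i x"] exI[of _ "c s"]) (simp add: add.commute)
next
  assume "\<exists>f0 a. lin S F f0 \<and> (\<forall>x. f x = f0 x + a * F s x)"
  then obtain f0 a c where c: "\<forall>x. f0 x = (\<Sum>i\<in>S. c i * F i x)" "\<forall>x. f x = f0 x + a * F s x"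
    unfolding lin_def by blast
  have "(\<Sum>i\<in>S. c i * F i x) = (\<Sum>i\<in>S. (c(s := a)) i * F i x)" for x
    using assms(2) by (intro sum.cong) auto
  then show "lin (insert s S) F f" unfolding lin_def
    using c assms by (intro exI[of _ "c(s := a)"]) (simp add: add.commute)
qed

text \<open>Newton interpolation: for a new function, \<open>h\<close> is the error of its
  interpolation at the old nodes. If \<open>h\<close> vanishes identically the span has not grown;
  otherwise any point with \<open>h x \<noteq> 0\<close> serves as a new node, \<open>h\<close>
  divided by \<open>h x\<close> is its Lagrange function, and the old ones are corrected by
  multiples of it.\<close>

lemma lagrange_system_exists:
  assumes "finite S"
  shows "\<exists>m y l. lagrange_system S F m y l"
  using assms
proof (induction S rule: finite_induct)
  case empty
  show ?case by (rule exI[of _ 0]) (simp add: lagrange_system_def lin_def)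
next
  case (insert s S)
  then obtain m y l where "lagrange_system S F m y l" by blast
  then have l: "\<And>i. i < m \<Longrightarrow> lin S F (l i)"
      "\<And>i k. i < m \<Longrightarrow> k < m \<Longrightarrow> l i (y k) = (if i = k then 1 else 0)"
      "\<And>f x. lin S F f \<Longrightarrow> f x = (\<Sum>i<m. f (y i) * l i x)" unfolding lagrange_system_def by blast+
  define h where "h x = F s x - (\<Sum>i<m. F s (y i) * l i x)" for x
  have mono: "lin (insert s S) F f" if "lin S F f" for f
    unfolding lin_insert[OF insert.hyps] by (rule exI[of _ f], rule exI[of _ 0]) (simp add: that)
  have expand: "\<exists>a. \<forall>x. f x = (\<Sum>i<m. f (y i) * l i x) + a * h x" if f: "lin (insert s S) F f" for f
  proof -
    obtain f0 a where f0: "lin S F f0" "\<forall>x. f x = f0 x + a * F s x"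
      using f unfolding lin_insert[OF insert.hyps] by blast
    have "f x = (\<Sum>i<m. f (y i) * l i x) + a * h x" for x
    proof -
      have "f x = (\<Sum>i<m. f0 (y i) * l i x) + a * F s x" using f0(2) l(3)[OF f0(1), of x] by simp
      also have "\<dots> = (\<Sum>i<m. f (y i) * l i x) + a * h x"
        using f0(2) by (simp add: h_def distrib_right sum.distrib sum_distrib_left right_diff_distrib mult.assoc)
      finally show ?thesis .
    qed
    then show ?thesis by blast
  qed
  have hy: "h (y k) = 0" if "k < m" for k
  proof -
    have "(\<Sum>i<m. F s (y i) * l i (y k)) = (\<Sum>i<m. if i = k then F s (y i) else 0)"
      using l(2) that by (intro sum.cong) auto
    then show ?thesis using that by (simp add: h_def)
  qed
  show ?case
  proof (cases "\<exists>x. h x \<noteq> 0")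
    case False
    then have "lagrange_system (insert s S) F m y l"
      unfolding lagrange_system_def using l mono expand by auto
    then show ?thesis by blast
  next
    case True
    then obtain x where x: "h x \<noteq> 0" by blast
    define g where "g z = h z / h x" for z
    define l' where "l' i z = (if i < m then l i z - l i x * g z else g z)" for i z
    define y' where "y' = y(m := x)"
    have Fs: "lin (insert s S) F (F s)"
      unfolding lin_insert[OF insert.hyps]
      by (rule exI[of _ "\<lambda>_. 0"], rule exI[of _ 1]) (auto simp: lin_def intro: exI[of _ "\<lambda>_. 0"])
    have "lin (insert s S) F h" unfolding h_def
      by (intro lin_diff lin_sum Fs lin_cmult mono l(1)) auto
    then have lg: "lin (insert s S) F g" unfolding g_def divide_inverse mult.commute[of _ "inverse _"] by (rule lin_cmult)
    have lin': "lin (insert s S) F (l' i)" for i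
      unfolding l'_def using lin_diff[OF mono[OF l(1)] lin_cmult[OF lg]] lg by (cases "i < m") auto
    have biorth: "l' i (y' k) = (if i = k then 1 else 0)" if "i < Suc m" "k < Suc m" for i k
      using that l(2)[of i k] hy[of k] x by (auto simp: l'_def y'_def g_def less_Suc_eq)
    have "f z = (\<Sum>i<Suc m. f (y' i) * l' i z)" if f: "lin (insert s S) F f" for f z
    proof -
      obtain a where a: "\<And>x. f x = (\<Sum>i<m. f (y i) * l i x) + a * h x" using expand[OF f] by blast
      have "(\<Sum>i<Suc m. f (y' i) * l' i z) = (\<Sum>i<m. f (y i) * (l i z - l i x * g z)) + f x * g z"
        by (simp add: y'_def l'_def)
      also have "\<dots> = (\<Sum>i<m. f (y i) * l i z) + (f x - (\<Sum>i<m. f (y i) * l i x)) * g z"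
        by (simp add: right_diff_distrib left_diff_distrib sum_subtractf sum_distrib_right mult.assoc)
      also have "f x - (\<Sum>i<m. f (y i) * l i x) = a * h x" using a[of x] by simp
      also have "a * h x * g z = a * h z" using x by (simp add: g_def)
      finally show ?thesis using a[of z] by simp
    qed
    with lin' biorth have "lagrange_system (insert s S) F (Suc m) y' l'"
      unfolding lagrange_system_def by blast
    then show ?thesis by blast
  qed
qed

text \<open>Leibniz formula for the determinant of the evaluation matrix \<open>g j (y i)\<close>.
  The size is a number and not a type because the dimension varies with the finite family.\<close>

definition vandermonde :: "nat \<Rightarrow> (nat \<Rightarrow> 'x \<Rightarrow> complex) \<Rightarrow> (nat \<Rightarrow> 'x) \<Rightarrow> complex" where
  "vandermonde m g y = (\<Sum>p | p permutes {..<m}. of_int (sign p) * (\<Prod>i<m. g (p i) (y i)))"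

text \<open>Composition with the transposition of the two equal nodes flips the sign of every term,
  so the sum is its own negative.\<close>

lemma vandermonde_repeated:
  assumes "i < m" "k < m" "i \<noteq> k" "y i = y k"
  shows "vandermonde m g y = 0"
proof -
  let ?t = "Transposition.transpose i k"
  have t: "?t permutes {..<m}" using assms by (intro permutes_swap_id) auto
  have "vandermonde m g y = (\<Sum>p | p permutes {..<m}. of_int (sign (p \<circ> ?t)) * (\<Prod>j<m. g ((p \<circ> ?t) j) (y j)))"
    unfolding vandermonde_def by (rule sum_permutations_compose_right[OF t])
  also have "\<dots> = (\<Sum>p | p permutes {..<m}. - (of_int (sign p) * (\<Prod>j<m. g (p j) (y j))))"
  proof (rule sum.cong[OF refl])
    fix p assume "p \<in> {p. p permutes {..<m}}"
    then have p: "p permutes {..<m}" by simp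
    have "sign (p \<circ> ?t) = - sign p"
      using sign_compose[of p ?t] p t assms(3)
      by (simp add: permutation_permutes sign_swap_id permutation_swap_id) (metis finite_lessThan permutation_permutes)
    moreover have "(\<Prod>j<m. g ((p \<circ> ?t) j) (y j)) = (\<Prod>j<m. g (p (?t j)) (y (?t j)))"
      using assms(4) by (intro prod.cong) (auto simp: Transposition.transpose_def)
    moreover have "\<dots> = (\<Prod>j<m. g (p j) (y j))"
      using prod.permute[OF t, of "\<lambda>j. g (p j) (y j)"] by (simp add: o_def)
    ultimately show "of_int (sign (p \<circ> ?t)) * (\<Prod>j<m. g ((p \<circ> ?t) j) (y j)) = - (of_int (sign p) * (\<Prod>j<m. g (p j) (y j)))"
      by simp
  qed
  also have "\<dots> = - vandermonde m g y" by (simp add: vandermonde_def sum_negf)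
  finally show ?thesis by simp
qed

text \<open>Cramer's rule: by linearity in place \<open>i\<close> the determinant is a combination
  of those with \<open>y k\<close> in that place, and all but \<open>k = i\<close> have a repeated
  node.\<close>

lemma vandermonde_replace:
  assumes i: "i < m" and x: "\<And>j. j < m \<Longrightarrow> g j x = (\<Sum>k<m. a k * g j (y k))"
  shows "vandermonde m g (y(i := x)) = a i * vandermonde m g y"
proof -
  have "vandermonde m g (y(i := x)) = (\<Sum>k<m. a k * vandermonde m g (y(i := y k)))"
  proof -
    have fac: "(\<Prod>j<m. g (p j) ((y(i := z)) j)) = g (p i) z * (\<Prod>j\<in>{..<m} - {i}. g (p j) (y j))" for p z
      using i by (subst prod.remove[of _ i]) (auto intro!: prod.cong)
    have "vandermonde m g (y(i := x)) = (\<Sum>p | p permutes {..<m}. \<Sum>k<m. a k * (of_int (sign p) * (\<Prod>j<m. g (p j) ((y(i := y k)) j))))"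
      unfolding vandermonde_def fac
    proof (rule sum.cong[OF refl])
      fix p assume "p \<in> {p. p permutes {..<m}}"
      then have "p i < m" using permutes_in_image[of p "{..<m}" i] i by simp
      then show "of_int (sign p) * (g (p i) x * (\<Prod>j\<in>{..<m} - {i}. g (p j) (y j))) =
        (\<Sum>k<m. a k * (of_int (sign p) * (g (p i) (y k) * (\<Prod>j\<in>{..<m} - {i}. g (p j) (y j)))))"
        by (simp add: x sum_distrib_left sum_distrib_right mult_ac)
    qed
    also have "\<dots> = (\<Sum>k<m. a k * vandermonde m g (y(i := y k)))"
      unfolding vandermonde_def sum_distrib_left by (rule sum.swap)
    finally show ?thesis .
  qed
  also have "\<dots> = (\<Sum>k<m. if k = i then a i * vandermonde m g y else 0)"
  proof (rule sum.cong[OF refl])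
    fix k assume k: "k \<in> {..<m}"
    show "a k * vandermonde m g (y(i := y k)) = (if k = i then a i * vandermonde m g y else 0)"
    proof (cases "k = i")
      case False
      then have "vandermonde m g (y(i := y k)) = 0"
        using i k by (intro vandermonde_repeated[of i m k]) auto
      then show ?thesis using False by simp
    qed simp
  qed
  also have "\<dots> = a i * vandermonde m g y" using i by simp
  finally show ?thesis .
qed

lemma vandermonde_biorthogonal:
  assumes "\<And>i k. i < m \<Longrightarrow> k < m \<Longrightarrow> g i (y k) = (if i = k then 1 else 0)"
  shows "vandermonde m g y = 1"
proof -
  have "of_int (sign p) * (\<Prod>i<m. g (p i) (y i)) = (if p = id then 1 else 0)" if p: "p permutes {..<m}" for p
  proof (cases "p = id")
    case True
    then show ?thesis using assms by (simp add: sign_id)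
  next
    case False
    then obtain i where i: "p i \<noteq> i" by (auto simp: fun_eq_iff)
    then have "i < m" using p unfolding permutes_def by (meson lessThan_iff)
    moreover have "p i < m" using permutes_in_image[OF p, of i] \<open>i < m\<close> by simp
    ultimately have "\<exists>j\<in>{..<m}. g (p j) (y j) = 0" using assms i by (intro bexI[of _ i]) auto
    then have "(\<Prod>i<m. g (p i) (y i)) = 0" by (intro prod_zero) auto
    then show ?thesis using False by simp
  qed
  then have "vandermonde m g y = (\<Sum>p | p permutes {..<m}. if p = id then 1 else 0)"
    unfolding vandermonde_def by (intro sum.cong) auto
  also have "\<dots> = 1" by (subst sum.delta) (auto simp: finite_permutations permutes_id)
  finally show ?thesis .
qed

text \<open>A pivot step with pivot \<open>l i x\<close>. The exchange stays among the admissible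
  node systems, which is what makes the supremum of the determinants a bound for the exchanged
  one.\<close>

lemma lagrange_system_swap:
  assumes sys: "lagrange_system S F m y l" and i: "i < m" and nz: "l i x \<noteq> 0"
  shows "\<exists>l'. lagrange_system S F m (y(i := x)) l'"
proof -
  have l: "\<And>i. i < m \<Longrightarrow> lin S F (l i)"
      "\<And>i k. i < m \<Longrightarrow> k < m \<Longrightarrow> l i (y k) = (if i = k then 1 else 0)"
      "\<And>f x. lin S F f \<Longrightarrow> f x = (\<Sum>i<m. f (y i) * l i x)" using sys unfolding lagrange_system_def by blast+
  define g where "g z = inverse (l i x) * l i z" for z
  have lg: "lin S F g" unfolding g_def by (rule lin_cmult[OF l(1)[OF i]])
  define l' where "l' k z = (if k = i then g z else l k z - l k x * g z)" for k z
  have "lin S F (l' k)" if "k < m" for k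
  proof -
    have "l' k = (if k = i then g else (\<lambda>z. l k z - l k x * g z))" by (auto simp: l'_def)
    then show ?thesis using lin_diff[OF l(1)[OF that] lin_cmult[OF lg]] lg by simp
  qed
  moreover have "l' j ((y(i := x)) k) = (if j = k then 1 else 0)" if "j < m" "k < m" for j k
    using that i nz l(2) by (auto simp: l'_def g_def)
  moreover have "f z = (\<Sum>k<m. f ((y(i := x)) k) * l' k z)" if f: "lin S F f" for f z
  proof -
    have split: "(\<Sum>k<m. h k) = h i + (\<Sum>k\<in>{..<m} - {i}. h k)" for h :: "nat \<Rightarrow> complex"
      using i by (intro sum.remove) auto
    have "(\<Sum>k<m. f ((y(i := x)) k) * l' k z) = f x * g z + (\<Sum>k\<in>{..<m} - {i}. f (y k) * (l k z - l k x * g z))"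
      unfolding split by (simp add: l'_def)
    also have "\<dots> = (f x - (\<Sum>k\<in>{..<m} - {i}. f (y k) * l k x)) * g z + (\<Sum>k\<in>{..<m} - {i}. f (y k) * l k z)"
      by (simp add: right_diff_distrib left_diff_distrib sum_subtractf sum_distrib_right mult.assoc)
    also have "f x - (\<Sum>k\<in>{..<m} - {i}. f (y k) * l k x) = f (y i) * l i x"
      using l(3)[OF f, of x] unfolding split by simp
    also have "f (y i) * l i x * g z = f (y i) * l i z" using nz by (simp add: g_def)
    also have "f (y i) * l i z + (\<Sum>k\<in>{..<m} - {i}. f (y k) * l k z) = f z"
      using l(3)[OF f, of z] unfolding split by simp
    finally show ?thesis by simp
  qed
  ultimately show ?thesis unfolding lagrange_system_def by blast
qed

lemma lin_bounded:
  assumes "lin S F f" "\<And>i. i \<in> S \<Longrightarrow> \<exists>K. \<forall>x. norm (F i x) \<le> K"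
  shows "\<exists>K\<ge>0. \<forall>x. norm (f x) \<le> K"
proof -
  obtain c where c: "\<forall>x. f x = (\<Sum>i\<in>S. c i * F i x)" using assms(1) unfolding lin_def by blast
  obtain K where K: "\<And>i x. i \<in> S \<Longrightarrow> norm (F i x) \<le> K i" using assms(2) by metis
  have "norm (f x) \<le> (\<Sum>i\<in>S. norm (c i) * K i)" for x
    unfolding c[rule_format] by (intro sum_norm_le) (simp add: norm_mult K mult_left_mono)
  then show ?thesis using norm_ge_zero order_trans by blast
qed

text \<open>
  A system of Lagrange functions whose nodes nearly maximise the determinant is nearly bounded by
  one: replacing the node \<open>y i\<close> by \<open>x\<close> multiplies the determinant by \<open>l i x\<close>.
\<close>
lemma fekete_system:
  assumes fin: "finite S" and bdd: "\<And>i. i \<in> S \<Longrightarrow> \<exists>K. \<forall>x. norm (F i x) \<le> K" and \<epsilon>: "0 < \<epsilon>"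
  shows "\<exists>m y l. lagrange_system S F m y l \<and> (\<forall>i<m. \<forall>x. norm (l i x) \<le> 1 + \<epsilon>)"
proof -
  obtain m y0 g where sys0: "lagrange_system S F m y0 g" using lagrange_system_exists[OF fin] by blast
  \<comment> \<open>All determinants are formed with the one basis \<open>g\<close> of a reference
    system, so they are comparable. At the reference nodes the value is one, so the supremum is
    positive.\<close>
  define \<Y> where "\<Y> = {y. \<exists>l. lagrange_system S F m y l}"
  have y0: "y0 \<in> \<Y>" using sys0 by (auto simp: \<Y>_def)
  have lg: "\<And>i. i < m \<Longrightarrow> lin S F (g i)" using sys0 unfolding lagrange_system_def by blast
  have "\<forall>i\<in>{..<m}. \<exists>K\<ge>0. \<forall>x. norm (g i x) \<le> K" using lin_bounded[OF lg bdd] by blast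
  then obtain K where K: "\<And>i x. i < m \<Longrightarrow> norm (g i x) \<le> K i" "\<And>i. i < m \<Longrightarrow> 0 \<le> K i"
    by (metis lessThan_iff)
  have bound: "norm (vandermonde m g y) \<le> (\<Sum>p | p permutes {..<m}. \<Prod>i<m. K (p i))" for y
    unfolding vandermonde_def
  proof (rule sum_norm_le)
    fix p assume "p \<in> {p. p permutes {..<m}}"
    then have "p i < m" if "i < m" for i using permutes_in_image[of p "{..<m}" i] that by simp
    then have "(\<Prod>i<m. norm (g (p i) (y i))) \<le> (\<Prod>i<m. K (p i))" by (intro prod_mono) (auto intro: K)
    moreover have "norm (of_int (sign p) :: complex) = 1" by (simp add: sign_def)
    ultimately show "norm (of_int (sign p) * (\<Prod>i<m. g (p i) (y i))) \<le> (\<Prod>i<m. K (p i))"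
      by (simp add: norm_mult prod_norm)
  qed
  define s where "s = (SUP y\<in>\<Y>. norm (vandermonde m g y))"
  have bdd: "bdd_above ((\<lambda>y. norm (vandermonde m g y)) ` \<Y>)" by (rule bdd_aboveI2[OF bound])
  have le_s: "norm (vandermonde m g y) \<le> s" if "y \<in> \<Y>" for y
    unfolding s_def by (rule cSUP_upper[OF that bdd])
  have "vandermonde m g y0 = 1"
    by (rule vandermonde_biorthogonal) (use sys0 in \<open>auto simp: lagrange_system_def\<close>)
  then have s1: "1 \<le> s" using le_s[OF y0] by simp
  then have "s / (1 + \<epsilon>) < s" using \<epsilon> by (simp add: field_simps)
  then obtain y where y: "y \<in> \<Y>" "s / (1 + \<epsilon>) < norm (vandermonde m g y)"
    unfolding s_def using less_cSUP_iff[OF _ bdd] y0 by blast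
  then obtain l where l: "lagrange_system S F m y l" by (auto simp: \<Y>_def)
  have "norm (l i x) \<le> 1 + \<epsilon>" if i: "i < m" for i x
  \<comment> \<open>At a zero of \<open>l i\<close> an exchange would destroy unisolvence, but there
    the bound is trivial.\<close>
  proof (cases "l i x = 0")
    case False
    have "vandermonde m g (y(i := x)) = l i x * vandermonde m g y"
    proof (rule vandermonde_replace[OF i, where a = "\<lambda>k. l k x"])
      fix j assume "j < m"
      then have "g j x = (\<Sum>k<m. g j (y k) * l k x)" using l lg unfolding lagrange_system_def by blast
      then show "g j x = (\<Sum>k<m. l k x * g j (y k))" by (simp add: mult.commute)
    qed
    moreover have "y(i := x) \<in> \<Y>" using lagrange_system_swap[OF l i False] by (simp add: \<Y>_def)
    ultimately have "norm (l i x) * norm (vandermonde m g y) \<le> s" using le_s by (metis norm_mult)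
    also have "s \<le> (1 + \<epsilon>) * norm (vandermonde m g y)" using y(2) \<epsilon> by (simp add: field_simps)
    finally show ?thesis
    proof (rule mult_right_le_imp_le)
      have "0 < s / (1 + \<epsilon>)" using s1 \<epsilon> by simp
      then show "0 < norm (vandermonde m g y)" using y(2) by linarith
    qed
  qed (use \<epsilon> in simp)
  with l show ?thesis by blast
qed

subsection \<open>Slowly varying weights on the lattice\<close>

lemma sum_exp_abs_int_le:
  fixes \<epsilon> :: real
  assumes "0 < \<epsilon>" "finite J"
  shows "(\<Sum>j\<in>J. exp (- \<epsilon> * \<bar>real_of_int j\<bar>)) \<le> 2 / (1 - exp (- \<epsilon>))"
proof -
  have geo: "(\<Sum>n\<in>I. exp (- \<epsilon>) ^ n) \<le> 1 / (1 - exp (- \<epsilon>))" if "finite I" for I :: "nat set"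
    using assms(1) that sum_le_suminf[of "\<lambda>n. exp (- \<epsilon>) ^ n" I]
    by (simp add: suminf_geometric summable_geometric)
  have half: "(\<Sum>j\<in>I. exp (- \<epsilon> * \<bar>real_of_int j\<bar>)) \<le> 1 / (1 - exp (- \<epsilon>))"
    if I: "finite I" "inj_on (\<lambda>j. nat \<bar>j\<bar>) I" for I
  proof -
    have "(\<Sum>j\<in>I. exp (- \<epsilon> * \<bar>real_of_int j\<bar>)) = (\<Sum>j\<in>I. exp (- \<epsilon>) ^ nat \<bar>j\<bar>)"
      by (intro sum.cong refl) (simp add: exp_of_nat_mult[symmetric] mult.commute)
    also have "\<dots> = (\<Sum>n\<in>(\<lambda>j. nat \<bar>j\<bar>) ` I. exp (- \<epsilon>) ^ n)" by (simp add: sum.reindex[OF I(2)])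
    also have "\<dots> \<le> 1 / (1 - exp (- \<epsilon>))" using I by (intro geo) auto
    finally show ?thesis .
  qed
  have "(\<Sum>j\<in>J. exp (- \<epsilon> * \<bar>real_of_int j\<bar>))
      = (\<Sum>j\<in>J \<inter> {0..}. exp (- \<epsilon> * \<bar>real_of_int j\<bar>)) + (\<Sum>j\<in>J - {0..}. exp (- \<epsilon> * \<bar>real_of_int j\<bar>))"
    by (rule sum.Int_Diff[OF assms(2)])
  also have "\<dots> \<le> 1 / (1 - exp (- \<epsilon>)) + 1 / (1 - exp (- \<epsilon>))"
    using assms(2) by (intro add_mono half) (auto simp: inj_on_def)
  finally show ?thesis by simp
qed

text \<open>A finite set of lattice points lies in a finite product of coordinate sets, over which
  the sum of exponentials factors into one-dimensional sums.\<close>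

lemma exp_weight_summable:
  assumes "0 < \<epsilon>"
  shows "(\<lambda>k :: int ^ 'd. exp (- \<epsilon> * (\<Sum>i\<in>UNIV. \<bar>real_of_int (k $ i)\<bar>))) summable_on UNIV"
proof (rule nonneg_bdd_above_summable_on)
  let ?f = "\<lambda>j. exp (- \<epsilon> * \<bar>real_of_int j\<bar>)"
  have "(\<Sum>k\<in>K. exp (- \<epsilon> * (\<Sum>i\<in>UNIV. \<bar>real_of_int (k $ i)\<bar>))) \<le> (2 / (1 - exp (- \<epsilon>))) ^ CARD('d)"
    if K: "finite K" for K :: "(int ^ 'd) set"
  proof -
    define J where "J = (\<Union>k\<in>K. range (($) k))"
    have J: "finite J" using K by (simp add: J_def)
    have inj: "inj_on vec_nth K" by (auto simp: inj_on_def vec_nth_inject)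
    have sub: "vec_nth ` K \<subseteq> Pi\<^sub>E UNIV (\<lambda>_. J)" by (auto simp: J_def)
    have "(\<Sum>k\<in>K. exp (- \<epsilon> * (\<Sum>i\<in>UNIV. \<bar>real_of_int (k $ i)\<bar>))) = (\<Sum>k\<in>K. \<Prod>i\<in>UNIV. ?f (k $ i))"
      by (simp add: sum_distrib_left exp_sum[symmetric])
    also have "\<dots> = (\<Sum>g\<in>vec_nth ` K. \<Prod>i\<in>UNIV. ?f (g i))" by (simp add: sum.reindex[OF inj])
    also have "\<dots> \<le> (\<Sum>g\<in>Pi\<^sub>E (UNIV :: 'd set) (\<lambda>_. J). \<Prod>i\<in>UNIV. ?f (g i))"
      by (rule sum_mono2[OF _ sub]) (auto simp: J intro!: finite_PiE prod_nonneg)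
    also have "\<dots> = (\<Prod>i\<in>(UNIV :: 'd set). \<Sum>j\<in>J. ?f j)"
      by (rule prod_sum_PiE[symmetric]) (auto simp: J)
    also have "\<dots> \<le> (2 / (1 - exp (- \<epsilon>))) ^ CARD('d)"
      using sum_exp_abs_int_le[OF assms J] by (simp add: power_mono sum_nonneg)
    finally show ?thesis .
  qed
  then show "bdd_above (sum (\<lambda>k :: int ^ 'd. exp (- \<epsilon> * (\<Sum>i\<in>UNIV. \<bar>real_of_int (k $ i)\<bar>))) ` {K. K \<subseteq> UNIV \<and> finite K})"
    by (intro bdd_aboveI2) auto
qed simp

text \<open>An exponential weight in the sum of the absolute coordinates. A shift by
  \<open>m\<close> changes this length by at most \<open>len m\<close>, hence the weight by a factor
  between \<open>exp (- \<epsilon> * len m)\<close> and \<open>exp (\<epsilon> * len m)\<close>. As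
  \<open>R\<close> bounds the lengths in \<open>M\<close>, the rate
  \<open>ln (1 + \<delta>) / R\<close> keeps the factor between \<open>1 / (1 + \<delta>)\<close>
  and \<open>1 + \<delta>\<close>.\<close>

lemma slow_weight_exists:
  fixes M :: "(int ^ 'd) set"
  assumes "0 < \<delta>" "finite M"
  shows "\<exists>w :: int ^ 'd \<Rightarrow> real. (\<forall>k. 0 < w k \<and> w k \<le> 1) \<and> w 0 = 1 \<and> w summable_on UNIV \<and>
      (\<forall>m\<in>M. \<forall>k. \<bar>w (k + m) - w k\<bar> \<le> \<delta> * w k)"
proof -
  define len :: "int ^ 'd \<Rightarrow> real" where "len k = (\<Sum>i\<in>UNIV. \<bar>real_of_int (k $ i)\<bar>)" for k
  have len0: "0 \<le> len k" for k by (simp add: len_def sum_nonneg)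
  define R where "R = 1 + (\<Sum>m\<in>M. len m)"
  have R: "0 < R" "len m \<le> R" if "m \<in> M" for m
    using member_le_sum[OF that, of len] len0 assms(2) by (auto simp: R_def add_pos_nonneg sum_nonneg)
  have R0: "0 < R" by (simp add: R_def add_pos_nonneg sum_nonneg len0)
  define \<epsilon> where "\<epsilon> = ln (1 + \<delta>) / R"
  have \<epsilon>: "0 < \<epsilon>" using assms(1) R0 by (simp add: \<epsilon>_def)
  define w where "w k = exp (- \<epsilon> * len k)" for k
  have "\<bar>w (k + m) - w k\<bar> \<le> \<delta> * w k" if m: "m \<in> M" for m k
  proof -
    have tri: "len (k + m) \<le> len k + len m" "len k \<le> len (k + m) + len m"
      unfolding len_def sum.distrib[symmetric] by (intro sum_mono; simp)+
    have "\<epsilon> * len m \<le> \<epsilon> * R" using R(2)[OF m] \<epsilon> by simp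
    then have em: "\<epsilon> * len m \<le> ln (1 + \<delta>)" using R0 by (simp add: \<epsilon>_def)
    have "w (k + m) \<le> exp (\<epsilon> * len m + - \<epsilon> * len k)"
      unfolding w_def using mult_left_mono[OF tri(2), of \<epsilon>] \<epsilon> by (simp add: algebra_simps)
    also have "\<dots> = exp (\<epsilon> * len m) * w k" by (simp add: w_def exp_add[symmetric])
    also have "\<dots> \<le> (1 + \<delta>) * w k"
    proof (rule mult_right_mono)
      have "exp (\<epsilon> * len m) \<le> exp (ln (1 + \<delta>))" using em by simp
      then show "exp (\<epsilon> * len m) \<le> 1 + \<delta>" using assms(1) by simp
    qed (simp add: w_def)
    finally have up: "w (k + m) - w k \<le> \<delta> * w k" by (simp add: algebra_simps)
    have "inverse (1 + \<delta>) * w k \<le> exp (- (\<epsilon> * len m)) * w k"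
    proof (rule mult_right_mono)
      have "exp (- ln (1 + \<delta>)) \<le> exp (- (\<epsilon> * len m))" using em by simp
      then show "inverse (1 + \<delta>) \<le> exp (- (\<epsilon> * len m))" using assms(1) by (simp add: exp_minus)
    qed (simp add: w_def)
    also have "\<dots> = exp (- (\<epsilon> * len m) + - \<epsilon> * len k)" by (simp add: w_def exp_add[symmetric])
    also have "\<dots> \<le> w (k + m)"
      unfolding w_def using mult_left_mono[OF tri(1), of \<epsilon>] \<epsilon> by (simp add: algebra_simps)
    finally have "w k - w (k + m) \<le> (1 - inverse (1 + \<delta>)) * w k" by (simp add: algebra_simps)
    also have "\<dots> \<le> \<delta> * w k"
    proof (rule mult_right_mono)
      have "1 - inverse (1 + \<delta>) = \<delta> / (1 + \<delta>)" using assms(1) by (simp add: field_simps)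
      also have "\<dots> \<le> \<delta>" using assms(1) by (simp add: divide_le_eq)
      finally show "1 - inverse (1 + \<delta>) \<le> \<delta>" .
    qed (simp add: w_def)
    finally show ?thesis using up by linarith
  qed
  moreover have "w summable_on UNIV"
    using exp_weight_summable[OF \<epsilon>] unfolding w_def[abs_def] len_def .
  moreover have "w 0 = 1" by (simp add: w_def len_def)
  ultimately show ?thesis using \<epsilon> len0 by (intro exI[of _ w]) (simp add: w_def)
qed

subsection \<open>Cubic cells and envelopes\<close>

definition cell_of :: "real \<Rightarrow> real ^ 'd \<Rightarrow> int ^ 'd" where
  "cell_of s x = (\<chi> i. \<lfloor>x $ i / s\<rfloor>)"

definition corner :: "real \<Rightarrow> int ^ 'd \<Rightarrow> real ^ 'd" where
  "corner s k = (\<chi> i. s * real_of_int (k $ i))"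

lemma cell_of_eq_iff:
  fixes s :: real
  assumes "0 < s"
  shows "cell_of s x = k \<longleftrightarrow> (\<forall>i. corner s k $ i \<le> x $ i \<and> x $ i < corner s k $ i + s)"
  using assms by (simp add: cell_of_def corner_def vec_eq_iff floor_eq_iff field_simps)

lemma norm_vec_le:
  fixes x :: "real ^ 'd"
  assumes "\<And>i. \<bar>x $ i\<bar> \<le> e"
  shows "norm x \<le> e * CARD('d)"
  using norm_le_l1_cart[of x] sum_mono[of UNIV "\<lambda>i. \<bar>x $ i\<bar>" "\<lambda>_. e"] assms by (simp add: mult.commute)

lemma dist_cell_of_le:
  fixes x y :: "real ^ 'd" and s :: real
  assumes "0 < s" "cell_of s x = cell_of s y"
  shows "dist x y \<le> s * CARD('d)"
  unfolding dist_norm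
proof (rule norm_vec_le)
  fix i
  have "corner s (cell_of s y) $ i \<le> x $ i \<and> x $ i < corner s (cell_of s y) $ i + s"
       "corner s (cell_of s y) $ i \<le> y $ i \<and> y $ i < corner s (cell_of s y) $ i + s"
    using cell_of_eq_iff[OF assms(1), of x "cell_of s y"] cell_of_eq_iff[OF assms(1), of y "cell_of s y"] assms(2) by auto
  then show "\<bar>(x - y) $ i\<bar> \<le> s" by (simp add: algebra_simps abs_le_iff)
qed

text \<open>Rounding to cells is additive up to one cell in each direction. This lets an envelope in
  the variable \<open>x - \<gamma>\<close> be read off from a difference of cells.\<close>

lemma dist_cell_diff_lt:
  fixes x y w :: "real ^ 'd" and s :: real
  assumes "0 < s" "cell_of s x - cell_of s y = cell_of s w"
  shows "dist (x - y) w \<le> 2 * s * CARD('d)"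
  unfolding dist_norm
proof (rule norm_vec_le)
  fix i
  have b: "s * real_of_int (cell_of s z $ i) \<le> z $ i" "z $ i < s * real_of_int (cell_of s z $ i) + s" for z :: "real ^ 'd"
    using cell_of_eq_iff[OF assms(1), of z "cell_of s z"] by (auto simp: corner_def)
  have "cell_of s x $ i - cell_of s y $ i = cell_of s w $ i" using assms(2) by (metis vector_minus_component)
  then have "real_of_int (cell_of s x $ i) - real_of_int (cell_of s y $ i) = real_of_int (cell_of s w $ i)" by (metis of_int_diff)
  then have "s * real_of_int (cell_of s x $ i) - s * real_of_int (cell_of s y $ i) = s * real_of_int (cell_of s w $ i)"
    by (metis right_diff_distrib)
  then show "\<bar>(x - y - w) $ i\<bar> \<le> 2 * s" using b[of x] b[of y] b[of w] by (simp add: abs_le_iff)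
qed

lemma box_subset_cell:
  fixes k :: "int ^ 'd" and s :: real
  assumes "0 < s"
  shows "box (corner s k) (corner s (k + 1)) \<subseteq> {x. cell_of s x = k}"
  using assms by (auto simp: cell_of_eq_iff mem_box_cart corner_def algebra_simps less_imp_le)

lemma cell_subset_cbox:
  fixes k :: "int ^ 'd" and s :: real
  assumes "0 < s"
  shows "{x. cell_of s x = k} \<subseteq> cbox (corner s k) (corner s (k + 1))"
  using assms by (auto simp: cell_of_eq_iff mem_box_cart corner_def algebra_simps less_imp_le)

lemma cell_borel: "{x :: real ^ 'd. cell_of s x = k} \<in> sets borel"
proof -
  have "{x :: real ^ 'd. cell_of s x = k} = (\<Inter>i\<in>UNIV. {x \<in> space borel. \<lfloor>x $ i / s\<rfloor> = k $ i})"
    by (auto simp: cell_of_def vec_eq_iff)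
  also have "\<dots> \<in> sets borel" by measurable
  finally show ?thesis .
qed

lemma cube_prod:
  fixes k :: "int ^ 'd" and s :: real
  shows "(\<Prod>b\<in>Basis. ((corner s (k + 1)) - (corner s k)) \<bullet> b) = s ^ CARD('d)"
proof -
  have "((corner s (k + 1)) - (corner s k)) \<bullet> b = s" if "b \<in> Basis" for b :: "real ^ 'd"
    using that by (auto simp: Basis_vec_def inner_axis corner_def algebra_simps)
  then show ?thesis by simp
qed

lemma cube_le:
  fixes k :: "int ^ 'd" and s :: real
  assumes "0 < s" "b \<in> Basis"
  shows "(corner s k) \<bullet> b \<le> (corner s (k + 1)) \<bullet> b"
  using assms by (auto simp: Basis_vec_def inner_axis corner_def algebra_simps)

lemma emeasure_cell:
  fixes k :: "int ^ 'd" and s :: real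
  assumes "0 < s"
  shows "emeasure lebesgue {x. cell_of s x = k} = ennreal (s ^ CARD('d))"
proof (rule antisym)
  have "emeasure lebesgue {x. cell_of s x = k} \<le> emeasure lebesgue (cbox (corner s k) (corner s (k + 1)))"
    by (intro emeasure_mono cell_subset_cbox assms) simp
  also have "\<dots> = ennreal (s ^ CARD('d))"
    using cube_le[OF assms, of _ k] by (simp add: emeasure_lborel_cbox cube_prod)
  finally show "emeasure lebesgue {x. cell_of s x = k} \<le> ennreal (s ^ CARD('d))" .
  have "ennreal (s ^ CARD('d)) = emeasure lebesgue (box (corner s k) (corner s (k + 1)))"
    using cube_le[OF assms, of _ k] by (simp add: emeasure_lborel_box cube_prod)
  also have "\<dots> \<le> emeasure lebesgue {x. cell_of s x = k}"
    using cell_borel[of s k] by (intro emeasure_mono box_subset_cell assms) (auto simp: sets_completionI_sets)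
  finally show "ennreal (s ^ CARD('d)) \<le> emeasure lebesgue {x. cell_of s x = k}" .
qed

lemma finite_cells_ball:
  fixes x :: "real ^ 'd" and s :: real
  assumes "0 < s"
  shows "finite (cell_of s ` ball x r)"
proof -
  have "cell_of s ` ball x r \<subseteq> (\<lambda>g. \<chi> i. g i) ` (Pi\<^sub>E UNIV (\<lambda>i. {\<lfloor>(x $ i - r) / s\<rfloor>..\<lfloor>(x $ i + r) / s\<rfloor>}))"
  proof
    fix k assume "k \<in> cell_of s ` ball x r"
    then obtain y where y: "k = cell_of s y" "dist x y < r" by auto
    have "\<bar>x $ i - y $ i\<bar> < r" for i
      using y(2) component_le_norm_cart[of "x - y" i] by (simp add: dist_norm)
    then have "x $ i - r \<le> y $ i" "y $ i \<le> x $ i + r" for i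
      by (smt (verit))+
    then have "\<lfloor>(x $ i - r) / s\<rfloor> \<le> k $ i" "k $ i \<le> \<lfloor>(x $ i + r) / s\<rfloor>" for i
      using assms by (auto simp: y(1) cell_of_def intro!: floor_mono divide_right_mono)
    then show "k \<in> (\<lambda>g. \<chi> i. g i) ` (Pi\<^sub>E UNIV (\<lambda>i. {\<lfloor>(x $ i - r) / s\<rfloor>..\<lfloor>(x $ i + r) / s\<rfloor>}))"
      by (intro image_eqI[of _ _ "($) k"]) auto
  qed
  then show ?thesis by (rule finite_subset) (intro finite_imageI finite_PiE; simp)
qed

section \<open>From essential suprema to a pointwise lattice envelope\<close>

lemma AE_open_ex:
  assumes "AE y in lebesgue. P y" "open U" "U \<noteq> ({} :: 'a::euclidean_space set)"
  shows "\<exists>y\<in>U. P y"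
proof (rule ccontr)
  assume "\<not> (\<exists>y\<in>U. P y)"
  moreover obtain N where "negligible N" "{x. \<not> P x} \<subseteq> N"
    using assms(1) unfolding eventually_ae_filter_negligible by blast
  ultimately have "negligible U" using negligible_subset by blast
  then show False using open_not_negligible assms(2,3) by blast
qed

text \<open>\<open>\<Theta>\<close> is controlled by its local supremum only almost everywhere. A
  strict violation by \<open>f\<close> at \<open>x\<close> would persist on an open set by
  continuity, and such a set contains a point where the essential bound holds.\<close>

lemma envelope_le_local_sup:
  fixes f :: "'a::euclidean_space \<Rightarrow> complex"
  assumes cont: "continuous_on UNIV f" and le: "\<And>x. norm (f x) \<le> \<Theta> (x - \<gamma>)"
    and w: "dist (x - \<gamma>) w < 1"
  shows "ennreal (norm (f x)) \<le> Linf_norm_on (ball w 1) \<Theta>"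
proof (rule ccontr)
  let ?M = "Linf_norm_on (ball w 1) \<Theta>"
  assume "\<not> ?thesis"
  then have lt: "?M < ennreal (norm (f x))" by simp
  define U where "U = (\<lambda>y. y + \<gamma>) -` {z. ?M < ennreal (norm (f z))} \<inter> ball w 1"
  have "open {z. ?M < ennreal (norm (f z))}"
    by (intro open_Collect_less continuous_on_ennreal continuous_on_norm cont continuous_on_const)
  then have "open U" unfolding U_def by (intro open_Int open_vimage) (auto intro: continuous_intros)
  moreover have "x - \<gamma> \<in> U" using lt w by (simp add: U_def dist_commute)
  moreover have "AE y in lebesgue. y \<in> ball w 1 \<longrightarrow> ennreal (norm (\<Theta> y)) \<le> ?M"
    unfolding Linf_norm_on_def
    using esssup_AE[where M = "restrict_space lebesgue (ball w 1)" and f = "\<lambda>x. ennreal (norm (\<Theta> x))"]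
    by (subst (asm) AE_restrict_space_iff) auto
  ultimately obtain y where y: "y \<in> U" "y \<in> ball w 1 \<longrightarrow> ennreal (norm (\<Theta> y)) \<le> ?M"
    using AE_open_ex by blast
  then have "ennreal (norm (\<Theta> y)) \<le> ?M" "?M < ennreal (norm (f (y + \<gamma>)))" by (auto simp: U_def)
  moreover have "norm (f (y + \<gamma>)) \<le> norm (\<Theta> y)" using le[of "y + \<gamma>"] by simp
  ultimately show False by (meson ennreal_leI leD order_trans)
qed

text \<open>\<open>e k\<close> is the supremum of the functions over all pairs at cell offset
  \<open>k\<close>; it is at most the local supremum of \<open>\<Theta>\<close> around every point
  of the cell \<open>k\<close>. Integrating over disjoint cells of equal volume bounds the sum of
  \<open>e\<close> by the amalgam norm. This is where membership in \<open>W_Linf_L1\<close> is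
  spent.\<close>

lemma discrete_envelope:
  fixes F :: "'i \<Rightarrow> real ^ 'd \<Rightarrow> complex" and \<tau> :: "'i \<Rightarrow> real ^ 'd" and \<Theta> :: "real ^ 'd \<Rightarrow> real"
    and s :: real
  assumes s: "0 < s" "2 * s * CARD('d) < 1" and \<Theta>: "\<Theta> \<in> W_Linf_L1"
    and cont: "\<And>\<gamma>. \<gamma> \<in> \<Gamma> \<Longrightarrow> continuous_on UNIV (F \<gamma>)"
    and le: "\<And>\<gamma> x. \<gamma> \<in> \<Gamma> \<Longrightarrow> norm (F \<gamma> x) \<le> \<Theta> (x - \<tau> \<gamma>)"
  shows "\<exists>\<theta>. (\<forall>k. 0 \<le> \<theta> k) \<and> \<theta> summable_on UNIV \<and>
    (\<forall>\<gamma>\<in>\<Gamma>. \<forall>x. norm (F \<gamma> x) \<le> \<theta> (cell_of s x - cell_of s (\<tau> \<gamma>)))"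
proof -
  define I where "I = (\<integral>\<^sup>+ x. Linf_norm_on (ball x 1) \<Theta> \<partial>lebesgue)"
  have I: "I < \<infinity>" using \<Theta> by (simp add: W_Linf_L1_def I_def)
  define e where "e k = (SUP p\<in>{(\<gamma>, x). \<gamma> \<in> \<Gamma> \<and> cell_of s x - cell_of s (\<tau> \<gamma>) = k}. ennreal (norm (F (fst p) (snd p))))" for k
  have e_le: "e (cell_of s w) \<le> Linf_norm_on (ball w 1) \<Theta>" for w
    unfolding e_def
  proof (rule SUP_least, clarsimp)
    fix \<gamma> x assume \<gamma>: "\<gamma> \<in> \<Gamma>" and k: "cell_of s x - cell_of s (\<tau> \<gamma>) = cell_of s w"
    have "dist (x - \<tau> \<gamma>) w < 1" using dist_cell_diff_lt[OF s(1) k] s(2) by linarith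
    then show "ennreal (norm (F \<gamma> x)) \<le> Linf_norm_on (ball w 1) \<Theta>"
      by (rule envelope_le_local_sup[OF cont[OF \<gamma>] le[OF \<gamma>]])
  qed
  have fin: "(\<Sum>k\<in>K. e k) * ennreal (s ^ CARD('d)) \<le> I" if K: "finite K" for K
  proof -
    have m: "{x :: real ^ 'd. cell_of s x = k} \<in> sets lebesgue" for k
      using cell_borel[of s k] by (auto simp: sets_completionI_sets)
    have "(\<Sum>k\<in>K. e k) * ennreal (s ^ CARD('d)) = (\<Sum>k\<in>K. e k * emeasure lebesgue {x. cell_of s x = k})"
      by (simp add: sum_distrib_right emeasure_cell[OF s(1)])
    also have "\<dots> = (\<integral>\<^sup>+ x. (\<Sum>k\<in>K. e k * indicator {x. cell_of s x = k} x) \<partial>lebesgue)"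
      using m by (subst nn_integral_sum) (auto simp: nn_integral_cmult_indicator)
    also have "\<dots> \<le> I" unfolding I_def
    proof (rule nn_integral_mono)
      fix x :: "real ^ 'd"
      have "(\<Sum>k\<in>K. e k * indicator {x. cell_of s x = k} x) = (\<Sum>k\<in>K. if k = cell_of s x then e k else 0)"
        by (intro sum.cong) (auto simp: indicator_def)
      also have "\<dots> \<le> e (cell_of s x)" using K by simp
      also have "\<dots> \<le> Linf_norm_on (ball x 1) \<Theta>" by (rule e_le)
      finally show "(\<Sum>k\<in>K. e k * indicator {x. cell_of s x = k} x) \<le> Linf_norm_on (ball x 1) \<Theta>" .
    qed
    finally show ?thesis .
  qed
  have s0: "ennreal (s ^ CARD('d)) \<noteq> 0" using s(1) by simp
  have bound: "(\<Sum>k\<in>K. e k) \<le> I / ennreal (s ^ CARD('d))" if K: "finite K" for K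
  proof -
    have "(\<Sum>k\<in>K. e k) = (\<Sum>k\<in>K. e k) * ennreal (s ^ CARD('d)) / ennreal (s ^ CARD('d))"
      using s0 by (simp add: ennreal_mult_divide_eq)
    also have "\<dots> \<le> I / ennreal (s ^ CARD('d))" by (rule divide_right_mono_ennreal[OF fin[OF K]])
    finally show ?thesis .
  qed
  have J: "I / ennreal (s ^ CARD('d)) < \<infinity>"
  proof -
    have "I / ennreal (s ^ CARD('d)) \<noteq> top" using I s0 by (auto simp: ennreal_divide_eq_top_iff)
    then show ?thesis by (simp add: less_top)
  qed
  then have ek: "e k < \<infinity>" for k using bound[of "{k}"] by (auto intro: le_less_trans)
  define \<theta> where "\<theta> k = enn2real (e k)" for k
  have \<theta>0: "\<And>k. 0 \<le> \<theta> k" by (simp add: \<theta>_def)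
  have ek': "e k = ennreal (\<theta> k)" for k using ek[of k] by (simp add: \<theta>_def)
  have "(\<Sum>k\<in>K. \<theta> k) \<le> enn2real (I / ennreal (s ^ CARD('d)))" if K: "finite K" for K
  proof -
    have "ennreal (\<Sum>k\<in>K. \<theta> k) \<le> I / ennreal (s ^ CARD('d))"
      using bound[OF K] \<theta>0 by (simp only: ek' sum_ennreal)
    then have "enn2real (ennreal (\<Sum>k\<in>K. \<theta> k)) \<le> enn2real (I / ennreal (s ^ CARD('d)))"
      using J by (intro enn2real_mono) auto
    then show ?thesis using \<theta>0 by (simp add: sum_nonneg)
  qed
  then have "\<theta> summable_on UNIV"
    by (intro nonneg_bdd_above_summable_on bdd_aboveI2 \<theta>0) auto
  moreover have "norm (F \<gamma> x) \<le> \<theta> (cell_of s x - cell_of s (\<tau> \<gamma>))" if "\<gamma> \<in> \<Gamma>" for \<gamma> x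
  proof -
    have "ennreal (norm (F \<gamma> x)) \<le> e (cell_of s x - cell_of s (\<tau> \<gamma>))"
      unfolding e_def by (rule SUP_upper2[of "(\<gamma>, x)"]) (use that in auto)
    then show ?thesis unfolding ek' using \<theta>0 by simp
  qed
  ultimately show ?thesis using \<theta>0 by (intro exI[of _ \<theta>]) auto
qed

text \<open>A cell has diameter below one, so it lies in the unit ball around any of its
  points.\<close>

lemma relatively_separated_cells:
  fixes \<Gamma> :: "(real ^ 'd) set" and s :: real
  assumes s: "0 < s" "2 * s * CARD('d) < 1" and "relatively_separated \<Gamma>"
  shows "\<exists>N. \<forall>k. finite {\<gamma>\<in>\<Gamma>. cell_of s \<gamma> = k} \<and> card {\<gamma>\<in>\<Gamma>. cell_of s \<gamma> = k} \<le> N"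
proof -
  obtain N where N: "\<And>x. finite (\<Gamma> \<inter> ball x 1) \<and> card (\<Gamma> \<inter> ball x 1) \<le> N"
    using assms(3) unfolding relatively_separated_def by blast
  have "finite {\<gamma>\<in>\<Gamma>. cell_of s \<gamma> = k} \<and> card {\<gamma>\<in>\<Gamma>. cell_of s \<gamma> = k} \<le> N" for k
  proof (cases "{\<gamma>\<in>\<Gamma>. cell_of s \<gamma> = k} = {}")
    case False
    then obtain x where x: "cell_of s x = k" by blast
    have "{\<gamma>\<in>\<Gamma>. cell_of s \<gamma> = k} \<subseteq> \<Gamma> \<inter> ball x 1"
    proof
      fix \<gamma> assume "\<gamma> \<in> {\<gamma>\<in>\<Gamma>. cell_of s \<gamma> = k}"
      then have g: "\<gamma> \<in> \<Gamma>" "cell_of s x = cell_of s \<gamma>" using x by auto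
      have "0 \<le> s * CARD('d)" using s(1) by simp
      then have "dist x \<gamma> < 1" using dist_cell_of_le[OF s(1) g(2)] s(2) by linarith
      then show "\<gamma> \<in> \<Gamma> \<inter> ball x 1" using g by simp
    qed
    then show ?thesis using N[of x] card_mono[of "\<Gamma> \<inter> ball x 1"] finite_subset order_trans by meson
  next
    case True
    then show ?thesis by (simp only: True) simp
  qed
  then show ?thesis by blast
qed

subsection \<open>Synthesis from a localized family\<close>

text \<open>From here on the decay of the family is known through the lattice envelope
  \<open>\<theta>\<close>, and the density of \<Gamma> through the number of its points per
  cell.\<close>

locale localized_family =
  fixes \<Gamma> :: "(real ^ 'd) set" and F :: "real ^ 'd \<Rightarrow> real ^ 'd \<Rightarrow> complex"
    and s :: real and \<theta> :: "int ^ 'd \<Rightarrow> real" and N :: nat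
  assumes s_pos: "0 < s"
    and cell_fin: "finite {\<gamma>\<in>\<Gamma>. cell_of s \<gamma> = k}" and cell_card: "card {\<gamma>\<in>\<Gamma>. cell_of s \<gamma> = k} \<le> N"
    and F_cont: "\<gamma> \<in> \<Gamma> \<Longrightarrow> continuous_on UNIV (F \<gamma>)"
    and \<theta>_nonneg: "0 \<le> \<theta> k" and \<theta>_summable: "\<theta> summable_on UNIV"
    and F_le: "\<gamma> \<in> \<Gamma> \<Longrightarrow> norm (F \<gamma> x) \<le> \<theta> (cell_of s x - cell_of s \<gamma>)"
begin

abbreviation "q \<equiv> cell_of s"

definition S\<theta> where "S\<theta> = (\<Sum>\<^sub>\<infinity>k. \<theta> k)"

lemma S\<theta>_nonneg: "0 \<le> S\<theta>" by (simp add: S\<theta>_def infsum_nonneg \<theta>_nonneg)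

lemma \<theta>_le: "\<theta> k \<le> S\<theta>"
  using finite_sum_le_infsum[OF \<theta>_summable, of "{k}"] by (simp add: S\<theta>_def \<theta>_nonneg)

lemma convolution_dominated_zero: "convolution_dominated \<Gamma> q N (\<lambda>_ _. 0) \<theta>"
  by unfold_locales (use cell_fin cell_card \<theta>_nonneg \<theta>_summable in auto)

lemma sum_\<theta>_le: "finite S \<Longrightarrow> S \<subseteq> \<Gamma> \<Longrightarrow> (\<Sum>\<gamma>\<in>S. \<theta> (k - q \<gamma>)) \<le> real N * S\<theta>"
  unfolding S\<theta>_def
  by (rule convolution_dominated.sum_cells_right[OF convolution_dominated_zero]) (auto simp: \<theta>_nonneg \<theta>_summable)

lemma \<theta>_cell_summable: "(\<lambda>\<gamma>. \<theta> (k - q \<gamma>)) summable_on \<Gamma>"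
  by (rule nonneg_bdd_above_summable_on) (auto simp: \<theta>_nonneg intro!: bdd_aboveI2 sum_\<theta>_le)

lemma infsum_\<theta>_le: "(\<Sum>\<^sub>\<infinity>\<gamma>\<in>\<Gamma>. \<theta> (k - q \<gamma>)) \<le> real N * S\<theta>"
  by (rule infsum_le_finite_sums[OF \<theta>_cell_summable sum_\<theta>_le])

lemma countable_\<Gamma>: "countable \<Gamma>"
proof -
  have "\<Gamma> = (\<Union>k. {\<gamma>\<in>\<Gamma>. q \<gamma> = k})" by auto
  moreover have "countable (\<Union>k. {\<gamma>\<in>\<Gamma>. q \<gamma> = k})"
    by (intro countable_UN countableI_type countable_finite cell_fin)
  ultimately show ?thesis by (rule ssubst)
qed

text \<open>The synthesis operator. For bounded coefficients the series converges absolutely at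
  every point, so that values are taken pointwise and no representative has to be chosen.\<close>

definition D where "D c x = (\<Sum>\<^sub>\<infinity>\<gamma>\<in>\<Gamma>. c \<gamma> * F \<gamma> x)"

lemma term_le:
  assumes "\<gamma> \<in> \<Gamma>" "norm (c \<gamma>) \<le> K"
  shows "norm (c \<gamma> * F \<gamma> x) \<le> K * \<theta> (q x - q \<gamma>)"
  unfolding norm_mult using assms F_le by (intro mult_mono) (auto intro: order_trans[OF norm_ge_zero])

lemma abs_summable:
  assumes "\<And>\<gamma>. \<gamma> \<in> \<Gamma> \<Longrightarrow> norm (c \<gamma>) \<le> K"
  shows "(\<lambda>\<gamma>. norm (c \<gamma> * F \<gamma> x)) summable_on \<Gamma>"
  by (rule summable_on_bound_real[OF summable_on_cmult_right[OF \<theta>_cell_summable[of "q x"], of K]])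
    (auto intro: term_le assms)

lemma D_has_sum:
  assumes "\<And>\<gamma>. \<gamma> \<in> \<Gamma> \<Longrightarrow> norm (c \<gamma>) \<le> K"
  shows "((\<lambda>\<gamma>. c \<gamma> * F \<gamma> x) has_sum D c x) \<Gamma>"
  unfolding D_def by (rule has_sum_infsum[OF abs_summable_summable[OF abs_summable[OF assms]]])

lemma D_le:
  assumes "\<And>\<gamma>. \<gamma> \<in> \<Gamma> \<Longrightarrow> norm (c \<gamma>) \<le> K" "0 \<le> K"
  shows "norm (D c x) \<le> K * (real N * S\<theta>)"
proof -
  have "norm (D c x) \<le> (\<Sum>\<^sub>\<infinity>\<gamma>\<in>\<Gamma>. norm (c \<gamma> * F \<gamma> x))"
    unfolding D_def by (rule norm_infsum_bound[OF abs_summable[OF assms(1)]])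
  also have "\<dots> \<le> (\<Sum>\<^sub>\<infinity>\<gamma>\<in>\<Gamma>. K * \<theta> (q x - q \<gamma>))"
    by (intro infsum_mono abs_summable[OF assms(1)] summable_on_cmult_right \<theta>_cell_summable term_le assms(1))
  also have "\<dots> = K * (\<Sum>\<^sub>\<infinity>\<gamma>\<in>\<Gamma>. \<theta> (q x - q \<gamma>))" by (rule infsum_cmult_right')
  also have "\<dots> \<le> K * (real N * S\<theta>)" by (intro mult_left_mono infsum_\<theta>_le assms(2))
  finally show ?thesis .
qed

lemma D_finite:
  assumes "finite S" "S \<subseteq> \<Gamma>" "\<And>\<gamma>. \<gamma> \<in> \<Gamma> - S \<Longrightarrow> c \<gamma> = 0"
  shows "D c x = (\<Sum>\<gamma>\<in>S. c \<gamma> * F \<gamma> x)"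
proof -
  have "D c x = infsum (\<lambda>\<gamma>. c \<gamma> * F \<gamma> x) S"
    unfolding D_def by (rule infsum_cong_neutral) (use assms in auto)
  then show ?thesis using assms(1) by simp
qed

lemma D_diff:
  assumes "\<And>\<gamma>. \<gamma> \<in> \<Gamma> \<Longrightarrow> norm (c \<gamma>) \<le> K" "\<And>\<gamma>. \<gamma> \<in> \<Gamma> \<Longrightarrow> norm (d \<gamma>) \<le> L"
  shows "D (\<lambda>\<gamma>. c \<gamma> - d \<gamma>) x = D c x - D d x"
  using has_sum_diff[OF D_has_sum[OF assms(1)] D_has_sum[OF assms(2)]]
  unfolding D_def[of "\<lambda>\<gamma>. c \<gamma> - d \<gamma>"] by (intro infsumI) (simp add: left_diff_distrib)

text \<open>The tail of the envelope depends on \<open>x\<close> only through its cell. So one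
  finite set works on finitely many cells, for all coefficient families at once, with an error
  proportional to their bound. This uniformity yields both the continuity of \<open>D c\<close> and
  its stability under coefficientwise limits.\<close>

lemma uniform_tail:
  assumes "finite Q" "0 < \<epsilon>"
  shows "\<exists>S. finite S \<and> S \<subseteq> \<Gamma> \<and> (\<forall>c K x. q x \<in> Q \<longrightarrow> (\<forall>\<gamma>\<in>\<Gamma>. norm (c \<gamma>) \<le> K) \<longrightarrow> 0 \<le> K \<longrightarrow>
    norm (D c x - (\<Sum>\<gamma>\<in>S. c \<gamma> * F \<gamma> x)) \<le> K * \<epsilon>)"
proof -
  have "\<exists>S. finite S \<and> S \<subseteq> \<Gamma> \<and> (\<Sum>\<^sub>\<infinity>\<gamma>\<in>\<Gamma> - S. \<theta> (k - q \<gamma>)) < \<epsilon>" for k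
    by (rule finite_subset_approx[OF \<theta>_cell_summable[of k] \<theta>_nonneg assms(2)]) blast
  then obtain S where S: "\<And>k. finite (S k)" "\<And>k. S k \<subseteq> \<Gamma>" "\<And>k. (\<Sum>\<^sub>\<infinity>\<gamma>\<in>\<Gamma> - S k. \<theta> (k - q \<gamma>)) < \<epsilon>" by metis
  define R where "R = (\<Union>k\<in>Q. S k)"
  have R: "finite R" "R \<subseteq> \<Gamma>" using assms(1) S by (auto simp: R_def)
  have "norm (D c x - (\<Sum>\<gamma>\<in>R. c \<gamma> * F \<gamma> x)) \<le> K * \<epsilon>"
    if x: "q x \<in> Q" and K: "\<forall>\<gamma>\<in>\<Gamma>. norm (c \<gamma>) \<le> K" "0 \<le> K" for c K x
  proof -
    have c: "norm (c \<gamma>) \<le> K" if "\<gamma> \<in> \<Gamma>" for \<gamma> using K that by blast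
    have "(\<lambda>\<gamma>. c \<gamma> * F \<gamma> x) summable_on \<Gamma>"
      by (rule has_sum_imp_summable[OF D_has_sum[where c = c and K = K]]) (rule c)
    then have sm: "(\<lambda>\<gamma>. c \<gamma> * F \<gamma> x) summable_on (\<Gamma> - R)" by (rule summable_on_subset_banach) auto
    have as: "(\<lambda>\<gamma>. norm (c \<gamma> * F \<gamma> x)) summable_on (\<Gamma> - R)"
      using abs_summable[OF c] by (rule summable_on_subset_banach) auto
    have "D c x = (\<Sum>\<^sub>\<infinity>\<gamma>\<in>R \<union> (\<Gamma> - R). c \<gamma> * F \<gamma> x)" using R(2) by (simp add: D_def Un_absorb1)
    also have "\<dots> = (\<Sum>\<gamma>\<in>R. c \<gamma> * F \<gamma> x) + (\<Sum>\<^sub>\<infinity>\<gamma>\<in>\<Gamma> - R. c \<gamma> * F \<gamma> x)"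
      using R(1) by (subst infsum_Un_disjoint) (auto intro: sm)
    finally have "norm (D c x - (\<Sum>\<gamma>\<in>R. c \<gamma> * F \<gamma> x)) = norm (\<Sum>\<^sub>\<infinity>\<gamma>\<in>\<Gamma> - R. c \<gamma> * F \<gamma> x)" by simp
    also have "\<dots> \<le> (\<Sum>\<^sub>\<infinity>\<gamma>\<in>\<Gamma> - R. norm (c \<gamma> * F \<gamma> x))" by (rule norm_infsum_bound[OF as])
    also have "\<dots> \<le> (\<Sum>\<^sub>\<infinity>\<gamma>\<in>\<Gamma> - S (q x). K * \<theta> (q x - q \<gamma>))"
    proof (rule infsum_mono_neutral[OF as])
      show "(\<lambda>\<gamma>. K * \<theta> (q x - q \<gamma>)) summable_on \<Gamma> - S (q x)"
        by (intro summable_on_cmult_right summable_on_subset_banach[OF \<theta>_cell_summable]) auto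
      show "0 \<le> K * \<theta> (q x - q \<gamma>)" for \<gamma> using K \<theta>_nonneg by simp
    qed (use x in \<open>auto simp: R_def intro: term_le c\<close>)
    also have "\<dots> = K * (\<Sum>\<^sub>\<infinity>\<gamma>\<in>\<Gamma> - S (q x). \<theta> (q x - q \<gamma>))" by (rule infsum_cmult_right')
    also have "\<dots> \<le> K * \<epsilon>" using S(3)[of "q x"] K by (intro mult_left_mono) auto
    finally show ?thesis .
  qed
  then show ?thesis using R by (intro exI[of _ R] conjI allI impI)
qed

lemma D_continuous:
  assumes "\<And>\<gamma>. \<gamma> \<in> \<Gamma> \<Longrightarrow> norm (c \<gamma>) \<le> K" "0 \<le> K"
  shows "continuous_on UNIV (D c)"
  unfolding continuous_on_iff
proof (intro ballI allI impI)
  fix x :: "real ^ 'd" and e :: real assume e: "0 < e"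
  define \<epsilon> where "\<epsilon> = e / (3 * (K + 1))"
  have \<epsilon>: "0 < \<epsilon>" "K * \<epsilon> < e / 3"
  proof -
    show "0 < \<epsilon>" using e assms(2) by (simp add: \<epsilon>_def)
    have "K * \<epsilon> = e / 3 * (K / (K + 1))" using assms(2) by (simp add: \<epsilon>_def field_simps)
    also have "\<dots> < e / 3 * 1" using e assms(2) by (intro mult_strict_left_mono) auto
    finally show "K * \<epsilon> < e / 3" by simp
  qed
  obtain S where S: "finite S" "S \<subseteq> \<Gamma>" and t: "\<forall>c K y. q y \<in> q ` ball x 1 \<longrightarrow> (\<forall>\<gamma>\<in>\<Gamma>. norm (c \<gamma>) \<le> K) \<longrightarrow> 0 \<le> K \<longrightarrow>
      norm (D c y - (\<Sum>\<gamma>\<in>S. c \<gamma> * F \<gamma> y)) \<le> K * \<epsilon>"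
    using uniform_tail[OF finite_cells_ball[OF s_pos, of x 1] \<epsilon>(1)] by (elim exE conjE) (rule that)
  have tail: "norm (D c y - (\<Sum>\<gamma>\<in>S. c \<gamma> * F \<gamma> y)) \<le> K * \<epsilon>" if "q y \<in> q ` ball x 1" for y
    by (rule t[rule_format, OF that assms])
  have "continuous_on UNIV (\<lambda>y. \<Sum>\<gamma>\<in>S. c \<gamma> * F \<gamma> y)"
    using S(2) by (intro continuous_on_sum continuous_on_mult continuous_on_const F_cont) auto
  then have "\<forall>e>0. \<exists>d>0. \<forall>y\<in>UNIV. dist y x < d \<longrightarrow> dist (\<Sum>\<gamma>\<in>S. c \<gamma> * F \<gamma> y) (\<Sum>\<gamma>\<in>S. c \<gamma> * F \<gamma> x) < e"
    unfolding continuous_on_iff by (rule bspec) simp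
  then have "\<exists>d>0. \<forall>y\<in>UNIV. dist y x < d \<longrightarrow> dist (\<Sum>\<gamma>\<in>S. c \<gamma> * F \<gamma> y) (\<Sum>\<gamma>\<in>S. c \<gamma> * F \<gamma> x) < e / 3"
    by (elim allE[of _ "e / 3"] impE) (use e in simp_all)
  then obtain d where d: "0 < d" "\<And>y. dist y x < d \<Longrightarrow> dist (\<Sum>\<gamma>\<in>S. c \<gamma> * F \<gamma> y) (\<Sum>\<gamma>\<in>S. c \<gamma> * F \<gamma> x) < e / 3"
    by blast
  have "dist (D c y) (D c x) < e" if y: "dist y x < min d 1" for y
  proof -
    have "q y \<in> q ` ball x 1" "q x \<in> q ` ball x 1" using y by (auto simp: dist_commute)
    then have t: "dist (D c y) (\<Sum>\<gamma>\<in>S. c \<gamma> * F \<gamma> y) < e / 3" "dist (D c x) (\<Sum>\<gamma>\<in>S. c \<gamma> * F \<gamma> x) < e / 3"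
      using tail[of y] tail[of x] \<epsilon>(2) by (simp_all add: dist_norm)
    have "dist (D c y) (D c x) \<le> dist (D c y) (\<Sum>\<gamma>\<in>S. c \<gamma> * F \<gamma> y)
       + dist (\<Sum>\<gamma>\<in>S. c \<gamma> * F \<gamma> y) (\<Sum>\<gamma>\<in>S. c \<gamma> * F \<gamma> x) + dist (D c x) (\<Sum>\<gamma>\<in>S. c \<gamma> * F \<gamma> x)"
      using dist_triangle[of "D c y" "D c x" "\<Sum>\<gamma>\<in>S. c \<gamma> * F \<gamma> y"]
        dist_triangle[of "\<Sum>\<gamma>\<in>S. c \<gamma> * F \<gamma> y" "D c x" "\<Sum>\<gamma>\<in>S. c \<gamma> * F \<gamma> x"]
      by (simp add: dist_commute)
    then show ?thesis using t d(2)[of y] y by simp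
  qed
  then show "\<exists>d>0. \<forall>x'\<in>UNIV. dist x' x < d \<longrightarrow> dist (D c x') (D c x) < e"
    using d(1) by (intro exI[of _ "min d 1"]) auto
qed

text \<open>Up to a uniform tail finitely many coefficients matter, and these converge. The
  evaluation point may move with \<open>n\<close> within finitely many cells, as the nodes will
  do.\<close>

lemma D_convergence:
  assumes c: "\<And>n \<gamma>. \<gamma> \<in> \<Gamma> \<Longrightarrow> norm (c n \<gamma>) \<le> K" and K: "0 \<le> K"
    and lim: "\<And>\<gamma>. \<gamma> \<in> \<Gamma> \<Longrightarrow> (\<lambda>n. c n \<gamma>) \<longlonglongrightarrow> c' \<gamma>" and Q: "finite Q" "\<And>n. q (x n) \<in> Q"
  shows "(\<lambda>n. D (c n) (x n) - D c' (x n)) \<longlonglongrightarrow> 0"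
proof (rule LIMSEQ_I)
  fix r :: real assume r: "0 < r"
  have c': "norm (c' \<gamma>) \<le> K" if "\<gamma> \<in> \<Gamma>" for \<gamma>
    by (rule tendsto_upperbound[OF tendsto_norm[OF lim[OF that]]]) (use c[OF that] in auto)
  define \<epsilon> where "\<epsilon> = r / (4 * (K + 1))"
  have \<epsilon>: "0 < \<epsilon>" "K * \<epsilon> \<le> r / 4"
  proof -
    show "0 < \<epsilon>" using r K by (simp add: \<epsilon>_def)
    have "K * \<epsilon> = r / 4 * (K / (K + 1))" using K by (simp add: \<epsilon>_def field_simps)
    also have "\<dots> \<le> r / 4 * 1" using r K by (intro mult_left_mono) auto
    finally show "K * \<epsilon> \<le> r / 4" by simp
  qed
  obtain S where S: "finite S" "S \<subseteq> \<Gamma>" and t: "\<forall>c K y. q y \<in> Q \<longrightarrow> (\<forall>\<gamma>\<in>\<Gamma>. norm (c \<gamma>) \<le> K) \<longrightarrow> 0 \<le> K \<longrightarrow>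
      norm (D c y - (\<Sum>\<gamma>\<in>S. c \<gamma> * F \<gamma> y)) \<le> K * \<epsilon>"
    using uniform_tail[OF Q(1) \<epsilon>(1)] by (elim exE conjE) (rule that)
  have tail: "norm (D c y - (\<Sum>\<gamma>\<in>S. c \<gamma> * F \<gamma> y)) \<le> r / 4" if "q y \<in> Q" "\<And>\<gamma>. \<gamma> \<in> \<Gamma> \<Longrightarrow> norm (c \<gamma>) \<le> K" for c y
    by (rule order_trans[OF t[rule_format, OF that K] \<epsilon>(2)])
  have "(\<lambda>n. \<Sum>\<gamma>\<in>S. norm (c n \<gamma> - c' \<gamma>) * S\<theta>) \<longlonglongrightarrow> (\<Sum>\<gamma>\<in>S. norm (c' \<gamma> - c' \<gamma>) * S\<theta>)"
    using S(2) by (intro tendsto_sum tendsto_mult tendsto_norm tendsto_diff lim tendsto_const) auto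
  then have "(\<lambda>n. \<Sum>\<gamma>\<in>S. norm (c n \<gamma> - c' \<gamma>) * S\<theta>) \<longlonglongrightarrow> 0" by simp
  then have "\<forall>\<^sub>F n in sequentially. (\<Sum>\<gamma>\<in>S. norm (c n \<gamma> - c' \<gamma>) * S\<theta>) < r / 4"
    using r by (intro order_tendstoD) auto
  then obtain n0 where n0: "\<And>n. n0 \<le> n \<Longrightarrow> (\<Sum>\<gamma>\<in>S. norm (c n \<gamma> - c' \<gamma>) * S\<theta>) < r / 4"
    by (auto simp: eventually_sequentially)
  have "norm (D (c n) (x n) - D c' (x n) - 0) < r" if n: "n0 \<le> n" for n
  proof -
    have "norm ((\<Sum>\<gamma>\<in>S. c n \<gamma> * F \<gamma> (x n)) - (\<Sum>\<gamma>\<in>S. c' \<gamma> * F \<gamma> (x n))) \<le> (\<Sum>\<gamma>\<in>S. norm (c n \<gamma> - c' \<gamma>) * S\<theta>)"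
      unfolding sum_subtractf[symmetric] left_diff_distrib[symmetric]
      using S(2) by (intro sum_norm_le) (auto simp: norm_mult intro!: mult_left_mono order_trans[OF F_le \<theta>_le])
    then have "norm ((\<Sum>\<gamma>\<in>S. c n \<gamma> * F \<gamma> (x n)) - (\<Sum>\<gamma>\<in>S. c' \<gamma> * F \<gamma> (x n))) < r / 4" using n0[OF n] by linarith
    moreover have "norm (D (c n) (x n) - (\<Sum>\<gamma>\<in>S. c n \<gamma> * F \<gamma> (x n))) \<le> r / 4"
      by (rule tail[OF Q(2) c])
    moreover have "norm (D c' (x n) - (\<Sum>\<gamma>\<in>S. c' \<gamma> * F \<gamma> (x n))) \<le> r / 4"
      by (rule tail[OF Q(2) c'])
    moreover have "norm (D (c n) (x n) - D c' (x n)) \<le> norm (D (c n) (x n) - (\<Sum>\<gamma>\<in>S. c n \<gamma> * F \<gamma> (x n)))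
        + norm ((\<Sum>\<gamma>\<in>S. c n \<gamma> * F \<gamma> (x n)) - (\<Sum>\<gamma>\<in>S. c' \<gamma> * F \<gamma> (x n))) + norm (D c' (x n) - (\<Sum>\<gamma>\<in>S. c' \<gamma> * F \<gamma> (x n)))"
      using norm_triangle_ineq4[of "D (c n) (x n) - (\<Sum>\<gamma>\<in>S. c n \<gamma> * F \<gamma> (x n)) + ((\<Sum>\<gamma>\<in>S. c n \<gamma> * F \<gamma> (x n)) - (\<Sum>\<gamma>\<in>S. c' \<gamma> * F \<gamma> (x n)))" "D c' (x n) - (\<Sum>\<gamma>\<in>S. c' \<gamma> * F \<gamma> (x n))"]
        norm_triangle_ineq[of "D (c n) (x n) - (\<Sum>\<gamma>\<in>S. c n \<gamma> * F \<gamma> (x n))" "(\<Sum>\<gamma>\<in>S. c n \<gamma> * F \<gamma> (x n)) - (\<Sum>\<gamma>\<in>S. c' \<gamma> * F \<gamma> (x n))"]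
      by simp
    ultimately show ?thesis using r by simp
  qed
  then show "\<exists>no. \<forall>n\<ge>no. norm (D (c n) (x n) - D c' (x n) - 0) < r" by blast
qed

end

lemma continuous_measurable_lebesgue:
  fixes f :: "'a::euclidean_space \<Rightarrow> 'b::topological_space"
  assumes "continuous_on UNIV f"
  shows "f \<in> borel_measurable lebesgue"
proof -
  have "f \<in> borel_measurable lborel" using borel_measurable_continuous_onI[OF assms] by simp
  then show ?thesis by (rule measurable_completion)
qed

section \<open>Integrals over cells and the Gram matrix of the family\<close>

context localized_family begin

definition v where "v = s ^ CARD('d)"

lemma v_pos: "0 < v" using s_pos by (simp add: v_def)

lemma cell_measurable: "{x. q x = k} \<in> sets lebesgue"
  using cell_borel[of s k] by (auto simp: sets_completionI_sets)

lemma step_measurable: "(\<lambda>x. h (q x)) \<in> borel_measurable lebesgue"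
proof -
  have "q \<in> measurable lebesgue (count_space UNIV)"
    by (subst measurable_count_space_eq_countable) (auto simp: vimage_def cell_measurable)
  then show ?thesis by (rule measurable_compose) simp
qed

lemma nn_integral_step:
  fixes h :: "int ^ 'd \<Rightarrow> real"
  assumes "h summable_on UNIV" "\<And>k. 0 \<le> h k"
  shows "(\<integral>\<^sup>+ x. ennreal (h (q x)) \<partial>lebesgue) = ennreal (v * (\<Sum>\<^sub>\<infinity>k. h k))"
proof -
  have "(\<lambda>k. norm (h k)) summable_on UNIV" using assms by simp
  then have abs': "Infinite_Set_Sum.abs_summable_on h UNIV" by (rule abs_summable_equivalent[THEN iffD1])
  have "(\<integral>\<^sup>+ x. ennreal (h (q x)) \<partial>lebesgue) = (\<integral>\<^sup>+ x. \<integral>\<^sup>+ k. ennreal (h k) * indicator {x. q x = k} x \<partial>count_space UNIV \<partial>lebesgue)"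
  proof (rule nn_integral_cong)
    fix x
    have "(\<integral>\<^sup>+ k. ennreal (h k) * indicator {x. q x = k} x \<partial>count_space UNIV) = (\<integral>\<^sup>+ k. ennreal (h k) * indicator {q x} k \<partial>count_space UNIV)"
      by (intro nn_integral_cong) (auto simp: indicator_def)
    then show "ennreal (h (q x)) = (\<integral>\<^sup>+ k. ennreal (h k) * indicator {x. q x = k} x \<partial>count_space UNIV)"
      by (simp add: nn_integral_indicator_singleton)
  qed
  also have "\<dots> = (\<integral>\<^sup>+ k. \<integral>\<^sup>+ x. ennreal (h k) * indicator {x. q x = k} x \<partial>lebesgue \<partial>count_space UNIV)"
    by (intro nn_integral_count_space_nn_integral borel_measurable_times_ennreal borel_measurable_const
        borel_measurable_indicator cell_measurable countableI_type)
  also have "\<dots> = (\<integral>\<^sup>+ k. ennreal (h k) * ennreal v \<partial>count_space UNIV)"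
    by (intro nn_integral_cong) (simp add: nn_integral_cmult_indicator[OF cell_measurable] emeasure_cell[OF s_pos] v_def)
  also have "\<dots> = (\<integral>\<^sup>+ k. ennreal (h k) \<partial>count_space UNIV) * ennreal v"
    by (rule nn_integral_multc) simp
  also have "(\<integral>\<^sup>+ k. ennreal (h k) \<partial>count_space UNIV) = ennreal (\<Sum>\<^sub>\<infinity>k. h k)"
    using nn_integral_conv_infsetsum[OF abs'] assms(2) infsetsum_infsum[OF abs'] by simp
  finally show ?thesis
    using v_pos assms(2) by (simp add: ennreal_mult[symmetric] infsum_nonneg mult.commute)
qed

lemma step_integral:
  fixes h :: "int ^ 'd \<Rightarrow> real"
  assumes "h summable_on UNIV" "\<And>k. 0 \<le> h k"
  shows "integrable lebesgue (\<lambda>x. h (q x))" "(LINT x|lebesgue. h (q x)) = v * (\<Sum>\<^sub>\<infinity>k. h k)"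
proof -
  show int: "integrable lebesgue (\<lambda>x. h (q x))"
    using nn_integral_step[OF assms] assms(2) by (intro integrableI_nonneg step_measurable) auto
  have "ennreal (LINT x|lebesgue. h (q x)) = ennreal (v * (\<Sum>\<^sub>\<infinity>k. h k))"
    using nn_integral_eq_integral[OF int] nn_integral_step[OF assms] assms(2) by simp
  then show "(LINT x|lebesgue. h (q x)) = v * (\<Sum>\<^sub>\<infinity>k. h k)"
    using assms(2) v_pos by (subst (asm) ennreal_inj) (auto intro!: infsum_nonneg mult_nonneg_nonneg integral_nonneg)
qed

lemma bij_shift: "bij_betw (\<lambda>k :: int ^ 'd. k + b) UNIV UNIV"
  by (rule bij_betw_byWitness[of _ "\<lambda>k. k - b"]) auto

lemma has_sum_shift:
  fixes h :: "int ^ 'd \<Rightarrow> real"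
  shows "((\<lambda>k. h (k + b)) has_sum x) UNIV \<longleftrightarrow> (h has_sum x) UNIV"
  using has_sum_reindex_bij_betw[OF bij_shift[of b], of h x] by simp

lemma \<theta>_shift: "((\<lambda>k. \<theta> (k - b)) has_sum S\<theta>) UNIV"
  using has_sum_shift[of \<theta> "- b" S\<theta>] has_sum_infsum[OF \<theta>_summable] by (simp add: S\<theta>_def)

lemma F_measurable: "\<gamma> \<in> \<Gamma> \<Longrightarrow> F \<gamma> \<in> borel_measurable lebesgue"
  by (rule continuous_measurable_lebesgue[OF F_cont])

lemma envelope_integral:
  "integrable lebesgue (\<lambda>x. \<theta> (q x - b))" "(LINT x|lebesgue. \<theta> (q x - b)) = v * S\<theta>"
  using step_integral[of "\<lambda>k. \<theta> (k - b)", OF has_sum_imp_summable[OF \<theta>_shift] \<theta>_nonneg] infsumI[OF \<theta>_shift] by auto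

lemma F_integrable:
  assumes "\<gamma> \<in> \<Gamma>"
  shows "integrable lebesgue (F \<gamma>)"
  by (rule Bochner_Integration.integrable_bound[OF envelope_integral(1)[of "q \<gamma>"] F_measurable[OF assms]])
    (use F_le[OF assms] \<theta>_nonneg in auto)

lemma F_integral_le:
  assumes "\<gamma> \<in> \<Gamma>"
  shows "(LINT x|lebesgue. norm (F \<gamma> x)) \<le> v * S\<theta>"
  unfolding envelope_integral(2)[of "q \<gamma>", symmetric]
  by (rule integral_mono[OF integrable_norm[OF F_integrable[OF assms]] envelope_integral(1)]) (rule F_le[OF assms])

lemma integrable_mult_F:
  assumes "f \<in> borel_measurable lebesgue" "\<And>x. norm (f x) \<le> K" "\<gamma> \<in> \<Gamma>"
  shows "integrable lebesgue (\<lambda>x. f x * cnj (F \<gamma> x))"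
proof (rule Bochner_Integration.integrable_bound)
  show "integrable lebesgue (\<lambda>x. K * norm (F \<gamma> x))" using F_integrable[OF assms(3)] by simp
  show "(\<lambda>x. f x * cnj (F \<gamma> x)) \<in> borel_measurable lebesgue"
    by (intro borel_measurable_times assms(1) continuous_measurable_lebesgue continuous_on_cnj F_cont assms(3))
  show "AE x in lebesgue. norm (f x * cnj (F \<gamma> x)) \<le> norm (K * norm (F \<gamma> x))"
    using assms(2) order_trans[OF norm_ge_zero assms(2)] by (intro always_eventually) (auto simp: norm_mult intro!: mult_right_mono)
qed

lemma L2_inner_F_le:
  assumes "f \<in> borel_measurable lebesgue" "\<And>x. norm (f x) \<le> K" "\<gamma> \<in> \<Gamma>"
  shows "norm (L2_inner f (F \<gamma>)) \<le> K * (v * S\<theta>)"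
proof -
  have K: "0 \<le> K" by (rule order_trans[OF norm_ge_zero assms(2)])
  have "norm (L2_inner f (F \<gamma>)) \<le> (LINT x|lebesgue. norm (f x * cnj (F \<gamma> x)))"
    unfolding L2_inner_def by (rule integral_norm_bound)
  also have "\<dots> \<le> (LINT x|lebesgue. K * norm (F \<gamma> x))"
    using integrable_norm[OF integrable_mult_F[OF assms]] F_integrable[OF assms(3)]
    by (intro integral_mono) (auto simp: norm_mult intro!: mult_right_mono assms(2))
  also have "\<dots> = K * (LINT x|lebesgue. norm (F \<gamma> x))" by simp
  also have "\<dots> \<le> K * (v * S\<theta>)" by (rule mult_left_mono[OF F_integral_le[OF assms(3)] K])
  finally show ?thesis .
qed

text \<open>The autocorrelation of the envelope times the volume of a cell, that is the integral of
  the product of two envelopes whose centres differ by \<open>m\<close> cells.\<close>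

definition \<Xi> where "\<Xi> m = v * (\<Sum>\<^sub>\<infinity>k. \<theta> (k + m) * \<theta> k)"

lemma \<theta>_product_summable: "(\<lambda>k. \<theta> (k + m) * \<theta> k) summable_on UNIV"
  by (rule summable_on_bound_real[OF summable_on_cmult_right[OF \<theta>_summable, of S\<theta>]])
    (auto simp: \<theta>_nonneg intro!: mult_right_mono \<theta>_le)

lemma \<Xi>_nonneg: "0 \<le> \<Xi> m"
  using v_pos by (simp add: \<Xi>_def infsum_nonneg \<theta>_nonneg)

lemma \<Xi>_summable: "\<Xi> summable_on UNIV"
proof (rule nonneg_bdd_above_summable_on)
  have "(\<Sum>m\<in>M. \<Xi> m) \<le> v * (S\<theta> * S\<theta>)" if M: "finite M" for M
  proof -
    have hs: "((\<lambda>k. \<Sum>m\<in>M. \<theta> (k + m) * \<theta> k) has_sum (\<Sum>m\<in>M. \<Sum>\<^sub>\<infinity>k. \<theta> (k + m) * \<theta> k)) UNIV"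
      by (rule has_sum_sum[OF M has_sum_infsum[OF \<theta>_product_summable]])
    have "(\<Sum>m\<in>M. \<Sum>\<^sub>\<infinity>k. \<theta> (k + m) * \<theta> k) \<le> S\<theta> * S\<theta>"
    proof (rule has_sum_mono[OF hs])
      show "((\<lambda>k. S\<theta> * \<theta> k) has_sum (S\<theta> * S\<theta>)) UNIV"
        using has_sum_cmult_right[OF has_sum_infsum[OF \<theta>_summable], of S\<theta>] by (simp add: S\<theta>_def)
      fix k
      have inj: "inj_on (\<lambda>m. k + m) M" by (simp add: inj_on_def)
      have "(\<Sum>m\<in>M. \<theta> (k + m)) = (\<Sum>m\<in>(\<lambda>m. k + m) ` M. \<theta> m)" by (simp add: sum.reindex[OF inj])
      also have "\<dots> \<le> S\<theta>" unfolding S\<theta>_def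
        using M by (intro finite_sum_le_infsum \<theta>_summable) (auto simp: \<theta>_nonneg)
      finally show "(\<Sum>m\<in>M. \<theta> (k + m) * \<theta> k) \<le> S\<theta> * \<theta> k"
        unfolding sum_distrib_right[symmetric] by (intro mult_right_mono \<theta>_nonneg)
    qed
    then show ?thesis using v_pos by (simp add: \<Xi>_def sum_distrib_left[symmetric])
  qed
  then show "bdd_above (sum \<Xi> ` {F. F \<subseteq> UNIV \<and> finite F})" by (intro bdd_aboveI2) auto
qed (rule \<Xi>_nonneg)

text \<open>The order of the arguments makes the matrix analysis after synthesis: applied to
  \<open>c\<close> it returns the inner products of \<open>D c\<close> with the family. The value
  zero outside \<Gamma> lets the domination hold for all indices.\<close>

definition gram where "gram \<gamma> \<gamma>' = (if \<gamma> \<in> \<Gamma> \<and> \<gamma>' \<in> \<Gamma> then L2_inner (F \<gamma>') (F \<gamma>) else 0)"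

lemma gram_le: "norm (gram \<gamma> \<gamma>') \<le> \<Xi> (q \<gamma> - q \<gamma>')"
proof (cases "\<gamma> \<in> \<Gamma> \<and> \<gamma>' \<in> \<Gamma>")
  case True
  then have g: "\<gamma> \<in> \<Gamma>" "\<gamma>' \<in> \<Gamma>" by auto
  let ?h = "\<lambda>k. \<theta> (k - q \<gamma>') * \<theta> (k - q \<gamma>)"
  have "((\<lambda>k. \<theta> (k + (q \<gamma> - q \<gamma>')) * \<theta> k) has_sum (\<Sum>\<^sub>\<infinity>k. \<theta> (k + (q \<gamma> - q \<gamma>')) * \<theta> k)) UNIV"
    by (rule has_sum_infsum[OF \<theta>_product_summable])
  then have hs: "(?h has_sum (\<Sum>\<^sub>\<infinity>k. \<theta> (k + (q \<gamma> - q \<gamma>')) * \<theta> k)) UNIV"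
    using has_sum_shift[of ?h "q \<gamma>" "\<Sum>\<^sub>\<infinity>k. \<theta> (k + (q \<gamma> - q \<gamma>')) * \<theta> k"] by (simp add: add_diff_eq)
  have le: "norm (F \<gamma>' x * cnj (F \<gamma> x)) \<le> ?h (q x)" for x
    by (simp add: norm_mult mult_mono F_le g \<theta>_nonneg)
  have si: "integrable lebesgue (\<lambda>x. ?h (q x))" "(LINT x|lebesgue. ?h (q x)) = \<Xi> (q \<gamma> - q \<gamma>')"
    using step_integral[of ?h, OF has_sum_imp_summable[OF hs]] infsumI[OF hs] by (auto simp: \<theta>_nonneg \<Xi>_def)
  have "norm (gram \<gamma> \<gamma>') \<le> (LINT x|lebesgue. norm (F \<gamma>' x * cnj (F \<gamma> x)))"
    using True unfolding gram_def L2_inner_def by (simp add: integral_norm_bound del: norm_mult)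
  also have "\<dots> \<le> (LINT x|lebesgue. ?h (q x))"
    using si(1) by (rule integral_mono'[OF _ le]) (simp add: \<theta>_nonneg)
  finally show ?thesis by (simp add: si(2))
qed (auto simp: gram_def \<Xi>_nonneg)

lemma L2_inner_commute: "L2_inner f g = cnj (L2_inner g f)" for f g :: "real ^ 'd \<Rightarrow> complex"
  unfolding L2_inner_def Bochner_Integration.integral_cnj[symmetric] by (simp add: mult.commute)

lemma gram_hermitian: "gram \<gamma>' \<gamma> = cnj (gram \<gamma> \<gamma>')"
  unfolding gram_def by (cases "\<gamma> \<in> \<Gamma> \<and> \<gamma>' \<in> \<Gamma>") (auto intro: L2_inner_commute)

lemma D_bounded_measurable:
  assumes "\<And>\<gamma>. \<gamma> \<in> \<Gamma> \<Longrightarrow> norm (c \<gamma>) \<le> K" "0 \<le> K"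
  shows "D c \<in> borel_measurable lebesgue"
  by (rule continuous_measurable_lebesgue[OF D_continuous[OF assms]])

sublocale cd: convolution_dominated \<Gamma> q N gram \<Xi>
  by unfold_locales (use cell_fin cell_card gram_le \<Xi>_nonneg \<Xi>_summable in auto)

lemma finite_support_bounded:
  assumes "finite {\<gamma>. c \<gamma> \<noteq> (0 :: complex)}"
  shows "\<exists>K\<ge>0. \<forall>\<gamma>. norm (c \<gamma>) \<le> K"
proof (intro exI conjI allI)
  show "0 \<le> (\<Sum>\<gamma> | c \<gamma> \<noteq> 0. norm (c \<gamma>))" by (simp add: sum_nonneg)
  show "norm (c \<gamma>) \<le> (\<Sum>\<gamma> | c \<gamma> \<noteq> 0. norm (c \<gamma>))" for \<gamma>
    by (cases "c \<gamma> = 0") (use assms in \<open>auto simp: sum_nonneg intro!: member_le_sum\<close>)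
qed

lemma finite_support_ell1:
  assumes "finite {\<gamma>. c \<gamma> \<noteq> 0}"
  shows "c \<in> ell1 \<Gamma>"
proof -
  have "(\<lambda>\<gamma>. norm (c \<gamma>)) summable_on ({\<gamma>. c \<gamma> \<noteq> 0} \<inter> \<Gamma>)" using assms by simp
  then show ?thesis unfolding ell1_def mem_Collect_eq
    by (rule summable_on_cong_neutral[THEN iffD1, rotated -1]) auto
qed

lemma D_support:
  assumes "finite {\<gamma>. c \<gamma> \<noteq> 0}" "{\<gamma>. c \<gamma> \<noteq> 0} \<subseteq> \<Gamma>"
  shows "D c x = (\<Sum>\<gamma> | c \<gamma> \<noteq> 0. c \<gamma> * F \<gamma> x)"
  by (rule D_finite[OF assms]) auto

lemma gram_apply:
  assumes c: "finite {\<gamma>. c \<gamma> \<noteq> 0}" "{\<gamma>. c \<gamma> \<noteq> 0} \<subseteq> \<Gamma>" and \<gamma>: "\<gamma> \<in> \<Gamma>"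
  shows "mat_app \<Gamma> gram c \<gamma> = L2_inner (D c) (F \<gamma>)"
proof -
  let ?S = "{\<gamma>. c \<gamma> \<noteq> 0}"
  have "mat_app \<Gamma> gram c \<gamma> = infsum (\<lambda>\<gamma>'. gram \<gamma> \<gamma>' * c \<gamma>') ?S"
    unfolding mat_app_def using c(2) by (intro infsum_cong_neutral) auto
  also have "\<dots> = (\<Sum>\<gamma>'\<in>?S. gram \<gamma> \<gamma>' * c \<gamma>')" using c(1) by simp
  also have "\<dots> = (\<Sum>\<gamma>'\<in>?S. (LINT x|lebesgue. c \<gamma>' * (F \<gamma>' x * cnj (F \<gamma> x))))"
    using c(2) \<gamma> by (intro sum.cong) (auto simp: gram_def L2_inner_def)
  also have "\<dots> = (LINT x|lebesgue. (\<Sum>\<gamma>'\<in>?S. c \<gamma>' * (F \<gamma>' x * cnj (F \<gamma> x))))"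
  proof (rule Bochner_Integration.integral_sum[symmetric])
    fix \<gamma>' assume "\<gamma>' \<in> ?S"
    then have "\<gamma>' \<in> \<Gamma>" using c(2) by auto
    then show "integrable lebesgue (\<lambda>x. c \<gamma>' * (F \<gamma>' x * cnj (F \<gamma> x)))"
      by (intro integrable_mult_right integrable_mult_F[OF F_measurable _ \<gamma>, of _ S\<theta>] order_trans[OF F_le \<theta>_le])
  qed
  also have "\<dots> = L2_inner (D c) (F \<gamma>)"
    unfolding L2_inner_def by (simp add: D_support[OF c] sum_distrib_right mult.assoc)
  finally show ?thesis .
qed

text \<open>Together with \<open>gram_apply\<close> this is the dictionary between matrix and
  functions: the form is the squared norm of \<open>D c\<close>, the image vector consists of its
  frame coefficients.\<close>

lemma gram_form:
  assumes c: "finite {\<gamma>. c \<gamma> \<noteq> 0}" "{\<gamma>. c \<gamma> \<noteq> 0} \<subseteq> \<Gamma>"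
  shows "Re (ell2_inner \<Gamma> (mat_app \<Gamma> gram c) c) = (LINT x|lebesgue. (norm (D c x))\<^sup>2)"
proof -
  let ?S = "{\<gamma>. c \<gamma> \<noteq> 0}"
  obtain K where K: "0 \<le> K" "\<And>\<gamma>. norm (c \<gamma>) \<le> K" using finite_support_bounded[OF c(1)] by blast
  have m: "D c \<in> borel_measurable lebesgue" by (rule D_bounded_measurable[OF K(2,1)])
  have "ell2_inner \<Gamma> (mat_app \<Gamma> gram c) c = infsum (\<lambda>\<gamma>. mat_app \<Gamma> gram c \<gamma> * cnj (c \<gamma>)) ?S"
    unfolding ell2_inner_def using c(2) by (intro infsum_cong_neutral) auto
  also have "\<dots> = (\<Sum>\<gamma>\<in>?S. (LINT x|lebesgue. cnj (c \<gamma>) * (D c x * cnj (F \<gamma> x))))"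
    using c by (simp add: subset_iff gram_apply L2_inner_def mult.commute[of _ "cnj _"])
  also have "\<dots> = (LINT x|lebesgue. (\<Sum>\<gamma>\<in>?S. cnj (c \<gamma>) * (D c x * cnj (F \<gamma> x))))"
    using c(2) by (intro Bochner_Integration.integral_sum[symmetric] integrable_mult_right integrable_mult_F[OF m D_le[OF K(2,1)]]) auto
  also have "\<dots> = (LINT x|lebesgue. complex_of_real ((norm (D c x))\<^sup>2))"
  proof (rule Bochner_Integration.integral_cong[OF refl])
    fix x
    have "(\<Sum>\<gamma>\<in>?S. cnj (c \<gamma>) * (D c x * cnj (F \<gamma> x))) = D c x * cnj (\<Sum>\<gamma>\<in>?S. c \<gamma> * F \<gamma> x)"
      by (simp add: sum_distrib_left mult_ac)
    also have "\<dots> = D c x * cnj (D c x)" by (simp add: D_support[OF c])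
    finally show "(\<Sum>\<gamma>\<in>?S. cnj (c \<gamma>) * (D c x * cnj (F \<gamma> x))) = complex_of_real ((norm (D c x))\<^sup>2)"
      by (simp only: complex_norm_square)
  qed
  also have "\<dots> = complex_of_real (LINT x|lebesgue. (norm (D c x))\<^sup>2)" by (rule integral_complex_of_real)
  finally show ?thesis by simp
qed

end

section \<open>Sup norms of continuous functions, and limits along nets and sequences\<close>

lemma Linf_norm_le:
  assumes "f \<in> borel_measurable lebesgue" "\<And>x. norm (f x) \<le> K"
  shows "Linf_norm f \<le> ennreal K"
  unfolding Linf_norm_on_def
proof (rule esssup_I)
  show "(\<lambda>x. ennreal (norm (f x))) \<in> borel_measurable (restrict_space lebesgue UNIV)"
    using assms(1) by (intro measurable_restrict_space1) simp
  show "AE x in restrict_space lebesgue UNIV. ennreal (norm (f x)) \<le> ennreal K"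
    by (intro always_eventually allI ennreal_leI assms(2))
qed

lemma continuous_le_Linf_norm:
  fixes f :: "'a::euclidean_space \<Rightarrow> complex"
  assumes "continuous_on UNIV f"
  shows "ennreal (norm (f x)) \<le> Linf_norm f"
proof (rule ccontr)
  assume "\<not> ?thesis"
  then have lt: "Linf_norm f < ennreal (norm (f x))" by simp
  have "open {z. Linf_norm f < ennreal (norm (f z))}"
    by (intro open_Collect_less continuous_on_ennreal continuous_on_norm assms continuous_on_const)
  moreover have "x \<in> {z. Linf_norm f < ennreal (norm (f z))}" using lt by simp
  moreover have "AE y in lebesgue. y \<in> UNIV \<longrightarrow> ennreal (norm (f y)) \<le> Linf_norm f"
    unfolding Linf_norm_on_def
    using esssup_AE[where M = "restrict_space lebesgue (UNIV :: 'a set)" and f = "\<lambda>x. ennreal (norm (f x))"]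
    by (subst (asm) AE_restrict_space_iff) auto
  ultimately obtain y where "y \<in> {z. Linf_norm f < ennreal (norm (f z))}" "ennreal (norm (f y)) \<le> Linf_norm f"
    using AE_open_ex by blast
  then show False by simp
qed

text \<open>By Fatou the pointwise limit has integral zero, so it vanishes almost everywhere, and
  continuity upgrades this to every point. It serves to identify a limit in norm with a pointwise
  limit.\<close>

lemma continuous_limit_eq_zero:
  fixes h :: "'a::euclidean_space \<Rightarrow> real"
  assumes h: "continuous_on UNIV h" "\<And>x. 0 \<le> h x"
    and hn: "\<And>n. integrable lebesgue (hn n)" "\<And>n x. 0 \<le> hn n x" "\<And>x. (\<lambda>n. hn n x) \<longlonglongrightarrow> h x"
    and lim: "(\<lambda>n. LINT x|lebesgue. hn n x) \<longlonglongrightarrow> 0"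
  shows "h x = 0"
proof (rule ccontr)
  assume "h x \<noteq> 0"
  have "(\<integral>\<^sup>+ x. ennreal (h x) \<partial>lebesgue) = (\<integral>\<^sup>+ x. liminf (\<lambda>n. ennreal (hn n x)) \<partial>lebesgue)"
    by (intro nn_integral_cong lim_imp_Liminf[symmetric] tendsto_ennrealI hn(3)) simp
  also have "\<dots> \<le> liminf (\<lambda>n. \<integral>\<^sup>+ x. ennreal (hn n x) \<partial>lebesgue)"
    using hn(1) by (intro nn_integral_liminf) (auto dest: borel_measurable_integrable)
  also have "\<dots> = liminf (\<lambda>n. ennreal (LINT x|lebesgue. hn n x))"
    by (simp add: nn_integral_eq_integral[OF hn(1)] hn(2))
  also have "\<dots> = ennreal 0" by (intro lim_imp_Liminf tendsto_ennrealI lim) simp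
  finally have "(\<integral>\<^sup>+ x. ennreal (h x) \<partial>lebesgue) = 0" by simp
  then have ae: "AE x in lebesgue. h x \<le> 0"
    using continuous_measurable_lebesgue[OF h(1)] by (subst (asm) nn_integral_0_iff_AE) (auto simp: ennreal_eq_0_iff)
  have "open {x. 0 < h x}" by (intro open_Collect_less continuous_on_const h(1))
  moreover have "x \<in> {x. 0 < h x}" using h(2)[of x] \<open>h x \<noteq> 0\<close> by simp
  ultimately have "\<exists>y\<in>{x. 0 < h x}. h y \<le> 0" using AE_open_ex[OF ae] by blast
  then show False by auto
qed

text \<open>Limit theorems for integrals concern sequences, while unconditional convergence is along
  the net of finite subsets; a sequence that eventually contains each finite set mediates between
  them.\<close>

lemma countable_exhaustion:
  assumes "countable \<Gamma>"
  shows "\<exists>X. (\<forall>n::nat. finite (X n) \<and> X n \<subseteq> \<Gamma>) \<and> filterlim X (finite_subsets_at_top \<Gamma>) sequentially"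
proof -
  define X where "X n = {\<gamma>\<in>\<Gamma>. to_nat_on \<Gamma> \<gamma> < n}" for n
  have "finite (X n)" for n
  proof (rule inj_on_finite)
    show "inj_on (to_nat_on \<Gamma>) (X n)" using assms by (auto simp: X_def inj_on_def)
    show "to_nat_on \<Gamma> ` X n \<subseteq> {..<n}" by (auto simp: X_def)
  qed simp
  moreover have "filterlim X (finite_subsets_at_top \<Gamma>) sequentially"
    unfolding filterlim_finite_subsets_at_top
  proof (intro allI impI)
    fix Y assume Y: "finite Y \<and> Y \<subseteq> \<Gamma>"
    have "Y \<subseteq> X n" if "Suc (\<Sum>\<gamma>\<in>Y. to_nat_on \<Gamma> \<gamma>) \<le> n" for n
    proof
      fix \<gamma> assume g: "\<gamma> \<in> Y"
      then have "to_nat_on \<Gamma> \<gamma> \<le> (\<Sum>\<gamma>\<in>Y. to_nat_on \<Gamma> \<gamma>)" using Y by (intro member_le_sum) auto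
      then show "\<gamma> \<in> X n" using that g Y by (auto simp: X_def)
    qed
    then show "\<forall>\<^sub>F n in sequentially. finite (X n) \<and> Y \<subseteq> X n \<and> X n \<subseteq> \<Gamma>"
      using \<open>\<And>n. finite (X n)\<close> unfolding eventually_sequentially
      by (intro exI[of _ "Suc (\<Sum>\<gamma>\<in>Y. to_nat_on \<Gamma> \<gamma>)"]) (auto simp: X_def)
  qed
  ultimately show ?thesis by (intro exI[of _ X]) (auto simp: X_def)
qed

section \<open>Bounded coefficients and \<open>Vinf\<close>, summable coefficients and
  \<open>Vp 1\<close>\<close>

context localized_family begin

lemma sum_F_le:
  assumes "\<And>\<gamma>. \<gamma> \<in> \<Gamma> \<Longrightarrow> norm (c \<gamma>) \<le> K" "0 \<le> K" "finite S" "S \<subseteq> \<Gamma>"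
  shows "(\<Sum>\<gamma>\<in>S. norm (c \<gamma> * F \<gamma> x)) \<le> K * (real N * S\<theta>)"
proof -
  have "(\<Sum>\<gamma>\<in>S. norm (c \<gamma> * F \<gamma> x)) \<le> (\<Sum>\<gamma>\<in>S. K * \<theta> (q x - q \<gamma>))"
    using assms(4) by (intro sum_mono term_le assms(1)) auto
  also have "\<dots> \<le> K * (real N * S\<theta>)"
    unfolding sum_distrib_left[symmetric] by (intro mult_left_mono sum_\<theta>_le assms)
  finally show ?thesis .
qed

text \<open>The terms integrated against \<open>g\<close> are absolutely summable, so the net has a
  limit; dominated convergence along one exhausting sequence identifies it.\<close>

lemma D_weak_star:
  assumes c: "\<And>\<gamma>. \<gamma> \<in> \<Gamma> \<Longrightarrow> norm (c \<gamma>) \<le> K" and K: "0 \<le> K"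
    and g: "integrable lebesgue g"
  shows "((\<lambda>S. LINT x|lebesgue. (\<Sum>\<gamma>\<in>S. c \<gamma> * F \<gamma> x) * g x) \<longlongrightarrow> (LINT x|lebesgue. D c x * g x))
     (finite_subsets_at_top \<Gamma>)"
proof -
  define t where "t \<gamma> = (LINT x|lebesgue. c \<gamma> * F \<gamma> x * g x)" for \<gamma>
  let ?B = "K * (real N * S\<theta>)"
  have gm: "g \<in> borel_measurable lebesgue" using g by (rule borel_measurable_integrable)
  have int: "integrable lebesgue (\<lambda>x. c \<gamma> * F \<gamma> x * g x)" if "\<gamma> \<in> \<Gamma>" for \<gamma>
  proof (rule Bochner_Integration.integrable_bound)
    show "integrable lebesgue (\<lambda>x. K * S\<theta> * norm (g x))" using g by simp
    show "(\<lambda>x. c \<gamma> * F \<gamma> x * g x) \<in> borel_measurable lebesgue"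
      by (intro borel_measurable_times borel_measurable_const F_measurable gm that)
    have "norm (c \<gamma> * F \<gamma> x) \<le> K * S\<theta>" for x
      by (rule order_trans[OF term_le[where K = K] mult_left_mono[OF \<theta>_le]]) (auto intro: c that K)
    then show "AE x in lebesgue. norm (c \<gamma> * F \<gamma> x * g x) \<le> norm (K * S\<theta> * norm (g x))"
      using K S\<theta>_nonneg by (intro always_eventually allI) (simp add: norm_mult[of _ "g _"] mult_right_mono)
  qed
  have sum_t: "(\<Sum>\<gamma>\<in>S. t \<gamma>) = (LINT x|lebesgue. (\<Sum>\<gamma>\<in>S. c \<gamma> * F \<gamma> x) * g x)" if "S \<subseteq> \<Gamma>" for S
    unfolding t_def sum_distrib_right using that by (intro Bochner_Integration.integral_sum[symmetric] int) auto
  have "(\<Sum>\<gamma>\<in>S. norm (t \<gamma>)) \<le> ?B * (LINT x|lebesgue. norm (g x))" if S: "finite S" "S \<subseteq> \<Gamma>" for S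
  proof -
    have "(\<Sum>\<gamma>\<in>S. norm (t \<gamma>)) \<le> (\<Sum>\<gamma>\<in>S. (LINT x|lebesgue. norm (c \<gamma> * F \<gamma> x * g x)))"
      unfolding t_def by (intro sum_mono integral_norm_bound)
    also have "\<dots> = (LINT x|lebesgue. (\<Sum>\<gamma>\<in>S. norm (c \<gamma> * F \<gamma> x * g x)))"
      using S(2) by (intro Bochner_Integration.integral_sum[symmetric] integrable_norm int) auto
    also have "\<dots> \<le> (LINT x|lebesgue. ?B * norm (g x))"
    proof (rule integral_mono)
      show "integrable lebesgue (\<lambda>x. \<Sum>\<gamma>\<in>S. norm (c \<gamma> * F \<gamma> x * g x))"
        using S(2) by (intro Bochner_Integration.integrable_sum integrable_norm int) auto
      show "integrable lebesgue (\<lambda>x. ?B * norm (g x))" using g by simp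
      fix x
      have "(\<Sum>\<gamma>\<in>S. norm (c \<gamma> * F \<gamma> x * g x)) = (\<Sum>\<gamma>\<in>S. norm (c \<gamma> * F \<gamma> x)) * norm (g x)"
        by (simp add: sum_distrib_right norm_mult)
      also have "\<dots> \<le> ?B * norm (g x)" by (intro mult_right_mono sum_F_le[OF c K S]) auto
      finally show "(\<Sum>\<gamma>\<in>S. norm (c \<gamma> * F \<gamma> x * g x)) \<le> ?B * norm (g x)" .
    qed
    also have "\<dots> = ?B * (LINT x|lebesgue. norm (g x))" by simp
    finally show ?thesis .
  qed
  then have "(\<lambda>\<gamma>. norm (t \<gamma>)) summable_on \<Gamma>"
    by (intro nonneg_bdd_above_summable_on bdd_aboveI2) auto
  then have "t summable_on \<Gamma>" by (rule abs_summable_summable)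
  then have hs: "(sum t \<longlongrightarrow> infsum t \<Gamma>) (finite_subsets_at_top \<Gamma>)"
    using has_sum_infsum unfolding has_sum_def by blast
  obtain X where X: "\<And>n::nat. finite (X n)" "\<And>n. X n \<subseteq> \<Gamma>" "filterlim X (finite_subsets_at_top \<Gamma>) sequentially"
    using countable_exhaustion[OF countable_\<Gamma>] by blast
  have 1: "(\<lambda>n. sum t (X n)) \<longlonglongrightarrow> infsum t \<Gamma>" by (rule filterlim_compose[OF hs X(3)])
  have "(\<lambda>n. LINT x|lebesgue. (\<Sum>\<gamma>\<in>X n. c \<gamma> * F \<gamma> x) * g x) \<longlonglongrightarrow> (LINT x|lebesgue. D c x * g x)"
  proof (rule integral_dominated_convergence[where w = "\<lambda>x. ?B * norm (g x)"])
    show "(\<lambda>x. D c x * g x) \<in> borel_measurable lebesgue"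
      by (intro borel_measurable_times D_bounded_measurable[OF c K] gm)
    show "(\<lambda>x. (\<Sum>\<gamma>\<in>X n. c \<gamma> * F \<gamma> x) * g x) \<in> borel_measurable lebesgue" for n
      using X(2) by (intro borel_measurable_times borel_measurable_sum borel_measurable_const F_measurable gm) auto
    show "integrable lebesgue (\<lambda>x. ?B * norm (g x))" using g by simp
    have "(\<lambda>n. \<Sum>\<gamma>\<in>X n. c \<gamma> * F \<gamma> x) \<longlonglongrightarrow> D c x" for x
      using filterlim_compose[OF D_has_sum[OF c, unfolded has_sum_def] X(3)] by simp
    then show "AE x in lebesgue. (\<lambda>n. (\<Sum>\<gamma>\<in>X n. c \<gamma> * F \<gamma> x) * g x) \<longlonglongrightarrow> D c x * g x"
      by (intro always_eventually allI tendsto_mult tendsto_const)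
    have "norm (\<Sum>\<gamma>\<in>X n. c \<gamma> * F \<gamma> x) \<le> ?B" for n x
      by (rule order_trans[OF norm_sum sum_F_le[OF c K X(1,2)]])
    then show "AE x in lebesgue. norm ((\<Sum>\<gamma>\<in>X n. c \<gamma> * F \<gamma> x) * g x) \<le> ?B * norm (g x)" for n
      unfolding norm_mult by (intro always_eventually allI mult_right_mono) auto
  qed
  then have "(\<lambda>n. sum t (X n)) \<longlonglongrightarrow> (LINT x|lebesgue. D c x * g x)" by (simp add: sum_t[OF X(2)])
  then have "infsum t \<Gamma> = (LINT x|lebesgue. D c x * g x)" using 1 LIMSEQ_unique by blast
  moreover have "\<forall>\<^sub>F S in finite_subsets_at_top \<Gamma>. sum t S = (LINT x|lebesgue. (\<Sum>\<gamma>\<in>S. c \<gamma> * F \<gamma> x) * g x)"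
    by (rule eventually_finite_subsets_at_top_weakI) (rule sum_t)
  ultimately show ?thesis using hs by (simp add: tendsto_cong)
qed

lemma D_in_Vinf:
  assumes c: "\<And>\<gamma>. \<gamma> \<in> \<Gamma> \<Longrightarrow> norm (c \<gamma>) \<le> K" and K: "0 \<le> K"
  shows "D c \<in> Vinf \<Gamma> F"
proof -
  have m: "D c \<in> borel_measurable lebesgue" by (rule D_bounded_measurable[OF c K])
  have "Linf_norm (D c) \<le> ennreal (K * (real N * S\<theta>))" by (rule Linf_norm_le[OF m D_le[OF c K]])
  then have "Linf_norm (D c) < \<infinity>" by (rule le_less_trans) simp
  then have L: "D c \<in> Linf" using m by (simp add: Linf_def)
  have b: "bounded (c ` \<Gamma>)" using c by (auto simp: bounded_iff)
  have cont: "continuous_on UNIV (D c)" by (rule D_continuous[OF c K])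
  have "\<forall>g\<in>Lp 1. ((\<lambda>S. LINT x|lebesgue. (\<Sum>\<gamma>\<in>S. c \<gamma> * F \<gamma> x) * g x) \<longlongrightarrow> (LINT x|lebesgue. D c x * g x))
     (finite_subsets_at_top \<Gamma>)"
  proof
    fix g :: "real ^ 'd \<Rightarrow> complex" assume "g \<in> Lp 1"
    then have "integrable lebesgue g" using integrable_norm_cancel[of lebesgue g] by (simp add: Lp_def)
    then show "((\<lambda>S. LINT x|lebesgue. (\<Sum>\<gamma>\<in>S. c \<gamma> * F \<gamma> x) * g x) \<longlongrightarrow> (LINT x|lebesgue. D c x * g x)) (finite_subsets_at_top \<Gamma>)"
      by (intro D_weak_star[where c = c and K = K] c K)
  qed
  then show ?thesis unfolding Vinf_def mem_Collect_eq
    by (intro conjI exI[of _ c] L cont b)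
qed

text \<open>The partial sums tend to \<open>f\<close> in \<open>L\<^sup>1\<close> and to
  \<open>D c\<close> pointwise; both limits are continuous, so they agree everywhere.\<close>

lemma Vp1_synthesis:
  assumes "f \<in> Vp 1 \<Gamma> F"
  shows "\<exists>c. c \<in> ell1 \<Gamma> \<and> (\<forall>x. f x = D c x)"
proof -
  obtain c where f: "f \<in> Lp 1" "continuous_on UNIV f" and c: "(\<lambda>\<gamma>. norm (c \<gamma>) powr 1) summable_on \<Gamma>"
    and lim: "((\<lambda>S. Lp_norm 1 (\<lambda>x. f x - (\<Sum>\<gamma>\<in>S. c \<gamma> * F \<gamma> x))) \<longlongrightarrow> 0) (finite_subsets_at_top \<Gamma>)"
    using assms unfolding Vp_def by blast
  have ell1: "c \<in> ell1 \<Gamma>" using c by (simp add: ell1_def)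
  then obtain K where K: "0 \<le> K" "\<And>\<gamma>. \<gamma> \<in> \<Gamma> \<Longrightarrow> norm (c \<gamma>) \<le> K" using ell1_bounded by blast
  have fint: "integrable lebesgue f"
    using f(1) integrable_norm_cancel[of lebesgue f] by (simp add: Lp_def)
  obtain X where X: "\<And>n::nat. finite (X n)" "\<And>n. X n \<subseteq> \<Gamma>" "filterlim X (finite_subsets_at_top \<Gamma>) sequentially"
    using countable_exhaustion[OF countable_\<Gamma>] by blast
  have "norm (f x - D c x) = 0" for x
  proof (rule continuous_limit_eq_zero[where h = "\<lambda>x. norm (f x - D c x)" and hn = "\<lambda>n x. norm (f x - (\<Sum>\<gamma>\<in>X n. c \<gamma> * F \<gamma> x))"])
    show "continuous_on UNIV (\<lambda>x. norm (f x - D c x))"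
      by (intro continuous_on_norm continuous_on_diff f(2) D_continuous[OF K(2,1)])
    show "integrable lebesgue (\<lambda>x. norm (f x - (\<Sum>\<gamma>\<in>X n. c \<gamma> * F \<gamma> x)))" for n
      using X(2) by (intro integrable_norm Bochner_Integration.integrable_diff fint Bochner_Integration.integrable_sum integrable_mult_right F_integrable) auto
    have "(\<lambda>n. \<Sum>\<gamma>\<in>X n. c \<gamma> * F \<gamma> x) \<longlonglongrightarrow> D c x" for x
      using filterlim_compose[OF D_has_sum[OF K(2), unfolded has_sum_def] X(3)] by simp
    then show "(\<lambda>n. norm (f x - (\<Sum>\<gamma>\<in>X n. c \<gamma> * F \<gamma> x))) \<longlonglongrightarrow> norm (f x - D c x)" for x
      by (intro tendsto_norm tendsto_diff tendsto_const)
    show "(\<lambda>n. LINT x|lebesgue. norm (f x - (\<Sum>\<gamma>\<in>X n. c \<gamma> * F \<gamma> x))) \<longlonglongrightarrow> 0"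
      using filterlim_compose[OF lim X(3)] by (simp add: Lp_norm_def)
  qed auto
  with ell1 show ?thesis by auto
qed

end

section \<open>The spectral gap from the frame inequality, and bounded coefficients\<close>

locale localized_frame = localized_family +
  fixes A :: real
  assumes A_pos: "0 < A"
    and frame_lower: "finite S \<Longrightarrow> S \<subseteq> \<Gamma> \<Longrightarrow>
      A * (LINT x|lebesgue. (norm (\<Sum>\<gamma>\<in>S. c \<gamma> * F \<gamma> x))\<^sup>2)
        \<le> (\<Sum>\<^sub>\<infinity>\<gamma>\<in>\<Gamma>. (norm (L2_inner (\<lambda>x. \<Sum>\<gamma>\<in>S. c \<gamma> * F \<gamma> x) (F \<gamma>)))\<^sup>2)"
begin

text \<open>This is the lower frame bound for the function \<open>D c\<close>, whose frame
  coefficients are the entries of the image of \<open>c\<close>. It yields a gap in the spectrum of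
  the Gram matrix, not invertibility.\<close>

lemma gram_gap:
  assumes c: "finite {\<gamma>. c \<gamma> \<noteq> 0}" "{\<gamma>. c \<gamma> \<noteq> 0} \<subseteq> \<Gamma>"
  shows "A * (LINT x|lebesgue. (norm (D c x))\<^sup>2) \<le> (ell2_norm \<Gamma> (mat_app \<Gamma> gram c))\<^sup>2"
proof -
  have "(\<Sum>\<^sub>\<infinity>\<gamma>\<in>\<Gamma>. (norm (L2_inner (D c) (F \<gamma>)))\<^sup>2) = (ell2_norm \<Gamma> (mat_app \<Gamma> gram c))\<^sup>2"
    unfolding ell2_norm_sq by (intro infsum_cong) (simp add: gram_apply[OF c])
  then show ?thesis using frame_lower[OF c, of c] by (simp add: D_support[OF c, abs_def] flip: fun_eq_iff)
qed

sublocale gapped_gram \<Gamma> q N gram \<Xi> A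
proof unfold_locales
  show "gram \<gamma>' \<gamma> = cnj (gram \<gamma> \<gamma>')" for \<gamma> \<gamma>' by (rule gram_hermitian)
  show "0 < A" by (rule A_pos)
  show "0 \<le> Re (ell2_inner \<Gamma> (mat_app \<Gamma> gram c) c) \<and> A * Re (ell2_inner \<Gamma> (mat_app \<Gamma> gram c) c) \<le> (ell2_norm \<Gamma> (mat_app \<Gamma> gram c))\<^sup>2"
    if c: "finite {\<gamma>. c \<gamma> \<noteq> 0}" "{\<gamma>. c \<gamma> \<noteq> 0} \<subseteq> \<Gamma>" for c
    unfolding gram_form[OF c] using gram_gap[OF c] by simp
  show "\<exists>w :: int ^ 'd \<Rightarrow> real. (\<forall>k. 0 < w k \<and> w k \<le> 1) \<and> w 0 = 1 \<and> w summable_on UNIV \<and>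
          (\<forall>m\<in>M. \<forall>k. \<bar>w (k + m) - w k\<bar> \<le> \<delta> * w k)" if "0 < \<delta>" "finite M" for \<delta> and M :: "(int ^ 'd) set"
    by (rule slow_weight_exists[OF that])
qed

lemma D_square_integrable:
  assumes c: "finite {\<gamma>. c \<gamma> \<noteq> 0}" "{\<gamma>. c \<gamma> \<noteq> 0} \<subseteq> \<Gamma>"
  shows "integrable lebesgue (\<lambda>x. (norm (D c x))\<^sup>2)"
proof -
  obtain K where K: "0 \<le> K" "\<And>\<gamma>. norm (c \<gamma>) \<le> K" using finite_support_bounded[OF c(1)] by blast
  let ?B = "K * (real N * S\<theta>)"
  have "integrable lebesgue (\<lambda>x. \<Sum>\<gamma> | c \<gamma> \<noteq> 0. c \<gamma> * F \<gamma> x)"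
    using c(2) by (intro Bochner_Integration.integrable_sum integrable_mult_right F_integrable) auto
  then have int: "integrable lebesgue (D c)" by (simp add: D_support[OF c, abs_def])
  show ?thesis
  proof (rule Bochner_Integration.integrable_bound)
    show "integrable lebesgue (\<lambda>x. ?B * norm (D c x))" using int by simp
    show "(\<lambda>x. (norm (D c x))\<^sup>2) \<in> borel_measurable lebesgue"
      using borel_measurable_integrable[OF int] by simp
    have "(norm (D c x))\<^sup>2 \<le> ?B * norm (D c x)" for x
      unfolding power2_eq_square by (intro mult_right_mono D_le K) auto
    then show "AE x in lebesgue. norm ((norm (D c x))\<^sup>2) \<le> norm (?B * norm (D c x))"
      using K S\<theta>_nonneg by (intro always_eventually allI) (simp add: abs_mult)
  qed
qed

text \<open>
  A uniformly bounded choice of coefficients: this is where the spectral invariance of the Gram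
  matrix enters, and what makes the unit ball of \<open>V\<^sup>\<infinity>\<close> compact for locally uniform convergence.
\<close>
lemma bounded_coefficients:
  "\<exists>C\<ge>0. \<forall>c K. finite {\<gamma>. c \<gamma> \<noteq> 0} \<longrightarrow> {\<gamma>. c \<gamma> \<noteq> 0} \<subseteq> \<Gamma> \<longrightarrow> 0 < K \<longrightarrow> (\<forall>x. norm (D c x) \<le> K) \<longrightarrow>
     (\<exists>c'. (\<forall>\<gamma>\<in>\<Gamma>. norm (c' \<gamma>) \<le> C * K) \<and> (\<forall>x. D c' x = D c x))"
proof -
  obtain C0 where C0: "0 \<le> C0" and pre: "\<forall>u K \<epsilon>. u \<in> ell1 \<Gamma> \<longrightarrow> 0 \<le> K \<longrightarrow> (\<forall>\<gamma>\<in>\<Gamma>. norm (mat_app \<Gamma> gram u \<gamma>) \<le> K) \<longrightarrow> 0 < \<epsilon> \<longrightarrow>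
    (\<exists>c. finite {\<gamma>. c \<gamma> \<noteq> 0} \<and> {\<gamma>. c \<gamma> \<noteq> 0} \<subseteq> \<Gamma> \<and> (\<forall>\<gamma>. norm (c \<gamma>) \<le> C0 * (K + \<epsilon>)) \<and>
      ell2_norm \<Gamma> (\<lambda>\<gamma>. mat_app \<Gamma> gram c \<gamma> - mat_app \<Gamma> gram u \<gamma>) \<le> \<epsilon>)"
    using bounded_preimage by (elim exE conjE) (rule that)
  define C where "C = C0 * (v * S\<theta> + 1)"
  have C: "0 \<le> C" using C0 v_pos S\<theta>_nonneg by (simp add: C_def)
  have "\<exists>c'. (\<forall>\<gamma>\<in>\<Gamma>. norm (c' \<gamma>) \<le> C * K) \<and> (\<forall>x. D c' x = D c x)"
    if c: "finite {\<gamma>. c \<gamma> \<noteq> 0}" "{\<gamma>. c \<gamma> \<noteq> 0} \<subseteq> \<Gamma>" and K: "0 < K" "\<And>x. norm (D c x) \<le> K" for c K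
  proof -
    obtain L where L: "0 \<le> L" "\<And>\<gamma>. norm (c \<gamma>) \<le> L" using finite_support_bounded[OF c(1)] by blast
    have cl: "c \<in> ell1 \<Gamma>" by (rule finite_support_ell1[OF c(1)])
    \<comment> \<open>A sup bound of the function bounds the image of \<open>c\<close>, since the
      frame elements are uniformly bounded in \<open>L\<^sup>1\<close>. About \<open>c\<close>
      itself only finiteness of its entries is known.\<close>
    have b: "norm (mat_app \<Gamma> gram c \<gamma>) \<le> K * (v * S\<theta>)" if "\<gamma> \<in> \<Gamma>" for \<gamma>
      using L2_inner_F_le[OF D_bounded_measurable[OF L(2,1)] K(2) that] by (simp add: gram_apply[OF c that])
    have K': "0 \<le> K * (v * S\<theta>)" using K(1) v_pos S\<theta>_nonneg by simp
    \<comment> \<open>The errors tend to zero, and the cap by \<open>K\<close> keeps the coefficient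
      bound proportional to \<open>K\<close>.\<close>
    have "\<forall>n::nat. \<exists>d. finite {\<gamma>. d \<gamma> \<noteq> 0} \<and> {\<gamma>. d \<gamma> \<noteq> 0} \<subseteq> \<Gamma> \<and> (\<forall>\<gamma>. norm (d \<gamma>) \<le> C0 * (K * (v * S\<theta>) + min K (1 / real (Suc n)))) \<and>
      ell2_norm \<Gamma> (\<lambda>\<gamma>. mat_app \<Gamma> gram d \<gamma> - mat_app \<Gamma> gram c \<gamma>) \<le> min K (1 / real (Suc n))"
    proof
      fix n
      have "0 < min K (1 / real (Suc n))" using K(1) by simp
      with b K' cl pre[rule_format, of c "K * (v * S\<theta>)" "min K (1 / real (Suc n))"]
      show "\<exists>d. finite {\<gamma>. d \<gamma> \<noteq> 0} \<and> {\<gamma>. d \<gamma> \<noteq> 0} \<subseteq> \<Gamma> \<and> (\<forall>\<gamma>. norm (d \<gamma>) \<le> C0 * (K * (v * S\<theta>) + min K (1 / real (Suc n)))) \<and>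
        ell2_norm \<Gamma> (\<lambda>\<gamma>. mat_app \<Gamma> gram d \<gamma> - mat_app \<Gamma> gram c \<gamma>) \<le> min K (1 / real (Suc n))" by blast
    qed
    from choice[OF this] obtain d where d: "\<And>n. finite {\<gamma>. d n \<gamma> \<noteq> 0}" "\<And>n. {\<gamma>. d n \<gamma> \<noteq> 0} \<subseteq> \<Gamma>"
      and d_le0: "\<And>n \<gamma>. norm (d n \<gamma>) \<le> C0 * (K * (v * S\<theta>) + min K (1 / real (Suc n)))"
      and d_ell2_norm: "\<And>n. ell2_norm \<Gamma> (\<lambda>\<gamma>. mat_app \<Gamma> gram (d n) \<gamma> - mat_app \<Gamma> gram c \<gamma>) \<le> min K (1 / real (Suc n))" by blast
    have d_le: "norm (d n \<gamma>) \<le> C * K" for n \<gamma>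
    proof -
      have "C0 * (K * (v * S\<theta>) + min K (1 / real (Suc n))) \<le> C0 * (K * (v * S\<theta>) + K)"
        using C0 by (intro mult_left_mono) auto
      also have "\<dots> = C * K" by (simp add: C_def algebra_simps)
      finally show ?thesis using d_le0[of n \<gamma>] by linarith
    qed
    obtain k :: "nat \<Rightarrow> nat" where k: "strict_mono k" and conv: "\<And>\<gamma>. \<gamma> \<in> \<Gamma> \<Longrightarrow> \<exists>l. (\<lambda>n. d (k n) \<gamma>) \<longlonglongrightarrow> l"
      using function_convergent_subsequence[OF countable_\<Gamma>, of d "C * K"] d_le by blast
    define c' where "c' \<gamma> = lim (\<lambda>n. d (k n) \<gamma>)" for \<gamma>
    have c'lim: "(\<lambda>n. d (k n) \<gamma>) \<longlonglongrightarrow> c' \<gamma>" if "\<gamma> \<in> \<Gamma>" for \<gamma>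
      using conv[OF that] unfolding c'_def by (auto simp: limI)
    have c'_le: "norm (c' \<gamma>) \<le> C * K" if "\<gamma> \<in> \<Gamma>" for \<gamma>
      by (rule tendsto_upperbound[OF tendsto_norm[OF c'lim[OF that]]]) (auto simp: d_le)
    have CK: "0 \<le> C * K" using C K(1) by simp
    have ptw: "(\<lambda>n. D (d (k n)) x) \<longlonglongrightarrow> D c' x" for x
      using D_convergence[of "\<lambda>n. d (k n)" "C * K" c' "{q x}" "\<lambda>_. x", OF d_le CK c'lim] by (simp add: LIM_zero_iff)
    have diff: "D (\<lambda>\<gamma>. d n \<gamma> - c \<gamma>) x = D (d n) x - D c x" for n x by (rule D_diff[OF d_le L(2)])
    have supp: "finite {\<gamma>. d n \<gamma> - c \<gamma> \<noteq> 0}" "{\<gamma>. d n \<gamma> - c \<gamma> \<noteq> 0} \<subseteq> \<Gamma>" for n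
    proof -
      have sub: "{\<gamma>. d n \<gamma> - c \<gamma> \<noteq> 0} \<subseteq> {\<gamma>. d n \<gamma> \<noteq> 0} \<union> {\<gamma>. c \<gamma> \<noteq> 0}" by auto
      show "finite {\<gamma>. d n \<gamma> - c \<gamma> \<noteq> 0}" by (rule finite_subset[OF sub]) (simp add: d(1) c(1))
      show "{\<gamma>. d n \<gamma> - c \<gamma> \<noteq> 0} \<subseteq> \<Gamma>" using sub d(2)[of n] c(2) by blast
    qed
    \<comment> \<open>The gap, applied to the difference \<open>d n - c\<close>, turns the error in
      the image into an \<open>L\<^sup>2\<close> error of the functions.\<close>
    have small: "(LINT x|lebesgue. (norm (D (d n) x - D c x))\<^sup>2) \<le> (1 / real (Suc n))\<^sup>2 / A" for n
    proof -
      have "A * (LINT x|lebesgue. (norm (D (d n) x - D c x))\<^sup>2) \<le> (ell2_norm \<Gamma> (mat_app \<Gamma> gram (\<lambda>\<gamma>. d n \<gamma> - c \<gamma>)))\<^sup>2"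
        using gram_gap[OF supp[of n]] by (simp add: diff)
      also have "mat_app \<Gamma> gram (\<lambda>\<gamma>. d n \<gamma> - c \<gamma>) = (\<lambda>\<gamma>. mat_app \<Gamma> gram (d n) \<gamma> - mat_app \<Gamma> gram c \<gamma>)"
        by (rule cd.mat_app_diff[OF finite_support_ell1[OF d(1)] cl])
      also have "(ell2_norm \<Gamma> \<dots>)\<^sup>2 \<le> (1 / real (Suc n))\<^sup>2" using d_ell2_norm[of n] by (intro power_mono ell2_norm_nonneg) simp
      finally show ?thesis using A_pos by (simp add: field_simps)
    qed
    \<comment> \<open>The families \<open>c'\<close> and \<open>c\<close> may well differ. The
      functions agree, as pointwise limit and \<open>L\<^sup>2\<close> limit of the same
      sequence.\<close>
    have "(norm (D c' x - D c x))\<^sup>2 = 0" for x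
    proof (rule continuous_limit_eq_zero[where h = "\<lambda>x. (norm (D c' x - D c x))\<^sup>2" and hn = "\<lambda>n x. (norm (D (d (k n)) x - D c x))\<^sup>2"])
      show "continuous_on UNIV (\<lambda>x. (norm (D c' x - D c x))\<^sup>2)"
        by (intro continuous_on_power continuous_on_norm continuous_on_diff D_continuous[OF c'_le CK] D_continuous[OF L(2,1)])
      show "integrable lebesgue (\<lambda>x. (norm (D (d (k n)) x - D c x))\<^sup>2)" for n
        using D_square_integrable[OF supp[of "k n"]] by (simp add: diff)
      show "(\<lambda>n. (norm (D (d (k n)) x - D c x))\<^sup>2) \<longlonglongrightarrow> (norm (D c' x - D c x))\<^sup>2" for x
        by (intro tendsto_power tendsto_norm tendsto_diff ptw tendsto_const)
      have inv: "(\<lambda>n. (1 / real (Suc n))\<^sup>2 / A) \<longlonglongrightarrow> 0"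
        using tendsto_divide[OF tendsto_power[OF LIMSEQ_inverse_real_of_nat, of 2] tendsto_const[of A]] A_pos
        by (simp add: inverse_eq_divide)
      have "(\<lambda>n. LINT x|lebesgue. (norm (D (d n) x - D c x))\<^sup>2) \<longlonglongrightarrow> 0"
        by (rule tendsto_sandwich[OF _ _ tendsto_const inv]) (use small in auto)
      then show "(\<lambda>n. LINT x|lebesgue. (norm (D (d (k n)) x - D c x))\<^sup>2) \<longlonglongrightarrow> 0"
        using LIMSEQ_subseq_LIMSEQ[OF _ k] by (force simp: o_def)
    qed auto
    then show ?thesis using c'_le by (intro exI[of _ c']) auto
  qed
  with C show ?thesis by (intro exI[of _ C]) blast
qed

end

context localized_frame begin

lemma F_bounded: "\<gamma> \<in> \<Gamma> \<Longrightarrow> norm (F \<gamma> x) \<le> S\<theta>"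
  by (rule order_trans[OF F_le \<theta>_le])

lemma D_cmult: "D (\<lambda>\<gamma>. a * c \<gamma>) x = a * D c x"
  unfolding D_def by (simp add: mult.assoc infsum_cmult_right')

lemma lin_eq_D:
  assumes "finite S" "S \<subseteq> \<Gamma>" "lin S F f"
  shows "\<exists>c. finite {\<gamma>. c \<gamma> \<noteq> 0} \<and> {\<gamma>. c \<gamma> \<noteq> 0} \<subseteq> \<Gamma> \<and> (\<forall>x. f x = D c x)"
proof -
  obtain c where c: "\<forall>x. f x = (\<Sum>\<gamma>\<in>S. c \<gamma> * F \<gamma> x)" using assms(3) unfolding lin_def by blast
  define d where "d \<gamma> = (if \<gamma> \<in> S then c \<gamma> else 0)" for \<gamma>
  have sub: "{\<gamma>. d \<gamma> \<noteq> 0} \<subseteq> S" by (auto simp: d_def)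
  have "f x = D d x" for x
  proof -
    have "D d x = (\<Sum>\<gamma>\<in>S. d \<gamma> * F \<gamma> x)" by (rule D_finite[OF assms(1,2)]) (simp add: d_def)
    also have "\<dots> = f x" unfolding c[rule_format] by (intro sum.cong) (auto simp: d_def)
    finally show ?thesis by simp
  qed
  then show ?thesis using finite_subset[OF sub assms(1)] subset_trans[OF sub assms(2)] by blast
qed

text \<open>The expansion coefficients of the Lagrange functions are exchanged for bounded ones. The
  new coefficients may live on all of \<Gamma> rather than on \<open>S\<close>, hence the system is
  phrased through \<open>D (cc i)\<close>. The restriction \<open>\<epsilon> \<le> 1\<close> turns
  \<open>C * (1 + \<epsilon>)\<close> into \<open>2 * C\<close>.\<close>

lemma fekete_nodes:
  assumes C: "\<forall>c K. finite {\<gamma>. c \<gamma> \<noteq> 0} \<longrightarrow> {\<gamma>. c \<gamma> \<noteq> 0} \<subseteq> \<Gamma> \<longrightarrow> 0 < K \<longrightarrow> (\<forall>x. norm (D c x) \<le> K) \<longrightarrow>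
     (\<exists>c'. (\<forall>\<gamma>\<in>\<Gamma>. norm (c' \<gamma>) \<le> C * K) \<and> (\<forall>x. D c' x = D c x))" "0 \<le> C"
    and S: "finite S" "S \<subseteq> \<Gamma>" and \<epsilon>: "0 < \<epsilon>" "\<epsilon> \<le> 1"
  shows "\<exists>(m :: nat) y cc. (\<forall>i<m. \<forall>k<m. D (cc i) (y k) = (if i = k then 1 else 0)) \<and>
     (\<forall>i<m. \<forall>\<gamma>\<in>\<Gamma>. norm (cc i \<gamma>) \<le> 2 * C) \<and> (\<forall>i<m. \<forall>x. norm (D (cc i) x) \<le> 1 + \<epsilon>) \<and>
     (\<forall>b x. (\<Sum>\<gamma>\<in>S. b \<gamma> * F \<gamma> x) = (\<Sum>i<m. (\<Sum>\<gamma>\<in>S. b \<gamma> * F \<gamma> (y i)) * D (cc i) x))"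
proof -
  have "\<exists>K. \<forall>x. norm (F \<gamma> x) \<le> K" if "\<gamma> \<in> S" for \<gamma> using F_bounded S(2) that by blast
  then obtain m y l where l: "lagrange_system S F m y l" and le: "\<forall>i<m. \<forall>x. norm (l i x) \<le> 1 + \<epsilon>"
    using fekete_system[OF S(1) _ \<epsilon>(1), of F] by blast
  have lin: "\<And>i. i < m \<Longrightarrow> lin S F (l i)"
    and bi: "\<And>i k. i < m \<Longrightarrow> k < m \<Longrightarrow> l i (y k) = (if i = k then 1 else 0)"
    and ex: "\<And>f x. lin S F f \<Longrightarrow> f x = (\<Sum>i<m. f (y i) * l i x)"
    using l unfolding lagrange_system_def by blast+
  have "\<exists>c. (\<forall>\<gamma>\<in>\<Gamma>. norm (c \<gamma>) \<le> C * (1 + \<epsilon>)) \<and> (\<forall>x. D c x = l i x)" if i: "i < m" for i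
  proof -
    obtain c where c: "finite {\<gamma>. c \<gamma> \<noteq> 0}" "{\<gamma>. c \<gamma> \<noteq> 0} \<subseteq> \<Gamma>" "\<forall>x. l i x = D c x"
      using lin_eq_D[OF S lin[OF i]] by blast
    have "\<forall>x. norm (D c x) \<le> 1 + \<epsilon>" using le[rule_format, OF i] unfolding c(3)[rule_format] by blast
    moreover have "0 < 1 + \<epsilon>" using \<epsilon>(1) by simp
    ultimately show ?thesis using C(1)[rule_format, OF c(1,2)] c(3) by simp
  qed
  then obtain cc where cc: "\<And>i. i < m \<Longrightarrow> \<forall>\<gamma>\<in>\<Gamma>. norm (cc i \<gamma>) \<le> C * (1 + \<epsilon>)" "\<And>i x. i < m \<Longrightarrow> D (cc i) x = l i x"
    by metis
  have "C * (1 + \<epsilon>) \<le> C * 2" using C(2) \<epsilon>(2) by (intro mult_left_mono) auto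
  then have 1: "\<forall>i<m. \<forall>\<gamma>\<in>\<Gamma>. norm (cc i \<gamma>) \<le> 2 * C" using cc(1) by fastforce
  have 2: "\<forall>b x. (\<Sum>\<gamma>\<in>S. b \<gamma> * F \<gamma> x) = (\<Sum>i<m. (\<Sum>\<gamma>\<in>S. b \<gamma> * F \<gamma> (y i)) * D (cc i) x)"
  proof (intro allI)
    fix b x
    have "lin S F (\<lambda>x. \<Sum>\<gamma>\<in>S. b \<gamma> * F \<gamma> x)" unfolding lin_def by blast
    from ex[OF this, of x] show "(\<Sum>\<gamma>\<in>S. b \<gamma> * F \<gamma> x) = (\<Sum>i<m. (\<Sum>\<gamma>\<in>S. b \<gamma> * F \<gamma> (y i)) * D (cc i) x)"
      by (simp add: cc(2))
  qed
  have 3: "\<forall>i<m. \<forall>k<m. D (cc i) (y k) = (if i = k then 1 else 0)" using bi by (simp add: cc(2))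
  have 4: "\<forall>i<m. \<forall>x. norm (D (cc i) x) \<le> 1 + \<epsilon>" using le by (simp add: cc(2))
  show ?thesis
    using 1 2 3 4 by blast
qed

end

lemma norm_diff_corner_le:
  fixes x :: "real ^ 'd" and s :: real
  assumes "0 < s"
  shows "norm (x - corner s (cell_of s x)) \<le> s * CARD('d)"
proof (rule norm_vec_le)
  fix i
  show "\<bar>(x - corner s (cell_of s x)) $ i\<bar> \<le> s"
    using cell_of_eq_iff[OF assms, of x "cell_of s x"] by (auto simp: abs_le_iff algebra_simps less_imp_le)
qed

subsection \<open>The limit of the Fekete points\<close>

text \<open>The diameter of a cell is at most \<open>s * CARD('d)\<close>, while distinct nodes are
  more than \<open>\<delta>\<close> apart; so no two of them share a cell. The coefficient bound is
  independent of \<open>n\<close>, which is what permits passing to the limit.\<close>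

locale fekete_sequence = localized_frame \<Gamma> F s \<theta> N A
  for \<Gamma> :: "(real ^ 'd) set" and F s \<theta> N A +
  fixes \<delta> C :: real and X :: "nat \<Rightarrow> (real ^ 'd) set" and m :: "nat \<Rightarrow> nat"
    and y :: "nat \<Rightarrow> nat \<Rightarrow> real ^ 'd" and cc :: "nat \<Rightarrow> nat \<Rightarrow> real ^ 'd \<Rightarrow> complex"
  assumes \<delta>: "0 < \<delta>" "s * CARD('d) \<le> \<delta>" and C_nonneg: "0 \<le> C"
    and X: "finite (X n)" "X n \<subseteq> \<Gamma>" "filterlim X (finite_subsets_at_top \<Gamma>) sequentially"
    and biorth: "i < m n \<Longrightarrow> k < m n \<Longrightarrow> D (cc n i) (y n k) = (if i = k then 1 else 0)"
    and cc_le: "i < m n \<Longrightarrow> \<gamma> \<in> \<Gamma> \<Longrightarrow> norm (cc n i \<gamma>) \<le> 2 * C"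
    and l_le: "i < m n \<Longrightarrow> norm (D (cc n i) x) \<le> 1 + 1 / real (Suc n)"
    and expand: "(\<Sum>\<gamma>\<in>X n. b \<gamma> * F \<gamma> x) = (\<Sum>i<m n. (\<Sum>\<gamma>\<in>X n. b \<gamma> * F \<gamma> (y n i)) * D (cc n i) x)"
    and separated: "i < m n \<Longrightarrow> k < m n \<Longrightarrow> i \<noteq> k \<Longrightarrow> \<delta> < dist (y n i) (y n k)"
begin

lemma node_cell_inj: "i < m n \<Longrightarrow> k < m n \<Longrightarrow> q (y n i) = q (y n k) \<Longrightarrow> i = k"
  using separated[of i n k] dist_cell_of_le[OF s_pos, of "y n i" "y n k"] \<delta>(2) by fastforce

text \<open>The enumeration of the nodes by \<open>i < m n\<close> has no meaning across different
  \<open>n\<close>; naming a node by its cell has.\<close>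

definition occ where "occ n k \<longleftrightarrow> (\<exists>i<m n. q (y n i) = k)"
definition idx where "idx n k = (SOME i. i < m n \<and> q (y n i) = k)"

lemma idx: "occ n k \<Longrightarrow> idx n k < m n" "occ n k \<Longrightarrow> q (y n (idx n k)) = k"
  unfolding occ_def idx_def by (metis (mono_tags, lifting) someI_ex)+

lemma idx_node: "i < m n \<Longrightarrow> idx n (q (y n i)) = i"
  by (rule node_cell_inj) (auto simp: occ_def intro!: idx)

text \<open>Occupation flag, position relative to the corner of the cell, and one coefficient.
  Positions are relative because the diagonal argument asks for one bound over all cells. The flag
  is a real number so that it converges together with the rest.\<close>

definition data where
  "data n p = (case p of (k, \<gamma>) \<Rightarrow> if occ n k
     then (1 :: real, y n (idx n k) - corner s k, if \<gamma> \<in> \<Gamma> then cc n (idx n k) \<gamma> else 0)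
     else (0, 0, 0))"

lemma data_bounded: "norm (data n p) \<le> 1 + (s * CARD('d) + 2 * C)"
proof (cases p)
  case (Pair k \<gamma>)
  have pos: "0 \<le> s * CARD('d)" using s_pos by simp
  have tri: "norm (a, b, c) \<le> norm a + (norm b + norm c)" for a :: real and b :: "real ^ 'd" and c :: complex
    using norm_Pair_le[of a "(b, c)"] norm_Pair_le[of b c] by linarith
  show ?thesis
  proof (cases "occ n k")
    case True
    have "norm (y n (idx n k) - corner s k) \<le> s * CARD('d)"
      using norm_diff_corner_le[OF s_pos, of "y n (idx n k)"] idx(2)[OF True] by simp
    moreover have "norm (if \<gamma> \<in> \<Gamma> then cc n (idx n k) \<gamma> else 0) \<le> 2 * C"
      using cc_le[OF idx(1)[OF True]] C_nonneg by simp
    ultimately show ?thesis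
      using tri[of 1 "y n (idx n k) - corner s k" "if \<gamma> \<in> \<Gamma> then cc n (idx n k) \<gamma> else 0"] True
      by (simp add: data_def Pair)
  next
    case False
    then show ?thesis using pos C_nonneg by (simp add: data_def Pair norm_Pair)
  qed
qed

text \<open>The point 0 is a dummy \<open>\<gamma>\<close> at which flag and position can be read
  for every cell, whether or not 0 belongs to \<Gamma>.\<close>

lemma subsequence_exists:
  "\<exists>r :: nat \<Rightarrow> nat. strict_mono r \<and> (\<forall>p\<in>UNIV \<times> insert 0 \<Gamma>. \<exists>L. (\<lambda>n. data (r n) p) \<longlonglongrightarrow> L)"
proof -
  have "countable (UNIV \<times> insert 0 \<Gamma> :: ((int ^ 'd) \<times> (real ^ 'd)) set)"
    by (intro countable_SIGMA countableI_type countable_insert countable_\<Gamma>)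
  then show ?thesis
    by (rule function_convergent_subsequence[of _ data, OF _ data_bounded]) blast
qed

end

locale fekete_limit = fekete_sequence \<Gamma> F s \<theta> N A \<delta> C X m y cc
  for \<Gamma> :: "(real ^ 'd) set" and F s \<theta> N A \<delta> C X m y cc +
  fixes r :: "nat \<Rightarrow> nat"
  assumes r: "strict_mono r" and conv: "p \<in> UNIV \<times> insert 0 \<Gamma> \<Longrightarrow> \<exists>L. (\<lambda>n. data (r n) p) \<longlonglongrightarrow> L"
begin

definition "E = {k. \<forall>\<^sub>F n in sequentially. occ (r n) k}"
text \<open>A limit node lies in the closure of the cell \<open>k\<close>, possibly in a
  neighbouring cell. It is therefore still indexed by \<open>k\<close>, and separation is inherited
  from the nodes and not from the cells.\<close>

definition "pt k = corner s k + lim (\<lambda>n. fst (snd (data (r n) (k, 0))))"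
definition "co k \<gamma> = lim (\<lambda>n. snd (snd (data (r n) (k, \<gamma>))))"

text \<open>A convergent sequence of flags 0 and 1 is eventually constant, so along the subsequence
  a cell is either eventually occupied or eventually empty. No contribution to the sampling sum can
  be lost by oscillation.\<close>

lemma occ_eventually: "k \<notin> E \<Longrightarrow> \<forall>\<^sub>F n in sequentially. \<not> occ (r n) k"
proof -
  assume k: "k \<notin> E"
  obtain L where "(\<lambda>n. data (r n) (k, 0)) \<longlonglongrightarrow> L" using conv[of "(k, 0)"] by auto
  from tendsto_fst[OF this] have lim: "(\<lambda>n. fst (data (r n) (k, 0))) \<longlonglongrightarrow> fst L" .
  have fst: "fst (data n (k, 0)) = (if occ n k then 1 else 0)" for n by (simp add: data_def)
  show ?thesis
  proof (cases "1 / 2 < fst L")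
    case True
    then have "\<forall>\<^sub>F n in sequentially. 1 / 2 < fst (data (r n) (k, 0))" by (rule order_tendstoD(1)[OF lim])
    then have "\<forall>\<^sub>F n in sequentially. occ (r n) k" by (rule eventually_mono) (simp add: fst split: if_splits)
    with k show ?thesis by (simp add: E_def)
  next
    case False
    then have "fst L < 1" by simp
    then have "\<forall>\<^sub>F n in sequentially. fst (data (r n) (k, 0)) < 1" by (rule order_tendstoD(2)[OF lim])
    then show ?thesis by (rule eventually_mono) (simp add: fst split: if_splits)
  qed
qed

lemma node_limit:
  assumes "k \<in> E"
  shows "(\<lambda>n. y (r n) (idx (r n) k)) \<longlonglongrightarrow> pt k"
proof -
  obtain L where "(\<lambda>n. data (r n) (k, 0)) \<longlonglongrightarrow> L" using conv[of "(k, 0)"] by auto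
  then have "(\<lambda>n. fst (snd (data (r n) (k, 0)))) \<longlonglongrightarrow> fst (snd L)" by (intro tendsto_fst tendsto_snd)
  then have "(\<lambda>n. corner s k + fst (snd (data (r n) (k, 0)))) \<longlonglongrightarrow> pt k"
    unfolding pt_def by (intro tendsto_add tendsto_const) (simp add: limI)
  moreover have "\<forall>\<^sub>F n in sequentially. corner s k + fst (snd (data (r n) (k, 0))) = y (r n) (idx (r n) k)"
    using assms unfolding E_def mem_Collect_eq by (rule eventually_mono) (simp add: data_def)
  ultimately show ?thesis by (rule Lim_transform_eventually)
qed

lemma co_limit:
  assumes "\<gamma> \<in> \<Gamma>"
  shows "(\<lambda>n. snd (snd (data (r n) (k, \<gamma>)))) \<longlonglongrightarrow> co k \<gamma>"
proof -
  obtain L where "(\<lambda>n. data (r n) (k, \<gamma>)) \<longlonglongrightarrow> L" using conv[of "(k, \<gamma>)"] assms by auto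
  then have "(\<lambda>n. snd (snd (data (r n) (k, \<gamma>)))) \<longlonglongrightarrow> snd (snd L)" by (intro tendsto_snd)
  then show ?thesis unfolding co_def by (simp add: limI)
qed

lemma data_co_le: "norm (snd (snd (data n (k, \<gamma>)))) \<le> 2 * C"
  using cc_le[of "idx n k" n \<gamma>] idx(1)[of n k] C_nonneg by (auto simp: data_def)

lemma co_le: "\<gamma> \<in> \<Gamma> \<Longrightarrow> norm (co k \<gamma>) \<le> 2 * C"
  by (rule tendsto_upperbound[OF tendsto_norm[OF co_limit]]) (auto simp: data_co_le)

lemma D_data:
  assumes "occ n k"
  shows "D (\<lambda>\<gamma>. snd (snd (data n (k, \<gamma>)))) x = D (cc n (idx n k)) x"
  unfolding D_def using assms by (intro infsum_cong) (simp add: data_def)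

lemma pt_separated:
  assumes "k \<in> E" "k' \<in> E" "k \<noteq> k'"
  shows "\<delta> \<le> dist (pt k) (pt k')"
proof (rule tendsto_lowerbound[OF tendsto_dist[OF node_limit[OF assms(1)] node_limit[OF assms(2)]]])
  have "\<forall>\<^sub>F n in sequentially. occ (r n) k \<and> occ (r n) k'"
    using assms(1,2) by (auto simp: E_def eventually_conj_iff)
  then show "\<forall>\<^sub>F n in sequentially. \<delta> \<le> dist (y (r n) (idx (r n) k)) (y (r n) (idx (r n) k'))"
  proof (rule eventually_mono)
    fix n assume o: "occ (r n) k \<and> occ (r n) k'"
    then have "idx (r n) k \<noteq> idx (r n) k'" using idx(2) assms(3) by metis
    then show "\<delta> \<le> dist (y (r n) (idx (r n) k)) (y (r n) (idx (r n) k'))"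
      using separated idx(1) o by (intro less_imp_le) auto
  qed
qed simp

lemma pt_inj: "inj_on pt E"
  using pt_separated \<delta>(1) by (force simp: inj_on_def)

lemma limit_le:
  assumes "k \<in> E"
  shows "norm (D (co k) x) \<le> 1"
proof -
  let ?d = "\<lambda>n \<gamma>. snd (snd (data (r n) (k, \<gamma>)))"
  have "(\<lambda>n. D (?d n) x - D (co k) x) \<longlonglongrightarrow> 0"
    using C_nonneg by (intro D_convergence[where K = "2 * C" and Q = "{q x}"] data_co_le co_limit) auto
  then have lim: "(\<lambda>n. D (?d n) x) \<longlonglongrightarrow> D (co k) x" by (simp add: LIM_zero_iff)
  have one: "(\<lambda>n. 1 + 1 / real (Suc (r n))) \<longlonglongrightarrow> 1 + 0"
    using LIMSEQ_subseq_LIMSEQ[OF LIMSEQ_inverse_real_of_nat r] by (intro tendsto_add tendsto_const) (simp add: o_def inverse_eq_divide)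
  have "norm (D (co k) x) \<le> 1 + 0"
  proof (rule tendsto_le[OF _ one tendsto_norm[OF lim]])
    show "\<forall>\<^sub>F n in sequentially. norm (D (?d n) x) \<le> 1 + 1 / real (Suc (r n))"
      using assms unfolding E_def mem_Collect_eq
      by (rule eventually_mono) (simp only: D_data l_le idx(1))
  qed simp
  then show ?thesis by simp
qed

text \<open>Node and coefficients move simultaneously: \<open>D_convergence\<close> replaces
  \<open>d n\<close> by \<open>d'\<close> at the moving node, then continuity of \<open>D d'\<close>
  moves the node. The index is shifted because the node is known to lie in the cell \<open>k\<close>
  only once that cell is occupied.\<close>

lemma node_evaluation_limit:
  assumes k: "k \<in> E" and d: "\<And>n \<gamma>. \<gamma> \<in> \<Gamma> \<Longrightarrow> norm (d n \<gamma>) \<le> K" "0 \<le> K"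
    and lim: "\<And>\<gamma>. \<gamma> \<in> \<Gamma> \<Longrightarrow> (\<lambda>n. d n \<gamma>) \<longlonglongrightarrow> d' \<gamma>"
  shows "(\<lambda>n. D (d n) (y (r n) (idx (r n) k))) \<longlonglongrightarrow> D d' (pt k)"
proof -
  obtain n0 where n0: "\<And>n. n0 \<le> n \<Longrightarrow> occ (r n) k" using k by (auto simp: E_def eventually_sequentially)
  define x where "x n = y (r n) (idx (r n) k)" for n
  have d': "norm (d' \<gamma>) \<le> K" if "\<gamma> \<in> \<Gamma>" for \<gamma>
    by (rule tendsto_upperbound[OF tendsto_norm[OF lim[OF that]]]) (use d(1)[OF that] in auto)
  have "(\<lambda>n. D (d (n + n0)) (x (n + n0)) - D d' (x (n + n0))) \<longlonglongrightarrow> 0"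
    using d n0 LIMSEQ_ignore_initial_segment[OF lim]
    by (intro D_convergence[where K = K and Q = "{k}"]) (auto simp: x_def idx(2))
  then have "(\<lambda>n. D (d n) (x n) - D d' (x n)) \<longlonglongrightarrow> 0" by (rule LIMSEQ_offset)
  moreover have "(\<lambda>n. D d' (x n)) \<longlonglongrightarrow> D d' (pt k)"
    using D_continuous[where c = d' and K = K] d' d(2) node_limit[OF k] unfolding x_def
    by (intro continuous_on_tendsto_compose[of UNIV "D d'"]) auto
  ultimately have "(\<lambda>n. D (d n) (x n) - D d' (x n) + D d' (x n)) \<longlonglongrightarrow> 0 + D d' (pt k)" by (rule tendsto_add)
  then show ?thesis by (simp add: x_def)
qed

lemma limit_biorthogonal:
  assumes "k \<in> E" "k' \<in> E"
  shows "D (co k) (pt k') = (if k = k' then 1 else 0)"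
proof -
  let ?d = "\<lambda>n \<gamma>. snd (snd (data (r n) (k, \<gamma>)))"
  have "(\<lambda>n. D (?d n) (y (r n) (idx (r n) k'))) \<longlonglongrightarrow> D (co k) (pt k')"
    using C_nonneg by (intro node_evaluation_limit[where K = "2 * C"] assms data_co_le co_limit) auto
  moreover have "\<forall>\<^sub>F n in sequentially. D (?d n) (y (r n) (idx (r n) k')) = (if k = k' then 1 else 0)"
  proof -
    have "\<forall>\<^sub>F n in sequentially. occ (r n) k \<and> occ (r n) k'"
      using assms by (auto simp: E_def eventually_conj_iff)
    then show ?thesis
    proof (rule eventually_mono)
      fix n assume o: "occ (r n) k \<and> occ (r n) k'"
      then have "idx (r n) k = idx (r n) k' \<longleftrightarrow> k = k'" using idx(2) by metis
      then show "D (?d n) (y (r n) (idx (r n) k')) = (if k = k' then 1 else 0)"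
        using o by (simp add: D_data biorth idx(1))
    qed
  qed
  ultimately have "(\<lambda>_. if k = k' then 1 else 0 :: complex) \<longlonglongrightarrow> D (co k) (pt k')"
    by (rule Lim_transform_eventually)
  then show ?thesis using LIMSEQ_unique[OF tendsto_const] by metis
qed

text \<open>The convolution of the absolute coefficients with \<open>\<theta>\<close> majorises all
  partial sums on a whole cell and is summable over the cells. It plays the role of the dominating
  function when nodes escape to infinity.\<close>

lemma cell_majorant:
  assumes c: "c \<in> ell1 \<Gamma>"
  shows "(\<lambda>k. \<Sum>\<^sub>\<infinity>\<gamma>\<in>\<Gamma>. norm (c \<gamma>) * \<theta> (k - q \<gamma>)) summable_on UNIV"
    and "S \<subseteq> \<Gamma> \<Longrightarrow> finite S \<Longrightarrow> norm (\<Sum>\<gamma>\<in>S. c \<gamma> * F \<gamma> x) \<le> (\<Sum>\<^sub>\<infinity>\<gamma>\<in>\<Gamma>. norm (c \<gamma>) * \<theta> (q x - q \<gamma>))"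
proof -
  have sc: "(\<lambda>\<gamma>. norm (c \<gamma>)) summable_on \<Gamma>" using c by (simp add: ell1_def)
  have s: "(\<lambda>\<gamma>. norm (c \<gamma>) * \<theta> (k - q \<gamma>)) summable_on \<Gamma>" for k
    by (rule summable_on_bound_real[OF summable_on_cmult_left[OF sc, of S\<theta>]]) (auto simp: \<theta>_nonneg intro!: mult_left_mono \<theta>_le)
  show "(\<lambda>k. \<Sum>\<^sub>\<infinity>\<gamma>\<in>\<Gamma>. norm (c \<gamma>) * \<theta> (k - q \<gamma>)) summable_on UNIV"
  proof (rule nonneg_bdd_above_summable_on)
    have "(\<Sum>k\<in>K. \<Sum>\<^sub>\<infinity>\<gamma>\<in>\<Gamma>. norm (c \<gamma>) * \<theta> (k - q \<gamma>)) \<le> (\<Sum>\<^sub>\<infinity>\<gamma>\<in>\<Gamma>. norm (c \<gamma>)) * S\<theta>" if K: "finite K" for K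
    proof (rule has_sum_mono)
      show "((\<lambda>\<gamma>. \<Sum>k\<in>K. norm (c \<gamma>) * \<theta> (k - q \<gamma>)) has_sum (\<Sum>k\<in>K. \<Sum>\<^sub>\<infinity>\<gamma>\<in>\<Gamma>. norm (c \<gamma>) * \<theta> (k - q \<gamma>))) \<Gamma>"
        by (rule has_sum_sum[OF K has_sum_infsum[OF s]])
      show "((\<lambda>\<gamma>. norm (c \<gamma>) * S\<theta>) has_sum ((\<Sum>\<^sub>\<infinity>\<gamma>\<in>\<Gamma>. norm (c \<gamma>)) * S\<theta>)) \<Gamma>"
        by (rule has_sum_cmult_left[OF has_sum_infsum[OF sc]])
      fix \<gamma>
      have "(\<Sum>k\<in>K. \<theta> (k - q \<gamma>)) \<le> S\<theta>"
        using finite_sum_le_has_sum[OF \<theta>_shift[of "q \<gamma>"] K] \<theta>_nonneg by simp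
      then show "(\<Sum>k\<in>K. norm (c \<gamma>) * \<theta> (k - q \<gamma>)) \<le> norm (c \<gamma>) * S\<theta>"
        unfolding sum_distrib_left[symmetric] by (intro mult_left_mono) auto
    qed
    then show "bdd_above (sum (\<lambda>k. \<Sum>\<^sub>\<infinity>\<gamma>\<in>\<Gamma>. norm (c \<gamma>) * \<theta> (k - q \<gamma>)) ` {K. K \<subseteq> UNIV \<and> finite K})"
      by (intro bdd_aboveI2) auto
  qed (auto simp: \<theta>_nonneg intro!: infsum_nonneg)
  assume S: "S \<subseteq> \<Gamma>" "finite S"
  have "norm (\<Sum>\<gamma>\<in>S. c \<gamma> * F \<gamma> x) \<le> (\<Sum>\<gamma>\<in>S. norm (c \<gamma>) * \<theta> (q x - q \<gamma>))"
    using S by (intro sum_norm_le term_le) auto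
  also have "\<dots> \<le> (\<Sum>\<^sub>\<infinity>\<gamma>\<in>\<Gamma>. norm (c \<gamma>) * \<theta> (q x - q \<gamma>))"
    using S by (intro finite_sum_le_infsum s) (auto simp: \<theta>_nonneg)
  finally show "norm (\<Sum>\<gamma>\<in>S. c \<gamma> * F \<gamma> x) \<le> (\<Sum>\<^sub>\<infinity>\<gamma>\<in>\<Gamma>. norm (c \<gamma>) * \<theta> (q x - q \<gamma>))" .
qed

text \<open>At stage \<open>n\<close> the finite expansion bounds \<open>D (d n) x\<close> by the
  node values. Those in the cells of \<open>K\<close> converge; the others are at most the tail of
  the majorant because a cell holds at most one node. This tail is independent of \<open>n\<close>
  and survives the limit.\<close>

lemma finite_sampling:
  assumes c: "c \<in> ell1 \<Gamma>" and K: "finite K"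
  shows "norm (D c x) \<le> (\<Sum>k\<in>K \<inter> E. norm (D c (pt k))) + (\<Sum>\<^sub>\<infinity>k\<in>UNIV - K. \<Sum>\<^sub>\<infinity>\<gamma>\<in>\<Gamma>. norm (c \<gamma>) * \<theta> (k - q \<gamma>))"
proof -
  let ?\<phi> = "\<lambda>k. \<Sum>\<^sub>\<infinity>\<gamma>\<in>\<Gamma>. norm (c \<gamma>) * \<theta> (k - q \<gamma>)"
  have \<phi>0: "0 \<le> ?\<phi> k" for k by (auto simp: \<theta>_nonneg intro!: infsum_nonneg)
  obtain L where L: "0 \<le> L" "\<And>\<gamma>. \<gamma> \<in> \<Gamma> \<Longrightarrow> norm (c \<gamma>) \<le> L" using ell1_bounded[OF c] by blast
  \<comment> \<open>Truncation to \<open>X n\<close> puts the function into the span in which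
    \<open>expand\<close> holds.\<close>
  define d where "d n \<gamma> = (if \<gamma> \<in> X n then c \<gamma> else 0)" for n \<gamma>
  have d_le: "norm (d n \<gamma>) \<le> L" if "\<gamma> \<in> \<Gamma>" for n \<gamma> using L that by (simp add: d_def)
  have Dd: "D (d n) z = (\<Sum>\<gamma>\<in>X n. c \<gamma> * F \<gamma> z)" for n z
  proof -
    have "D (d n) z = (\<Sum>\<gamma>\<in>X n. d n \<gamma> * F \<gamma> z)" by (rule D_finite[OF X(1,2)]) (simp add: d_def)
    also have "\<dots> = (\<Sum>\<gamma>\<in>X n. c \<gamma> * F \<gamma> z)" by (intro sum.cong) (auto simp: d_def)
    finally show ?thesis .
  qed
  have d_lim: "(\<lambda>n. d (r n) \<gamma>) \<longlonglongrightarrow> c \<gamma>" if "\<gamma> \<in> \<Gamma>" for \<gamma>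
  proof -
    have "\<forall>\<^sub>F n in sequentially. finite (X n) \<and> {\<gamma>} \<subseteq> X n \<and> X n \<subseteq> \<Gamma>"
      using X(3) that unfolding filterlim_finite_subsets_at_top by auto
    then have "\<forall>\<^sub>F n in sequentially. c \<gamma> = d n \<gamma>" by (rule eventually_mono) (simp add: d_def)
    then have "(\<lambda>n. d n \<gamma>) \<longlonglongrightarrow> c \<gamma>" by (rule Lim_transform_eventually[OF tendsto_const])
    from LIMSEQ_subseq_LIMSEQ[OF this r] show ?thesis by (simp add: o_def)
  qed
  \<comment> \<open>A cell that is empty at stage \<open>n\<close> contributes zero, so that sums
    over the fixed set \<open>K\<close> can be compared for all \<open>n\<close>.\<close>
  define a where "a n k = (if occ n k then norm (D (d n) (y n (idx n k))) else 0)" for n k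
  have est: "norm (D (d n) x) \<le> (1 + 1 / real (Suc n)) * ((\<Sum>k\<in>K. a n k) + (\<Sum>\<^sub>\<infinity>k\<in>UNIV - K. ?\<phi> k))" for n
  proof -
    let ?I = "{i. i < m n \<and> q (y n i) \<in> K}" and ?J = "{i. i < m n \<and> q (y n i) \<notin> K}"
    have inj: "inj_on (\<lambda>i. q (y n i)) {..<m n}" using node_cell_inj by (auto simp: inj_on_def)
    have "(\<Sum>i\<in>?I. norm (D (d n) (y n i))) = (\<Sum>k\<in>(\<lambda>i. q (y n i)) ` ?I. a n k)"
    proof (subst sum.reindex)
      show "inj_on (\<lambda>i. q (y n i)) ?I" by (rule inj_on_subset[OF inj]) auto
      show "(\<Sum>i\<in>?I. norm (D (d n) (y n i))) = sum (a n \<circ> (\<lambda>i. q (y n i))) ?I"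
        by (intro sum.cong) (auto simp: a_def idx_node occ_def)
    qed
    also have "\<dots> \<le> (\<Sum>k\<in>K. a n k)" using K by (intro sum_mono2) (auto simp: a_def)
    finally have I: "(\<Sum>i\<in>?I. norm (D (d n) (y n i))) \<le> (\<Sum>k\<in>K. a n k)" .
    have "(\<Sum>i\<in>?J. norm (D (d n) (y n i))) \<le> (\<Sum>i\<in>?J. ?\<phi> (q (y n i)))"
      unfolding Dd by (intro sum_mono cell_majorant(2)[OF c] X)
    also have "\<dots> = (\<Sum>k\<in>(\<lambda>i. q (y n i)) ` ?J. ?\<phi> k)"
      by (subst sum.reindex) (auto intro: inj_on_subset[OF inj])
    also have "\<dots> \<le> (\<Sum>\<^sub>\<infinity>k\<in>UNIV - K. ?\<phi> k)"
      by (intro finite_sum_le_infsum summable_on_subset_banach[OF cell_majorant(1)[OF c]]) (auto simp: \<phi>0)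
    finally have J: "(\<Sum>i\<in>?J. norm (D (d n) (y n i))) \<le> (\<Sum>\<^sub>\<infinity>k\<in>UNIV - K. ?\<phi> k)" .
    have "norm (D (d n) x) = norm (\<Sum>i<m n. D (d n) (y n i) * D (cc n i) x)" unfolding Dd by (subst expand) simp
    also have "\<dots> \<le> (\<Sum>i<m n. norm (D (d n) (y n i)) * (1 + 1 / real (Suc n)))"
    proof (rule sum_norm_le)
      fix i assume "i \<in> {..<m n}"
      then show "norm (D (d n) (y n i) * D (cc n i) x) \<le> norm (D (d n) (y n i)) * (1 + 1 / real (Suc n))"
        unfolding norm_mult by (intro mult_left_mono l_le norm_ge_zero) simp
    qed
    also have "\<dots> = (1 + 1 / real (Suc n)) * (\<Sum>i<m n. norm (D (d n) (y n i)))"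
      by (simp only: sum_distrib_left mult.commute)
    also have "(\<Sum>i<m n. norm (D (d n) (y n i))) = (\<Sum>i\<in>?I. norm (D (d n) (y n i))) + (\<Sum>i\<in>?J. norm (D (d n) (y n i)))"
      by (subst sum.union_disjoint[symmetric]) (auto intro!: sum.cong)
    also have "(1 + 1 / real (Suc n)) * \<dots> \<le> (1 + 1 / real (Suc n)) * ((\<Sum>k\<in>K. a n k) + (\<Sum>\<^sub>\<infinity>k\<in>UNIV - K. ?\<phi> k))"
      by (rule mult_left_mono[OF add_mono[OF I J]]) simp
    finally show ?thesis .
  qed
  have a_lim: "(\<lambda>n. a (r n) k) \<longlonglongrightarrow> (if k \<in> E then norm (D c (pt k)) else 0)" for k
  proof (cases "k \<in> E")
    case True
    have "(\<lambda>n. norm (D (d (r n)) (y (r n) (idx (r n) k)))) \<longlonglongrightarrow> norm (D c (pt k))"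
      by (intro tendsto_norm node_evaluation_limit[where K = L] True d_le L d_lim)
    moreover have "\<forall>\<^sub>F n in sequentially. norm (D (d (r n)) (y (r n) (idx (r n) k))) = a (r n) k"
      using True unfolding E_def mem_Collect_eq by (rule eventually_mono) (simp add: a_def)
    ultimately have "(\<lambda>n. a (r n) k) \<longlonglongrightarrow> norm (D c (pt k))" by (rule Lim_transform_eventually)
    then show ?thesis using True by simp
  next
    case False
    have "\<forall>\<^sub>F n in sequentially. 0 = a (r n) k"
      using occ_eventually[OF False] by (rule eventually_mono) (simp add: a_def)
    then show ?thesis using False by (simp add: Lim_transform_eventually[OF tendsto_const])
  qed
  have one: "(\<lambda>n. 1 + 1 / real (Suc (r n))) \<longlonglongrightarrow> 1 + 0"
    using LIMSEQ_subseq_LIMSEQ[OF LIMSEQ_inverse_real_of_nat r] by (intro tendsto_add tendsto_const) (simp add: o_def inverse_eq_divide)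
  have rhs: "(\<lambda>n. (1 + 1 / real (Suc (r n))) * ((\<Sum>k\<in>K. a (r n) k) + (\<Sum>\<^sub>\<infinity>k\<in>UNIV - K. ?\<phi> k)))
     \<longlonglongrightarrow> (1 + 0) * ((\<Sum>k\<in>K. if k \<in> E then norm (D c (pt k)) else 0) + (\<Sum>\<^sub>\<infinity>k\<in>UNIV - K. ?\<phi> k))"
    by (intro tendsto_mult one tendsto_add tendsto_sum a_lim tendsto_const)
  have "(\<lambda>n. D (d (r n)) x - D c x) \<longlonglongrightarrow> 0"
    by (intro D_convergence[where K = L and Q = "{q x}"] d_le L d_lim) auto
  then have lhs: "(\<lambda>n. norm (D (d (r n)) x)) \<longlonglongrightarrow> norm (D c x)" by (intro tendsto_norm) (simp add: LIM_zero_iff)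
  have "norm (D c x) \<le> (1 + 0) * ((\<Sum>k\<in>K. if k \<in> E then norm (D c (pt k)) else 0) + (\<Sum>\<^sub>\<infinity>k\<in>UNIV - K. ?\<phi> k))"
    by (rule tendsto_le[OF sequentially_bot rhs lhs always_eventually]) (intro allI est)
  also have "(\<Sum>k\<in>K. if k \<in> E then norm (D c (pt k)) else 0) = (\<Sum>k\<in>K \<inter> E. norm (D c (pt k)))"
    using K by (simp add: sum.inter_restrict)
  finally show ?thesis by simp
qed

text \<open>Letting the finite set of cells grow removes the tail. The sum is taken in
  \<open>ennreal\<close>, so it is meaningful before its finiteness is known.\<close>

lemma sampling:
  assumes "f \<in> Vp 1 \<Gamma> F"
  shows "Linf_norm f \<le> (\<Sum>\<^sub>\<infinity>z\<in>pt ` E. ennreal (norm (f z)))"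
proof -
  obtain c where c: "c \<in> ell1 \<Gamma>" "\<And>x. f x = D c x" using Vp1_synthesis[OF assms] by blast
  let ?I = "\<Sum>\<^sub>\<infinity>z\<in>pt ` E. ennreal (norm (f z))"
  let ?\<phi> = "\<lambda>k. \<Sum>\<^sub>\<infinity>\<gamma>\<in>\<Gamma>. norm (c \<gamma>) * \<theta> (k - q \<gamma>)"
  have ptw: "ennreal (norm (f x)) \<le> ?I" for x
  proof (rule ennreal_le_epsilon)
    fix e :: real assume e: "0 < e"
    obtain K where K: "finite K" "(\<Sum>\<^sub>\<infinity>k\<in>UNIV - K. ?\<phi> k) < e"
      by (rule finite_subset_approx[OF cell_majorant(1)[OF c(1)] _ e]) (auto simp: \<theta>_nonneg intro!: infsum_nonneg)
    have "norm (f x) \<le> (\<Sum>k\<in>K \<inter> E. norm (f (pt k))) + e"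
      using finite_sampling[OF c(1) K(1), of x] K(2) by (simp add: c(2))
    then have "ennreal (norm (f x)) \<le> ennreal ((\<Sum>k\<in>K \<inter> E. norm (f (pt k))) + e)" by (rule ennreal_leI)
    also have "\<dots> = ennreal (\<Sum>k\<in>K \<inter> E. norm (f (pt k))) + ennreal e" using e by (intro ennreal_plus sum_nonneg) auto
    also have "ennreal (\<Sum>k\<in>K \<inter> E. norm (f (pt k))) = (\<Sum>k\<in>K \<inter> E. ennreal (norm (f (pt k))))" by (simp add: sum_ennreal)
    also have "\<dots> = (\<Sum>z\<in>pt ` (K \<inter> E). ennreal (norm (f z)))"
      by (subst sum.reindex) (auto intro: inj_on_subset[OF pt_inj])
    also have "\<dots> = (\<Sum>\<^sub>\<infinity>z\<in>pt ` (K \<inter> E). ennreal (norm (f z)))" using K(1) by simp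
    also have "\<dots> \<le> ?I" by (rule infsum_mono_neutral) (auto intro: nonneg_summable_on_complete)
    finally show "ennreal (norm (f x)) \<le> ?I + ennreal e" by simp
  qed
  show ?thesis
  proof (cases "?I = top")
    case False
    then have I: "?I = ennreal (enn2real ?I)" by (simp add: less_top)
    have "norm (f x) \<le> enn2real ?I" for x
      using ptw[of x] by (subst (asm) I) simp
    moreover have "f \<in> borel_measurable lebesgue" using assms by (simp add: Vp_def Lp_def)
    ultimately have "Linf_norm f \<le> ennreal (enn2real ?I)" by (intro Linf_norm_le)
    then show ?thesis using I by simp
  qed simp
qed

section \<open>Interpolation series, and the conclusion for the limit nodes\<close>

lemma D_sum:
  assumes "\<And>i \<gamma>. i \<in> S \<Longrightarrow> \<gamma> \<in> \<Gamma> \<Longrightarrow> norm (c i \<gamma>) \<le> K"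
  shows "finite S \<Longrightarrow> D (\<lambda>\<gamma>. \<Sum>i\<in>S. a i * c i \<gamma>) x = (\<Sum>i\<in>S. a i * D (c i) x)"
proof -
  assume S: "finite S"
  have "((\<lambda>\<gamma>. \<Sum>i\<in>S. a i * (c i \<gamma> * F \<gamma> x)) has_sum (\<Sum>i\<in>S. a i * D (c i) x)) \<Gamma>"
    by (intro has_sum_sum S has_sum_cmult_right D_has_sum[where K = K] assms)
  then have "((\<lambda>\<gamma>. (\<Sum>i\<in>S. a i * c i \<gamma>) * F \<gamma> x) has_sum (\<Sum>i\<in>S. a i * D (c i) x)) \<Gamma>"
    by (simp add: sum_distrib_right mult.assoc)
  then show ?thesis unfolding D_def[of "\<lambda>\<gamma>. \<Sum>i\<in>S. a i * c i \<gamma>"] by (rule infsumI)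
qed

text \<open>The series is formed on the level of coefficients: \<open>D d\<close> lies in
  \<open>Vinf\<close> simply because \<open>d\<close> is bounded. The tail of \<open>a\<close>
  controls the coefficients and thereby the functions uniformly, so evaluation at the nodes commutes
  with the sum.\<close>

lemma interpolation_series:
  fixes a :: "real ^ 'd \<Rightarrow> complex" and e :: "real ^ 'd \<Rightarrow> real ^ 'd \<Rightarrow> complex"
  assumes a: "(\<lambda>z. norm (a z)) summable_on \<Lambda>" and e: "\<And>z \<gamma>. z \<in> \<Lambda> \<Longrightarrow> \<gamma> \<in> \<Gamma> \<Longrightarrow> norm (e z \<gamma>) \<le> K" "0 \<le> K"
    and bi: "\<And>z t. z \<in> \<Lambda> \<Longrightarrow> t \<in> \<Lambda> \<Longrightarrow> D (e z) t = (if z = t then 1 else 0)"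
  shows "\<exists>f\<in>Vinf \<Gamma> F. ((\<lambda>S. Linf_norm (\<lambda>x. f x - (\<Sum>z\<in>S. a z * D (e z) x))) \<longlongrightarrow> 0) (finite_subsets_at_top \<Lambda>) \<and>
    (\<forall>t\<in>\<Lambda>. f t = a t)"
proof -
  define d where "d \<gamma> = (\<Sum>\<^sub>\<infinity>z\<in>\<Lambda>. a z * e z \<gamma>)" for \<gamma>
  let ?A = "\<Sum>\<^sub>\<infinity>z\<in>\<Lambda>. norm (a z)"
  have as: "(\<lambda>z. norm (a z * e z \<gamma>)) summable_on \<Lambda>" if "\<gamma> \<in> \<Gamma>" for \<gamma>
    by (rule summable_on_bound_real[OF summable_on_cmult_left[OF a, of K]]) (auto simp: norm_mult that intro!: mult_left_mono e)
  have tail: "norm (d \<gamma> - (\<Sum>z\<in>S. a z * e z \<gamma>)) \<le> (?A - (\<Sum>z\<in>S. norm (a z))) * K"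
    if S: "finite S" "S \<subseteq> \<Lambda>" and g: "\<gamma> \<in> \<Gamma>" for S \<gamma>
  proof -
    have sm: "(\<lambda>z. a z * e z \<gamma>) summable_on (\<Lambda> - S)"
      by (rule summable_on_subset_banach[OF abs_summable_summable[OF as[OF g]]]) auto
    have sma: "(\<lambda>z. norm (a z * e z \<gamma>)) summable_on (\<Lambda> - S)" by (rule summable_on_subset_banach[OF as[OF g]]) auto
    have aS: "(\<lambda>z. norm (a z)) summable_on (\<Lambda> - S)" by (rule summable_on_subset_banach[OF a]) auto
    have "d \<gamma> = (\<Sum>\<^sub>\<infinity>z\<in>S \<union> (\<Lambda> - S). a z * e z \<gamma>)" using S(2) by (simp add: d_def Un_absorb1)
    also have "\<dots> = (\<Sum>z\<in>S. a z * e z \<gamma>) + (\<Sum>\<^sub>\<infinity>z\<in>\<Lambda> - S. a z * e z \<gamma>)"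
      using S(1) by (subst infsum_Un_disjoint) (auto intro: sm)
    finally have "norm (d \<gamma> - (\<Sum>z\<in>S. a z * e z \<gamma>)) = norm (\<Sum>\<^sub>\<infinity>z\<in>\<Lambda> - S. a z * e z \<gamma>)" by simp
    also have "\<dots> \<le> (\<Sum>\<^sub>\<infinity>z\<in>\<Lambda> - S. norm (a z * e z \<gamma>))" by (rule norm_infsum_bound[OF sma])
    also have "\<dots> \<le> (\<Sum>\<^sub>\<infinity>z\<in>\<Lambda> - S. norm (a z) * K)"
      by (intro infsum_mono sma summable_on_cmult_left aS) (auto simp: norm_mult g intro!: mult_left_mono e)
    also have "\<dots> = (\<Sum>\<^sub>\<infinity>z\<in>\<Lambda> - S. norm (a z)) * K" by (rule infsum_cmult_left')
    also have "(\<Sum>\<^sub>\<infinity>z\<in>\<Lambda> - S. norm (a z)) = ?A - (\<Sum>z\<in>S. norm (a z))"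
      using infsum_Un_disjoint[of "\<lambda>z. norm (a z)" S "\<Lambda> - S"] S aS by (simp add: Un_absorb1)
    finally show ?thesis .
  qed
  have d_le: "norm (d \<gamma>) \<le> ?A * K" if "\<gamma> \<in> \<Gamma>" for \<gamma> using tail[of "{}" \<gamma>] that by simp
  have A0: "0 \<le> ?A * K" using e(2) by (simp add: infsum_nonneg)
  have Vi: "D d \<in> Vinf \<Gamma> F" by (rule D_in_Vinf[where K = "?A * K"]) (simp_all add: d_le A0)
  have diff: "norm (D d x - (\<Sum>z\<in>S. a z * D (e z) x)) \<le> (?A - (\<Sum>z\<in>S. norm (a z))) * K * (real N * S\<theta>)"
    if S: "finite S" "S \<subseteq> \<Lambda>" for S x
  proof -
    have "(\<Sum>z\<in>S. norm (a z)) \<le> ?A" using S by (intro finite_sum_le_infsum a) auto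
    then have nn: "0 \<le> (?A - (\<Sum>z\<in>S. norm (a z))) * K" using e(2) by simp
    have bd: "norm (\<Sum>z\<in>S. a z * e z \<gamma>) \<le> (\<Sum>z\<in>S. norm (a z) * K)" if "\<gamma> \<in> \<Gamma>" for \<gamma>
      using S(2) that by (intro sum_norm_le) (auto simp: norm_mult intro!: mult_left_mono e)
    have "(\<Sum>z\<in>S. a z * D (e z) x) = D (\<lambda>\<gamma>. \<Sum>z\<in>S. a z * e z \<gamma>) x"
      using S e(1) by (intro D_sum[symmetric, where K = K]) auto
    then have "D d x - (\<Sum>z\<in>S. a z * D (e z) x) = D (\<lambda>\<gamma>. d \<gamma> - (\<Sum>z\<in>S. a z * e z \<gamma>)) x"
      using D_diff[where c = d and d = "\<lambda>\<gamma>. \<Sum>z\<in>S. a z * e z \<gamma>", OF d_le bd] by simp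
    then show ?thesis
      using D_le[where c = "\<lambda>\<gamma>. d \<gamma> - (\<Sum>z\<in>S. a z * e z \<gamma>)", OF tail[OF S] nn] by simp
  qed
  have "((\<lambda>S. (?A - (\<Sum>z\<in>S. norm (a z))) * K * (real N * S\<theta>)) \<longlongrightarrow> (?A - ?A) * K * (real N * S\<theta>)) (finite_subsets_at_top \<Lambda>)"
    using has_sum_infsum[OF a] unfolding has_sum_def by (intro tendsto_mult tendsto_diff tendsto_const)
  then have lim0: "((\<lambda>S. (?A - (\<Sum>z\<in>S. norm (a z))) * K * (real N * S\<theta>)) \<longlongrightarrow> 0) (finite_subsets_at_top \<Lambda>)" by simp
  have Dem: "D (e z) \<in> borel_measurable lebesgue" if "z \<in> \<Lambda>" for z
    by (rule D_bounded_measurable[where K = K]) (auto simp: e that)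
  have Ddm: "D d \<in> borel_measurable lebesgue" by (rule D_bounded_measurable[where K = "?A * K"]) (simp_all add: d_le A0)
  have "((\<lambda>S. Linf_norm (\<lambda>x. D d x - (\<Sum>z\<in>S. a z * D (e z) x))) \<longlongrightarrow> 0) (finite_subsets_at_top \<Lambda>)"
  proof (rule tendsto_sandwich[OF _ _ tendsto_const])
    show "((\<lambda>S. ennreal ((?A - (\<Sum>z\<in>S. norm (a z))) * K * (real N * S\<theta>))) \<longlongrightarrow> 0) (finite_subsets_at_top \<Lambda>)"
      using tendsto_ennrealI[OF lim0] by simp
    show "\<forall>\<^sub>F S in finite_subsets_at_top \<Lambda>. Linf_norm (\<lambda>x. D d x - (\<Sum>z\<in>S. a z * D (e z) x))
        \<le> ennreal ((?A - (\<Sum>z\<in>S. norm (a z))) * K * (real N * S\<theta>))"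
      by (rule eventually_finite_subsets_at_top_weakI)
        (auto intro!: Linf_norm_le borel_measurable_diff borel_measurable_sum borel_measurable_times Ddm Dem diff)
  qed simp
  moreover have "D d t = a t" if t: "t \<in> \<Lambda>" for t
  proof -
    have "((\<lambda>S. D d t - a t) \<longlongrightarrow> 0) (finite_subsets_at_top \<Lambda>)"
    proof (rule Lim_null_comparison[OF _ lim0])
      have "\<forall>\<^sub>F S in finite_subsets_at_top \<Lambda>. finite S \<and> {t} \<subseteq> S \<and> S \<subseteq> \<Lambda>"
        using t by (intro eventually_finite_subsets_at_top[THEN iffD2] exI[of _ "{t}"]) auto
      then show "\<forall>\<^sub>F S in finite_subsets_at_top \<Lambda>. norm (D d t - a t) \<le> (?A - (\<Sum>z\<in>S. norm (a z))) * K * (real N * S\<theta>)"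
      proof (rule eventually_mono)
        fix S assume S: "finite S \<and> {t} \<subseteq> S \<and> S \<subseteq> \<Lambda>"
        have "(\<Sum>z\<in>S. a z * D (e z) t) = (\<Sum>z\<in>S. if z = t then a z else 0)"
          using S t by (intro sum.cong) (auto simp: bi subset_iff)
        also have "\<dots> = a t" using S by simp
        finally show "norm (D d t - a t) \<le> (?A - (\<Sum>z\<in>S. norm (a z))) * K * (real N * S\<theta>)"
          using diff[of S t] S by simp
      qed
    qed
    then show ?thesis by (simp add: tendsto_const_iff)
  qed
  ultimately show ?thesis using Vi by blast
qed

theorem interpolation_and_sampling:
  "\<exists>\<Lambda> :: (real ^ 'd) set. uniform_discrete \<Lambda> \<and>
    (\<exists>l :: real ^ 'd \<Rightarrow> real ^ 'd \<Rightarrow> complex.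
       (\<forall>z\<in>\<Lambda>. l z \<in> Vinf \<Gamma> F \<and> Linf_norm (l z) = 1) \<and>
       (\<forall>z\<in>\<Lambda>. \<forall>t\<in>\<Lambda>. l z t = (if z = t then 1 else 0)) \<and>
       (\<forall>a :: real ^ 'd \<Rightarrow> complex. (\<lambda>z. norm (a z)) summable_on \<Lambda> \<longrightarrow>
          (\<exists>f \<in> Vinf \<Gamma> F.
             ((\<lambda>S. Linf_norm (\<lambda>x. f x - (\<Sum>z\<in>S. a z * l z x))) \<longlongrightarrow> 0)
               (finite_subsets_at_top \<Lambda>) \<and>
             (\<forall>z\<in>\<Lambda>. f z = a z)))) \<and>
    (\<forall>f \<in> Vp 1 \<Gamma> F. Linf_norm f \<le> (\<Sum>\<^sub>\<infinity>z\<in>\<Lambda>. ennreal (norm (f z))))"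
proof -
  define e where "e z = co (the_inv_into E pt z)" for z
  have e: "e (pt k) = co k" if "k \<in> E" for k unfolding e_def by (simp add: the_inv_into_f_f[OF pt_inj that])
  have e_le: "norm (e z \<gamma>) \<le> 2 * C" if "z \<in> pt ` E" "\<gamma> \<in> \<Gamma>" for z \<gamma> using that by (auto simp: e co_le)
  have C2: "0 \<le> 2 * C" using C_nonneg by simp
  have bi: "D (e z) t = (if z = t then 1 else 0)" if "z \<in> pt ` E" "t \<in> pt ` E" for z t
    using that inj_onD[OF pt_inj] by (auto simp: e limit_biorthogonal)
  have V: "D (e z) \<in> Vinf \<Gamma> F" if "z \<in> pt ` E" for z
    by (rule D_in_Vinf[where K = "2 * C"]) (simp_all add: e_le that C2)
  have norm1: "Linf_norm (D (e z)) = 1" if z: "z \<in> pt ` E" for z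
  proof (rule antisym)
    have "D (e z) \<in> borel_measurable lebesgue"
      by (rule D_bounded_measurable[where K = "2 * C"]) (simp_all add: e_le z C2)
    moreover have "norm (D (e z) x) \<le> 1" for x using z by (auto simp: e limit_le)
    ultimately show "Linf_norm (D (e z)) \<le> 1" using Linf_norm_le[of "D (e z)" 1] by simp
    have "continuous_on UNIV (D (e z))"
      by (rule D_continuous[where K = "2 * C"]) (simp_all add: e_le z C2)
    \<comment> \<open>The essential supremum of a continuous function dominates each of its values,
      in particular the value one at its own node.\<close>
    from continuous_le_Linf_norm[OF this, of z] show "1 \<le> Linf_norm (D (e z))" by (simp add: bi z)
  qed
  have "uniform_discrete (pt ` E)"
    unfolding uniform_discrete_def using pt_separated \<delta>(1) by (intro exI[of _ \<delta>]) (force simp: not_less)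
  moreover have "\<forall>a :: real ^ 'd \<Rightarrow> complex. (\<lambda>z. norm (a z)) summable_on pt ` E \<longrightarrow>
          (\<exists>f \<in> Vinf \<Gamma> F. ((\<lambda>S. Linf_norm (\<lambda>x. f x - (\<Sum>z\<in>S. a z * D (e z) x))) \<longlongrightarrow> 0) (finite_subsets_at_top (pt ` E)) \<and>
             (\<forall>z\<in>pt ` E. f z = a z))"
    by (intro allI impI interpolation_series[where K = "2 * C"] e_le C2 bi)
  ultimately show ?thesis using V norm1 bi sampling
    by (intro exI[of _ "pt ` E"] conjI exI[of _ "\<lambda>z. D (e z)"]) auto
qed

end

section \<open>From the localizability hypotheses to the lattice setting\<close>

lemma closed_subspace_L2_sum:
  assumes "closed_subspace_L2 V" "finite S" "\<And>i. i \<in> S \<Longrightarrow> f i \<in> V"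
  shows "(\<lambda>x. \<Sum>i\<in>S. c i * f i x) \<in> V"
  using assms(2,3)
proof (induction S rule: finite_induct)
  case empty
  then show ?case using assms(1) by (simp add: closed_subspace_L2_def)
next
  case (insert i S)
  have add: "\<forall>f\<in>V. \<forall>g\<in>V. (\<lambda>x. f x + g x) \<in> V" and scale: "\<forall>a. \<forall>f\<in>V. (\<lambda>x. a * f x) \<in> V"
    using assms(1) unfolding closed_subspace_L2_def by simp_all
  have "(\<lambda>x. c i * f i x) \<in> V" by (rule scale[rule_format]) (simp add: insert.prems)
  moreover have "(\<lambda>x. \<Sum>i\<in>S. c i * f i x) \<in> V" by (rule insert.IH) (simp add: insert.prems)
  ultimately have "(\<lambda>x. c i * f i x + (\<Sum>i\<in>S. c i * f i x)) \<in> V" by (rule add[rule_format])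
  then show ?case using insert.hyps by simp
qed

lemma Lp_norm_2_sq: "(Lp_norm 2 f)\<^sup>2 = (LINT x|lebesgue. (norm (f x))\<^sup>2)"
proof -
  have "(Lp_norm 2 f)\<^sup>2 = ((LINT x|lebesgue. (norm (f x))\<^sup>2) powr (1 / 2))\<^sup>2"
    by (simp add: Lp_norm_def powr_numeral)
  also have "\<dots> = (LINT x|lebesgue. (norm (f x))\<^sup>2)"
    by (simp add: powr_half_sqrt integral_nonneg)
  finally show ?thesis .
qed

text \<open>The threshold \<open>1 / 2\<close> fits half a Lagrange function, which lies in the unit
  ball and drops from \<open>1 / 2\<close> to 0 between its own node and another one.\<close>

lemma uniformly_localizable_modulus:
  assumes "uniformly_localizable V \<Gamma> F"
  shows "\<exists>\<delta>>0. \<forall>f x y. f \<in> Vinf \<Gamma> F \<longrightarrow> Linf_norm f \<le> 1 \<longrightarrow> dist x y \<le> \<delta> \<longrightarrow> \<bar>norm (f x) - norm (f y)\<bar> < 1 / 2"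
proof -
  define \<omega> where "\<omega> \<delta> = (SUP (x, y)\<in>{(x, y). dist x y \<le> \<delta>}. SUP f\<in>{f \<in> Vinf \<Gamma> F. Linf_norm f \<le> 1}.
        ennreal \<bar>norm (f x) - norm (f y)\<bar>)" for \<delta>
  have "(\<omega> \<longlongrightarrow> 0) (at_right 0)"
    using assms unfolding uniformly_localizable_def \<omega>_def by blast
  then have "\<forall>\<^sub>F \<delta> in at_right 0. \<omega> \<delta> < ennreal (1 / 2)" by (rule order_tendstoD(2)) (subst ennreal_less_zero_iff, simp)
  then obtain b where b: "0 < b" "\<And>\<delta>. 0 < \<delta> \<Longrightarrow> \<delta> < b \<Longrightarrow> \<omega> \<delta> < ennreal (1 / 2)"
    unfolding eventually_at_right_field by blast
  have "\<bar>norm (f x) - norm (f y)\<bar> < 1 / 2" if f: "f \<in> Vinf \<Gamma> F" "Linf_norm f \<le> 1" and d: "dist x y \<le> b / 2" for f x y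
  proof -
    have "ennreal \<bar>norm (f x) - norm (f y)\<bar> \<le> (SUP f\<in>{f \<in> Vinf \<Gamma> F. Linf_norm f \<le> 1}. ennreal \<bar>norm (f x) - norm (f y)\<bar>)"
      by (rule SUP_upper) (use f in simp)
    also have "\<dots> \<le> \<omega> (b / 2)" unfolding \<omega>_def by (rule SUP_upper2[of "(x, y)"]) (use d in auto)
    also have "\<dots> < ennreal (1 / 2)" using b by simp
    finally show ?thesis by (subst (asm) ennreal_less_iff) simp_all
  qed
  then show ?thesis using b(1) by (intro exI[of _ "b / 2"]) auto
qed

text \<open>The smallness of \<open>s\<close> makes points with equal cell offset lie within
  distance one, as the envelope requires. The lower frame bound is specialised to finite
  combinations, which lie in \<open>V\<close> by linearity.\<close>

lemma localizable_localized_frame: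
  fixes V :: "(real ^ 'd \<Rightarrow> complex) set" and s :: real
  assumes loc: "localizable V \<Gamma> F" and s: "0 < s" "2 * s * CARD('d) < 1"
  shows "\<exists>\<theta> N A. localized_frame \<Gamma> F s \<theta> N A"
proof -
  have V: "closed_subspace_L2 V" and rs: "relatively_separated \<Gamma>" and fr: "is_frame V \<Gamma> F"
    and cont: "\<And>\<gamma>. \<gamma> \<in> \<Gamma> \<Longrightarrow> continuous_on UNIV (F \<gamma>)" using loc unfolding localizable_def by blast+
  obtain \<Theta> :: "real ^ 'd \<Rightarrow> real" where \<Theta>: "\<Theta> \<in> W_Linf_L1" "\<And>\<gamma> x. \<gamma> \<in> \<Gamma> \<Longrightarrow> norm (F \<gamma> x) \<le> \<Theta> (x - \<gamma>)"
    using loc unfolding localizable_def by blast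
  have env: "\<exists>\<theta>. (\<forall>k. 0 \<le> \<theta> k) \<and> \<theta> summable_on UNIV \<and> (\<forall>\<gamma>\<in>\<Gamma>. \<forall>x. norm (F \<gamma> x) \<le> \<theta> (cell_of s x - cell_of s \<gamma>))"
    by (intro discrete_envelope[where \<tau> = "\<lambda>\<gamma>. \<gamma>", OF s \<Theta>(1)] cont \<Theta>(2))
  obtain \<theta> where \<theta>: "\<forall>k. 0 \<le> \<theta> k" "\<theta> summable_on UNIV" "\<forall>\<gamma>\<in>\<Gamma>. \<forall>x. norm (F \<gamma> x) \<le> \<theta> (cell_of s x - cell_of s \<gamma>)"
    using env by (elim exE conjE) (rule that)
  obtain N where N: "\<forall>k. finite {\<gamma>\<in>\<Gamma>. cell_of s \<gamma> = k} \<and> card {\<gamma>\<in>\<Gamma>. cell_of s \<gamma> = k} \<le> N"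
    using relatively_separated_cells[OF s rs] by blast
  obtain A B where A: "0 < A" and lower: "\<forall>f\<in>V. (\<lambda>\<gamma>. (norm (L2_inner f (F \<gamma>)))\<^sup>2) summable_on \<Gamma> \<and> A * (Lp_norm 2 f)\<^sup>2 \<le> (\<Sum>\<^sub>\<infinity>\<gamma>\<in>\<Gamma>. (norm (L2_inner f (F \<gamma>)))\<^sup>2) \<and>
        (\<Sum>\<^sub>\<infinity>\<gamma>\<in>\<Gamma>. (norm (L2_inner f (F \<gamma>)))\<^sup>2) \<le> B * (Lp_norm 2 f)\<^sup>2"
    and FV: "\<forall>\<gamma>\<in>\<Gamma>. F \<gamma> \<in> V"
    using fr unfolding is_frame_def by (elim exE conjE) (rule that)
  have "localized_frame \<Gamma> F s \<theta> N A"
  proof unfold_locales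
    fix S c assume S: "finite S" "S \<subseteq> \<Gamma>"
    have "(\<lambda>x. \<Sum>\<gamma>\<in>S. c \<gamma> * F \<gamma> x) \<in> V"
      using S FV by (intro closed_subspace_L2_sum[OF V]) auto
    with lower[THEN bspec] have "A * (Lp_norm 2 (\<lambda>x. \<Sum>\<gamma>\<in>S. c \<gamma> * F \<gamma> x))\<^sup>2
        \<le> (\<Sum>\<^sub>\<infinity>\<gamma>\<in>\<Gamma>. (norm (L2_inner (\<lambda>x. \<Sum>\<gamma>\<in>S. c \<gamma> * F \<gamma> x) (F \<gamma>)))\<^sup>2)" by blast
    then show "A * (LINT x|lebesgue. (norm (\<Sum>\<gamma>\<in>S. c \<gamma> * F \<gamma> x))\<^sup>2)
        \<le> (\<Sum>\<^sub>\<infinity>\<gamma>\<in>\<Gamma>. (norm (L2_inner (\<lambda>x. \<Sum>\<gamma>\<in>S. c \<gamma> * F \<gamma> x) (F \<gamma>)))\<^sup>2)"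
      by (simp only: Lp_norm_2_sq)
  qed (use s(1) N cont \<theta> A in auto)
  then show ?thesis by blast
qed

theorem theorem7p6:
  fixes V :: "(real ^ 'd \<Rightarrow> complex) set"
    and \<Gamma> :: "(real ^ 'd) set"
    and F :: "real ^ 'd \<Rightarrow> real ^ 'd \<Rightarrow> complex"
  assumes "uniformly_localizable V \<Gamma> F"
  shows "\<exists>\<Lambda> :: (real ^ 'd) set. uniform_discrete \<Lambda> \<and>
    (\<exists>l :: real ^ 'd \<Rightarrow> real ^ 'd \<Rightarrow> complex.
       (\<forall>s\<in>\<Lambda>. l s \<in> Vinf \<Gamma> F \<and> Linf_norm (l s) = 1) \<and>
       (\<forall>s\<in>\<Lambda>. \<forall>t\<in>\<Lambda>. l s t = (if s = t then 1 else 0)) \<and>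
       (\<forall>a :: real ^ 'd \<Rightarrow> complex. (\<lambda>s. norm (a s)) summable_on \<Lambda> \<longrightarrow>
          (\<exists>f \<in> Vinf \<Gamma> F.
             ((\<lambda>S. Linf_norm (\<lambda>x. f x - (\<Sum>s\<in>S. a s * l s x))) \<longlongrightarrow> 0)
               (finite_subsets_at_top \<Lambda>) \<and>
             (\<forall>s\<in>\<Lambda>. f s = a s)))) \<and>
    (\<forall>f \<in> Vp 1 \<Gamma> F. Linf_norm f \<le> (\<Sum>\<^sub>\<infinity>s\<in>\<Lambda>. ennreal (norm (f s))))"
proof -
  have loc: "localizable V \<Gamma> F" using assms by (simp add: uniformly_localizable_def)
  obtain \<delta> where \<delta>: "0 < \<delta>" and mod: "\<And>f x y. f \<in> Vinf \<Gamma> F \<Longrightarrow> Linf_norm f \<le> 1 \<Longrightarrow> dist x y \<le> \<delta> \<Longrightarrow> \<bar>norm (f x) - norm (f y)\<bar> < 1 / 2"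
    using uniformly_localizable_modulus[OF assms] by blast
  \<comment> \<open>Small against one for the envelope and the cell count, and against
    \<open>\<delta>\<close> so that separated nodes lie in different cells.\<close>
  define s where "s = min 1 \<delta> / (4 * real CARD('d))"
  have s: "0 < s" "s * CARD('d) = min 1 \<delta> / 4" using \<delta> by (auto simp: s_def)
  then have s2: "2 * s * CARD('d) < 1" "s * CARD('d) \<le> \<delta>" using \<delta> by auto
  obtain \<theta> N A where "localized_frame \<Gamma> F s \<theta> N A"
    using localizable_localized_frame[OF loc s(1) s2(1)] by blast
  then interpret localized_frame \<Gamma> F s \<theta> N A .
  obtain C where C: "0 \<le> C" "\<forall>c K. finite {\<gamma>. c \<gamma> \<noteq> 0} \<longrightarrow> {\<gamma>. c \<gamma> \<noteq> 0} \<subseteq> \<Gamma> \<longrightarrow> 0 < K \<longrightarrow> (\<forall>x. norm (D c x) \<le> K) \<longrightarrow>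
     (\<exists>c'. (\<forall>\<gamma>\<in>\<Gamma>. norm (c' \<gamma>) \<le> C * K) \<and> (\<forall>x. D c' x = D c x))"
    using bounded_coefficients by (elim exE conjE) (rule that)
  obtain X where X: "\<And>n::nat. finite (X n)" "\<And>n. X n \<subseteq> \<Gamma>" "filterlim X (finite_subsets_at_top \<Gamma>) sequentially"
    using countable_exhaustion[OF countable_\<Gamma>] by blast
  define P where "P n m y cc \<longleftrightarrow> (\<forall>i<m. \<forall>k<m. D (cc i) (y k) = (if i = k then 1 else 0)) \<and>
     (\<forall>i<m. \<forall>\<gamma>\<in>\<Gamma>. norm (cc i \<gamma>) \<le> 2 * C) \<and> (\<forall>i<m. \<forall>x. norm (D (cc i) x) \<le> 1 + 1 / real (Suc n)) \<and>
     (\<forall>b x. (\<Sum>\<gamma>\<in>X n. b \<gamma> * F \<gamma> x) = (\<Sum>i<m. (\<Sum>\<gamma>\<in>X n. b \<gamma> * F \<gamma> (y i)) * D (cc i) x))"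
    for n m and y :: "nat \<Rightarrow> real ^ 'd" and cc
  have "\<exists>m y cc. P n m y cc" for n
    unfolding P_def by (rule fekete_nodes[OF C(2,1) X(1,2)]) auto
  then obtain m y cc where P: "\<And>n. P n (m n) (y n) (cc n)" by metis
  interpret fekete_sequence \<Gamma> F s \<theta> N A \<delta> C X m y cc
  proof unfold_locales
    show "\<delta> < dist (y n i) (y n k)" if ik: "i < m n" "k < m n" "i \<noteq> k" for n i k
    proof (rule ccontr)
      assume "\<not> ?thesis"
      then have d: "dist (y n i) (y n k) \<le> \<delta>" by simp
      \<comment> \<open>The Lagrange functions are bounded by
        \<open>1 + 1 / (n + 1) \<le> 2\<close>, so they are halved to enter the unit ball. Two nodes
        within \<open>\<delta>\<close> would give a jump of exactly \<open>1 / 2\<close>, against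
        the modulus.\<close>
      define f where "f x = 1 / 2 * D (cc n i) x" for x
      have f: "f = D (\<lambda>\<gamma>. 1 / 2 * cc n i \<gamma>)" by (intro ext) (simp only: f_def D_cmult)
      have c: "norm (1 / 2 * cc n i \<gamma>) \<le> C" if "\<gamma> \<in> \<Gamma>" for \<gamma>
      proof -
        have "norm (cc n i \<gamma>) \<le> 2 * C" using P[of n] ik(1) that unfolding P_def by blast
        then show ?thesis by (simp add: norm_mult)
      qed
      have le: "norm (f x) \<le> 1" for x
      proof -
        have "norm (D (cc n i) x) \<le> 1 + 1 / real (Suc n)" using P[of n] ik(1) by (simp only: P_def)
        also have "\<dots> \<le> 2" by simp
        finally show ?thesis by (simp add: f_def norm_mult)
      qed
      have "f \<in> Vinf \<Gamma> F" unfolding f by (rule D_in_Vinf[where K = C]) (simp_all only: c C(1))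
      moreover have "f \<in> borel_measurable lebesgue"
        unfolding f by (rule D_bounded_measurable[where K = C]) (simp_all only: c C(1))
      then have "Linf_norm f \<le> 1" using Linf_norm_le[of f 1] le by simp
      ultimately have "\<bar>norm (f (y n i)) - norm (f (y n k))\<bar> < 1 / 2" using mod d by blast
      moreover have "f (y n i) = 1 / 2" "f (y n k) = 0" using P[of n] ik by (simp_all add: P_def f_def)
      ultimately show False by simp
    qed
    show "D (cc n i) (y n k) = (if i = k then 1 else 0)" if "i < m n" "k < m n" for n i k
      using P[of n] that unfolding P_def by blast
    show "norm (cc n i \<gamma>) \<le> 2 * C" if "i < m n" "\<gamma> \<in> \<Gamma>" for n i \<gamma>
      using P[of n] that unfolding P_def by blast
    show "norm (D (cc n i) x) \<le> 1 + 1 / real (Suc n)" if "i < m n" for n i x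
      using P[of n] that unfolding P_def by blast
    show "(\<Sum>\<gamma>\<in>X n. b \<gamma> * F \<gamma> x) = (\<Sum>i<m n. (\<Sum>\<gamma>\<in>X n. b \<gamma> * F \<gamma> (y n i)) * D (cc n i) x)" for n b x
      using P[of n] unfolding P_def by blast
  qed (fact \<delta> s2(2) C(1) X)+
  obtain r :: "nat \<Rightarrow> nat" where r: "strict_mono r" "\<forall>p\<in>UNIV \<times> insert 0 \<Gamma>. \<exists>L. (\<lambda>n. data (r n) p) \<longlonglongrightarrow> L"
    using subsequence_exists by blast
  interpret fekete_limit \<Gamma> F s \<theta> N A \<delta> C X m y cc r
    by unfold_locales (use r in auto)
  show ?thesis by (rule interpolation_and_sampling)
qed

end
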